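(* Let $d\ge1$, $a,\sigma\in\mathbb{R}$ with $\sigma\ne0$, $T>0$, and let $(W_t)_{t\ge0}$ be a standard $d$-dimensional Wiener process. Let $(Z_t)_{t\ge0}$ be the $d$-dimensional Ornstein-Uhlenbeck process given by $dZ_t=aZ_t\,dt+\sigma\,dW_t$, $t\ge0$, $Z_0=0$, and let $R_t:=\|Z_t\|$, $t\ge0$, be its radial part, where $\|\cdot\|$ is the euclidean norm. Then the bridge $(X_t)_{0\le t\le T}$ with endpoints zero over $[0,T]$ derived from $(Z_t)_{t\ge0}$ and the bridge $(Y_t)_{0\le t\le T}$ with endpoints zero over $[0,T]$ derived from $(R_t)_{t\ge0}$ both exist, the processes $(\|X_t\|)_{0\le t\le T}$ and $(Y_t)_{0\le t\le T}$ are Markov processes with the same transition densities, and the laws of $(\|X_t\|)_{0\le t\le T}$ and $(Y_t)_{0\le t\le T}$ on $\left([0,\infty)^{[0,T]},(\mathcal{B}([0,\infty)))^{[0,T]}\right)$ coincide.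
   Context: Bridges. Let $E$ be a complete separable metric space with Borel $\sigma$-algebra $\mathcal{E}$, $\lambda$ a $\sigma$-finite measure on $\mathcal{E}$, $T>0$, $\alpha,b\in E$, and let $(U_t)_{0\le t\le T}$ be a time-homogeneous Markov process with state space $E$ and transition densities $(p^U_t)_{0<t\le T}$ with respect to $\lambda$. For $x,y\in E$ and $0\le s<t<T$ put $$p_{s,t}(x,y):=p^U_{t-s}(x,y)\lim_{\varepsilon\downarrow0}\frac{\int_{B(b,\varepsilon)}p^U_{T-t}(y,z)\,\lambda(dz)}{\int_{B(b,\varepsilon)}p^U_{T-s}(x,z)\,\lambda(dz)}$$ if the right hand side exists and $p_{s,t}(x,y):=0$ otherwise, where $B(b,\varepsilon)$ is the open ball in $E$ with centre $b$ and radius $\varepsilon$. A bridge from $\alpha$ to $b$ over $[0,T]$ derived from $U$ is a Markov process $(V_t)_{0\le t\le T}$ with $\mathsf{P}(V_0=\alpha)=1$, $\mathsf{P}(V_T=b)=1$ and transition densities $(p_{s,t})_{0\le s<t<T}$ with respect to $\lambda$. "Endpoints zero" means $\alpha=b=0$. Transition densities used. Let $\kappa(a,t)=\frac{e^{2at}-1}{2a}$ for $a\ne0$ and $\kappa(0,t)=t$, and let $\nu=\frac d2-1$. For $Z$ (with $E=\mathbb{R}^d$, $\lambda$ Lebesgue measure), $$p^Z_t(x,y)=\frac{1}{(2\pi\sigma^2\kappa(a,t))^{d/2}}\exp\left\{-\frac{\|y-e^{at}x\|^2}{2\sigma^2\kappa(a,t)}\right\},\quad t>0,\ x,y\in\mathbb{R}^d.$$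 The process $R$ is a time-homogeneous Markov process, and for $R$ (with $E=[0,\infty)$, $\lambda$ Lebesgue measure) the transition densities used are, for $t>0$, $$p^R_t(x,y)=\frac{e^{-a\nu t}y^{\nu+1}}{\sigma^2\kappa(a,t)x^\nu}\exp\left\{-\frac{e^{2at}x^2+y^2}{2\sigma^2\kappa(a,t)}\right\}I_\nu\left(\frac{e^{at}xy}{\sigma^2\kappa(a,t)}\right)\quad\text{if }x,y>0,$$ $$p^R_t(0,y)=\frac{y^{2\nu+1}}{2^\nu(\sigma^2\kappa(a,t))^{\nu+1}\Gamma(\nu+1)}\exp\left\{-\frac{y^2}{2\sigma^2\kappa(a,t)}\right\}\quad\text{if }y>0,$$ and for $x\ge0$, $p^R_t(x,0):=\lim_{y\downarrow0}p^R_t(x,y)$, which equals $0$ if $d\ge2$ and $\sqrt{\frac{2}{\pi\sigma^2\kappa(a,t)}}\exp\left\{-\frac{e^{2at}x^2}{2\sigma^2\kappa(a,t)}\right\}$ if $d=1$. Here $I_\nu(z)=\sum_{m=0}^\infty\frac{(z/2)^{2m+\nu}}{m!\,\Gamma(\nu+m+1)}$, $z>0$, is the modified Bessel function of index $\nu$. $(\mathcal{B}([0,\infty)))^{[0,T]}$ denotes the product $\sigma$-algebra. *)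

theory Defs
  imports "HOL-Probability.Probability"
begin

(* A state space E with its reference measure is given as one measure lam with space lam = E;
   E is a subset of an ambient metric space, so that [0,oo) is the set {0..} of reals. *)

definition polish_state_space :: "'e::{metric_space, second_countable_topology} measure \<Rightarrow> bool" where
  "polish_state_space lam \<longleftrightarrow>
     Topological_Spaces.complete (space lam) \<and> sets lam = sets (restrict_space borel (space lam)) \<and>
     sigma_finite_measure lam"

definition past_sigma ::
    "'w measure \<Rightarrow> 'e measure \<Rightarrow> real set \<Rightarrow> (real \<Rightarrow> 'w \<Rightarrow> 'e) \<Rightarrow> real \<Rightarrow> 'w measure" where
  "past_sigma M lam I V s =
     sigma (space M) {V u -` A \<inter> space M | u A. u \<in> I \<and> u \<le> s \<and> A \<in> sets lam}"

definition present_sigma ::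
    "'w measure \<Rightarrow> 'e measure \<Rightarrow> (real \<Rightarrow> 'w \<Rightarrow> 'e) \<Rightarrow> real \<Rightarrow> 'w measure" where
  "present_sigma M lam V s = vimage_algebra (space M) (V s) lam"

definition markov_process ::
    "'w measure \<Rightarrow> 'e measure \<Rightarrow> real set \<Rightarrow> (real \<Rightarrow> 'w \<Rightarrow> 'e) \<Rightarrow> bool" where
  "markov_process M lam I V \<longleftrightarrow>
     prob_space M \<and> (\<forall>t\<in>I. V t \<in> measurable M lam) \<and>
     (\<forall>s\<in>I. \<forall>t\<in>I. s \<le> t \<longrightarrow> (\<forall>A\<in>sets lam. AE w in M.
        real_cond_exp M (past_sigma M lam I V s) (indicator (V t -` A \<inter> space M)) w =
        real_cond_exp M (present_sigma M lam V s) (indicator (V t -` A \<inter> space M)) w))"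

(* p s t x is a probability density for every state x, and it is the density of the
   conditional distribution of V t given V s = x, for s < t in J. *)

definition transition_densities ::
    "'w measure \<Rightarrow> 'e measure \<Rightarrow> real set \<Rightarrow> (real \<Rightarrow> 'w \<Rightarrow> 'e) \<Rightarrow>
     (real \<Rightarrow> real \<Rightarrow> 'e \<Rightarrow> 'e \<Rightarrow> real) \<Rightarrow> bool" where
  "transition_densities M lam J V p \<longleftrightarrow>
     (\<forall>s\<in>J. \<forall>t\<in>J. s < t \<longrightarrow>
        (\<lambda>(x, y). p s t x y) \<in> borel_measurable (lam \<Otimes>\<^sub>M lam) \<and>
        (\<forall>x\<in>space lam. \<forall>y\<in>space lam. 0 \<le> p s t x y) \<and>
        (\<forall>x\<in>space lam. has_bochner_integral lam (p s t x) 1) \<and>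
        (\<forall>A\<in>sets lam. AE w in M.
           real_cond_exp M (present_sigma M lam V s) (indicator (V t -` A \<inter> space M)) w =
           (LINT y:A|lam. p s t (V s w) y)))"

definition homogeneous_markov_process ::
    "'w measure \<Rightarrow> 'e::{metric_space, second_countable_topology} measure \<Rightarrow> real \<Rightarrow>
     (real \<Rightarrow> 'w \<Rightarrow> 'e) \<Rightarrow> (real \<Rightarrow> 'e \<Rightarrow> 'e \<Rightarrow> real) \<Rightarrow> bool" where
  "homogeneous_markov_process N lam T U pU \<longleftrightarrow>
     polish_state_space lam \<and> markov_process N lam {0..T} U \<and>
     transition_densities N lam {0..T} U (\<lambda>s t. pU (t - s))"

definition bridge_ratio ::
    "'e::metric_space measure \<Rightarrow> (real \<Rightarrow> 'e \<Rightarrow> 'e \<Rightarrow> real) \<Rightarrow> real \<Rightarrow> 'e \<Rightarrow>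
     real \<Rightarrow> real \<Rightarrow> 'e \<Rightarrow> 'e \<Rightarrow> real \<Rightarrow> real" where
  "bridge_ratio lam pU T b s t x y e =
     (LINT z:ball b e \<inter> space lam|lam. pU (T - t) y z) /
     (LINT z:ball b e \<inter> space lam|lam. pU (T - s) x z)"

(* If the denominators vanish for small e, the ratio is undefined on paper and 0 here;
   either way the value of bridge_density is 0. *)

definition bridge_density ::
    "'e::metric_space measure \<Rightarrow> (real \<Rightarrow> 'e \<Rightarrow> 'e \<Rightarrow> real) \<Rightarrow> real \<Rightarrow> 'e \<Rightarrow>
     real \<Rightarrow> real \<Rightarrow> 'e \<Rightarrow> 'e \<Rightarrow> real" where
  "bridge_density lam pU T b s t x y =
     (if \<exists>l. (bridge_ratio lam pU T b s t x y \<longlongrightarrow> l) (at_right 0)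
      then pU (t - s) x y * Lim (at_right 0) (bridge_ratio lam pU T b s t x y)
      else 0)"

definition is_bridge ::
    "'w measure \<Rightarrow> (real \<Rightarrow> 'w \<Rightarrow> 'e) \<Rightarrow>
     'e::{metric_space, second_countable_topology} measure \<Rightarrow>
     (real \<Rightarrow> 'e \<Rightarrow> 'e \<Rightarrow> real) \<Rightarrow> real \<Rightarrow> 'e \<Rightarrow> 'e \<Rightarrow>
     'v measure \<Rightarrow> (real \<Rightarrow> 'v \<Rightarrow> 'e) \<Rightarrow> bool" where
  "is_bridge N U lam pU T \<alpha> b M V \<longleftrightarrow>
     homogeneous_markov_process N lam T U pU \<and> \<alpha> \<in> space lam \<and> b \<in> space lam \<and>
     markov_process M lam {0..T} V \<and>
     (AE w in M. V 0 w = \<alpha>) \<and> (AE w in M. V T w = b) \<and>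
     transition_densities M lam {0..<T} V (bridge_density lam pU T b)"

definition wiener_process :: "'w measure \<Rightarrow> (real \<Rightarrow> 'w \<Rightarrow> real ^ 'n) \<Rightarrow> bool" where
  "wiener_process M W \<longleftrightarrow>
     prob_space M \<and>
     (\<forall>t\<ge>0. W t \<in> borel_measurable M) \<and>
     (AE w in M. W 0 w = 0) \<and>
     (AE w in M. continuous_on {0..} (\<lambda>t. W t w)) \<and>
     (\<forall>s t. 0 \<le> s \<longrightarrow> s < t \<longrightarrow>
        distributed M lborel (\<lambda>w. W t w - W s w)
          (\<lambda>x. ennreal (\<Prod>i\<in>UNIV. normal_density 0 (sqrt (t - s)) (x $ i)))) \<and>
     (\<forall>(n::nat) (\<tau> :: nat \<Rightarrow> real). 0 \<le> \<tau> 0 \<longrightarrow> (\<forall>i<n. \<tau> i < \<tau> (Suc i)) \<longrightarrow>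
        prob_space.indep_vars M (\<lambda>_. borel) (\<lambda>i w. W (\<tau> (Suc i)) w - W (\<tau> i) w) {..<n})"

(* The SDE dZ = a Z dt + sigma dW in integrated form. As sigma is constant, its stochastic
   integral over [0,t] is sigma (W t - W 0), so the equation can be read path by path. *)

definition ou_solution ::
    "'w measure \<Rightarrow> (real \<Rightarrow> 'w \<Rightarrow> real ^ 'n) \<Rightarrow> real \<Rightarrow> real \<Rightarrow> (real \<Rightarrow> 'w \<Rightarrow> real ^ 'n) \<Rightarrow> bool" where
  "ou_solution M W a \<sigma> Z \<longleftrightarrow>
     (\<forall>t\<ge>0. Z t \<in> borel_measurable M) \<and>
     (AE w in M. continuous_on {0..} (\<lambda>t. Z t w)) \<and>
     (AE w in M. \<forall>t\<ge>0.
        Z t w = Z 0 w + integral {0..t} (\<lambda>u. a *\<^sub>R Z u w) + \<sigma> *\<^sub>R (W t w - W 0 w))"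

definition kappa :: "real \<Rightarrow> real \<Rightarrow> real" where
  "kappa a t = (if a = 0 then t else (exp (2 * a * t) - 1) / (2 * a))"

definition ou_density :: "real \<Rightarrow> real \<Rightarrow> real \<Rightarrow> real ^ 'n \<Rightarrow> real ^ 'n \<Rightarrow> real" where
  "ou_density a \<sigma> t x y =
     1 / (2 * pi * \<sigma>\<^sup>2 * kappa a t) powr (real CARD('n) / 2) *
     exp (- (norm (y - exp (a * t) *\<^sub>R x))\<^sup>2 / (2 * \<sigma>\<^sup>2 * kappa a t))"

definition bessel_I :: "real \<Rightarrow> real \<Rightarrow> real" where
  "bessel_I \<nu> z = (\<Sum>m. (z / 2) powr (2 * real m + \<nu>) / (fact m * Gamma (\<nu> + real m + 1)))"

definition radial_density_pos :: "real \<Rightarrow> real \<Rightarrow> real \<Rightarrow> real \<Rightarrow> real \<Rightarrow> real \<Rightarrow> real" where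
  "radial_density_pos \<nu> a \<sigma> t x y =
     (if x > 0 then
        exp (- a * \<nu> * t) * y powr (\<nu> + 1) / (\<sigma>\<^sup>2 * kappa a t * x powr \<nu>) *
        exp (- (exp (2 * a * t) * x\<^sup>2 + y\<^sup>2) / (2 * \<sigma>\<^sup>2 * kappa a t)) *
        bessel_I \<nu> (exp (a * t) * x * y / (\<sigma>\<^sup>2 * kappa a t))
      else
        y powr (2 * \<nu> + 1) /
          (2 powr \<nu> * (\<sigma>\<^sup>2 * kappa a t) powr (\<nu> + 1) * Gamma (\<nu> + 1)) *
        exp (- y\<^sup>2 / (2 * \<sigma>\<^sup>2 * kappa a t)))"

definition radial_density :: "nat \<Rightarrow> real \<Rightarrow> real \<Rightarrow> real \<Rightarrow> real \<Rightarrow> real \<Rightarrow> real" where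
  "radial_density d a \<sigma> t x y =
     (let \<nu> = real d / 2 - 1 in
      if y > 0 then radial_density_pos \<nu> a \<sigma> t x y
      else Lim (at_right 0) (radial_density_pos \<nu> a \<sigma> t x))"

definition half_line :: "real measure" where
  "half_line = restrict_space lborel {0..}"

definition path_law :: "'w measure \<Rightarrow> 'e measure \<Rightarrow> real set \<Rightarrow> (real \<Rightarrow> 'w \<Rightarrow> 'e) \<Rightarrow> (real \<Rightarrow> 'e) measure" where
  "path_law M S I V = distr M (Pi\<^sub>M I (\<lambda>_. S)) (\<lambda>w. \<lambda>t\<in>I. V t w)"

end

theory Submission
  imports Defs
begin

text \<open>Both assertions come from a single kernel that is pushed forward by the norm. The transition
density of \<open>Z\<close> is an isotropic Gaussian density centred at \<open>exp (a t) x\<close>, so the law of the norm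
of a step from \<open>x\<close> depends on \<open>x\<close> only through \<open>norm x\<close>; integrating out the direction produces the
Bessel function and hence \<open>radial_density\<close> (\<open>norm_gauss_eq_radial\<close>). A Markov process whose kernel
is compatible with a map in this way stays Markov under the map (\<open>kernel_markov_map\<close>), so \<open>R\<close> is
Markov with the radial densities.

The bridge densities are compared before passing to their defining limit. The ball of radius \<open>e\<close> in the
half line has as its preimage under the norm the ball of radius \<open>e\<close> in \<open>\<real>\<^sup>n\<close>, so the ratio that
defines the bridge density of \<open>R\<close> is literally the ratio that defines the bridge density of \<open>Z\<close>
(\<open>bridge_ratio_radial\<close>). Its limit is a quotient of Gaussian densities at the origin, which is a
function of the two norms. Multiplying both densities by this common factor keeps them related by
the norm (\<open>radial_bridge_push\<close>), and therefore the norm of a bridge of \<open>Z\<close> is a Markov process with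
the densities of the bridge of \<open>R\<close>. Starting point, end point and densities determine all
finite-dimensional distributions, which gives the equality of the laws (\<open>path_law_unique\<close>).

The bridge density of \<open>Z\<close> is again Gaussian with a linear mean (\<open>ou_bridge_density\<close>), so a bridge is
obtained explicitly from the given Wiener process by a deterministic change of time and of scale
(\<open>ou_bridge\<close>), and its norm is a bridge of \<open>R\<close>. That \<open>Z\<close> itself is Markov follows by writing the
innovation \<open>Z t - exp (a (t - s)) Z s\<close> pathwise as a limit of weighted sums of increments of \<open>W\<close>
after time \<open>s\<close> (\<open>ou_riemann_sums\<close>, \<open>ou_increment_gaussian\<close>).\<close>

section \<open>Markov processes described by kernels\<close>

definition density_kernel :: "'e measure \<Rightarrow> ('e \<Rightarrow> 'e \<Rightarrow> real) \<Rightarrow> bool" where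
  "density_kernel lam q \<longleftrightarrow>
     (\<lambda>(x, y). q x y) \<in> borel_measurable (lam \<Otimes>\<^sub>M lam) \<and>
     (\<forall>x\<in>space lam. \<forall>y\<in>space lam. 0 \<le> q x y) \<and>
     (\<forall>x\<in>space lam. has_bochner_integral lam (q x) 1)"

text \<open>This single identity contains both the Markov property between \<open>s\<close> and \<open>t\<close> and the fact that
\<open>q\<close> is a version of the conditional density. Unlike conditional expectations it involves no null sets
and no choice of versions, so it transfers directly to images of the process and to its path space.\<close>

definition kernel_markov ::
    "'w measure \<Rightarrow> 'e measure \<Rightarrow> real set \<Rightarrow> (real \<Rightarrow> 'w \<Rightarrow> 'e) \<Rightarrow> real \<Rightarrow> real \<Rightarrow>
     ('e \<Rightarrow> 'e \<Rightarrow> real) \<Rightarrow> bool" where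
  "kernel_markov M lam I V s t q \<longleftrightarrow>
     (\<forall>B\<in>sets (past_sigma M lam I V s). \<forall>A\<in>sets lam.
        emeasure M (V t -` A \<inter> B) =
        (\<integral>\<^sup>+w. (\<integral>\<^sup>+y. ennreal (q (V s w) y) * indicator A y \<partial>lam) * indicator B w \<partial>M))"

lemma space_past_sigma [simp]: "space (past_sigma M lam I V s) = space M"
  unfolding past_sigma_def by (rule space_measure_of) auto

lemma sets_past_sigma:
  "sets (past_sigma M lam I V s) =
     sigma_sets (space M) {V u -` A \<inter> space M | u A. u \<in> I \<and> u \<le> s \<and> A \<in> sets lam}"
  unfolding past_sigma_def by (rule sets_measure_of) auto

lemma past_sigma_subset:
  assumes "\<And>u A. u \<in> I \<Longrightarrow> u \<le> s \<Longrightarrow> A \<in> sets lam \<Longrightarrow> V u -` A \<inter> space M \<in> sets F"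
    and "space F = space M"
  shows "sets (past_sigma M lam I V s) \<subseteq> sets F"
  unfolding sets_past_sigma assms(2)[symmetric]
  by (rule sets.sigma_sets_subset) (use assms in auto)

lemma subalgebra_past_sigma:
  assumes "\<And>u. u \<in> I \<Longrightarrow> V u \<in> measurable M lam"
  shows "subalgebra M (past_sigma M lam I V s)"
  unfolding subalgebra_def
  using past_sigma_subset[of I s lam V M M] assms by (auto intro: measurable_sets)

lemma measurable_past_sigma:
  assumes "u \<in> I" "u \<le> s" "V u \<in> measurable M lam"
  shows "V u \<in> measurable (past_sigma M lam I V s) lam"
proof (rule measurableI)
  fix A assume "A \<in> sets lam"
  then show "V u -` A \<inter> space (past_sigma M lam I V s) \<in> sets (past_sigma M lam I V s)"
    unfolding sets_past_sigma space_past_sigma using assms(1,2) by (auto intro: sigma_sets.Basic)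
qed (use assms(3) in \<open>auto dest: measurable_space\<close>)

lemma measurable_present_sigma:
  assumes "V s \<in> measurable M lam"
  shows "V s \<in> measurable (present_sigma M lam V s) lam"
  unfolding present_sigma_def
  by (rule measurable_vimage_algebra1) (use assms in \<open>auto dest: measurable_space\<close>)

lemma present_sigma_subset_past:
  assumes "s \<in> I" "V s \<in> measurable M lam"
  shows "sets (present_sigma M lam V s) \<subseteq> sets (past_sigma M lam I V s)"
proof -
  have "V s \<in> space M \<rightarrow> space lam" using assms(2) by (auto dest: measurable_space)
  then show ?thesis
    unfolding present_sigma_def sets_past_sigma
    by (subst sets_vimage_algebra2) (use assms(1) in \<open>auto intro!: sigma_sets.Basic\<close>)
qed

lemma space_present_sigma [simp]: "space (present_sigma M lam V s) = space M"
  by (simp add: present_sigma_def)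

lemma subalgebra_present_sigma:
  assumes "s \<in> I" "\<And>u. u \<in> I \<Longrightarrow> V u \<in> measurable M lam"
  shows "subalgebra M (present_sigma M lam V s)"
  using present_sigma_subset_past[of s I V M lam] subalgebra_past_sigma[of I V M lam s] assms
  unfolding subalgebra_def by auto

lemma sigma_finite_subalgebra_prob:
  assumes "prob_space M" "subalgebra M F"
  shows "sigma_finite_subalgebra M F"
proof -
  interpret prob_space M by fact
  interpret finite_measure_subalgebra M F by unfold_locales fact
  show ?thesis by unfold_locales
qed

lemma density_kernel_nn_integral:
  assumes "density_kernel lam q" "x \<in> space lam" "A \<in> sets lam"
  shows "(\<integral>\<^sup>+y. ennreal (q x y) * indicator A y \<partial>lam) = ennreal (LINT y:A|lam. q x y)"
    and "0 \<le> (LINT y:A|lam. q x y)" and "(LINT y:A|lam. q x y) \<le> 1"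
proof -
  have i: "integrable lam (q x)" "integral\<^sup>L lam (q x) = 1"
    using assms unfolding density_kernel_def has_bochner_integral_iff by auto
  have nn: "\<And>y. y \<in> space lam \<Longrightarrow> 0 \<le> q x y" using assms unfolding density_kernel_def by auto
  have i2: "integrable lam (\<lambda>y. indicator A y *\<^sub>R q x y)"
    using integrable_mult_indicator[OF assms(3) i(1)] .
  have "(\<integral>\<^sup>+y. ennreal (q x y) * indicator A y \<partial>lam) = (\<integral>\<^sup>+y. ennreal (indicator A y *\<^sub>R q x y) \<partial>lam)"
    by (intro nn_integral_cong) (auto split: split_indicator)
  also have "\<dots> = ennreal (LINT y:A|lam. q x y)"
    unfolding set_lebesgue_integral_def
    by (rule nn_integral_eq_integral[OF i2]) (auto simp: nn split: split_indicator)
  finally show "(\<integral>\<^sup>+y. ennreal (q x y) * indicator A y \<partial>lam) = ennreal (LINT y:A|lam. q x y)" .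
  show "0 \<le> (LINT y:A|lam. q x y)" unfolding set_lebesgue_integral_def
    by (rule integral_nonneg_AE) (auto simp: nn)
  have "(LINT y:A|lam. q x y) \<le> integral\<^sup>L lam (q x)" unfolding set_lebesgue_integral_def
    by (rule integral_mono[OF i2 i(1)]) (auto simp: nn split: split_indicator)
  then show "(LINT y:A|lam. q x y) \<le> 1" using i by simp
qed

lemma measurable_kernel_integral [measurable (raw)]:
  assumes "sigma_finite_measure lam" "density_kernel lam q" "A \<in> sets lam"
    and f[measurable]: "f \<in> measurable M lam"
  shows "(\<lambda>w. LINT y:A|lam. q (f w) y) \<in> borel_measurable M"
proof -
  interpret sigma_finite_measure lam by fact
  have [measurable]: "(\<lambda>(x, y). q x y) \<in> borel_measurable (lam \<Otimes>\<^sub>M lam)"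
    using assms(2) unfolding density_kernel_def by auto
  note assms(3)[measurable]
  have "(\<lambda>x. LINT y:A|lam. q x y) \<in> borel_measurable lam"
    unfolding set_lebesgue_integral_def by measurable
  from measurable_compose[OF f this] show ?thesis .
qed

lemma set_integral_indicator_process:
  assumes "prob_space M" "V \<in> measurable M lam" "A \<in> sets lam" "B \<in> sets M"
  shows "ennreal (LINT w:B|M. indicator (V -` A \<inter> space M) w) = emeasure M (V -` A \<inter> B)"
    and "integrable M (indicator (V -` A \<inter> space M) :: _ \<Rightarrow> real)"
proof -
  interpret prob_space M by fact
  have m: "V -` A \<inter> space M \<in> sets M" using assms by (auto intro: measurable_sets)
  then show "integrable M (indicator (V -` A \<inter> space M) :: _ \<Rightarrow> real)"
    by (simp add: integrable_indicator_iff top.not_eq_extremum[symmetric])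
  have eq: "V -` A \<inter> B = B \<inter> (V -` A \<inter> space M)"
    using sets.sets_into_space[OF assms(4)] by auto
  have "(LINT w:B|M. indicator (V -` A \<inter> space M) w) = (\<integral>w. indicator (V -` A \<inter> B) w \<partial>M :: real)"
    unfolding set_lebesgue_integral_def eq
    by (intro Bochner_Integration.integral_cong) (auto split: split_indicator)
  also have "\<dots> = measure M (V -` A \<inter> B)"
    using m assms(4) by (simp add: eq)
  finally show "ennreal (LINT w:B|M. indicator (V -` A \<inter> space M) w) = emeasure M (V -` A \<inter> B)"
    by (simp add: emeasure_eq_measure)
qed

lemma set_integral_kernel:
  assumes "prob_space M" "sigma_finite_measure lam" "density_kernel lam q"
    and V: "V \<in> measurable M lam" and A: "A \<in> sets lam" and B: "B \<in> sets M"
  shows "ennreal (LINT w:B|M. (LINT y:A|lam. q (V w) y)) =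
      (\<integral>\<^sup>+w. (\<integral>\<^sup>+y. ennreal (q (V w) y) * indicator A y \<partial>lam) * indicator B w \<partial>M)"
    and "integrable M (\<lambda>w. LINT y:A|lam. q (V w) y)"
proof -
  interpret prob_space M by fact
  have sp: "\<And>w. w \<in> space M \<Longrightarrow> V w \<in> space lam" using V by (auto dest: measurable_space)
  note k = density_kernel_nn_integral[OF assms(3) sp A]
  show i: "integrable M (\<lambda>w. LINT y:A|lam. q (V w) y)"
  proof (rule integrable_const_bound[where B=1])
    show "AE w in M. norm (LINT y:A|lam. q (V w) y) \<le> 1"
      using k by (intro AE_I2) (auto simp: abs_of_nonneg)
  qed (rule measurable_kernel_integral[OF assms(2,3) A V])
  have i2: "integrable M (\<lambda>w. indicator B w *\<^sub>R (LINT y:A|lam. q (V w) y))"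
    using integrable_mult_indicator[OF B i] .
  have "ennreal (LINT w:B|M. (LINT y:A|lam. q (V w) y)) =
      (\<integral>\<^sup>+w. ennreal (indicator B w *\<^sub>R (LINT y:A|lam. q (V w) y)) \<partial>M)"
    unfolding set_lebesgue_integral_def[of M B]
    by (rule nn_integral_eq_integral[symmetric, OF i2]) (use k in \<open>auto split: split_indicator\<close>)
  also have "\<dots> = (\<integral>\<^sup>+w. (\<integral>\<^sup>+y. ennreal (q (V w) y) * indicator A y \<partial>lam) * indicator B w \<partial>M)"
    by (rule nn_integral_cong) (use k in \<open>auto split: split_indicator\<close>)
  finally show "ennreal (LINT w:B|M. (LINT y:A|lam. q (V w) y)) =
      (\<integral>\<^sup>+w. (\<integral>\<^sup>+y. ennreal (q (V w) y) * indicator A y \<partial>lam) * indicator B w \<partial>M)" .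
qed

text \<open>The kernel integral is a function of \<open>V s\<close>, hence measurable for every sigma-algebra between present and
past, and it has the right integrals over all events of the past. By uniqueness it is the conditional
expectation given each of these sigma-algebras, in particular given the past and given the present.\<close>

lemma cond_exp_kernel_markov:
  assumes M: "prob_space M" and lam: "sigma_finite_measure lam"
    and V: "\<And>u. u \<in> I \<Longrightarrow> V u \<in> measurable M lam" "s \<in> I" "t \<in> I"
    and q: "density_kernel lam q" and km: "kernel_markov M lam I V s t q"
    and F: "space F = space M" "sets F \<subseteq> sets (past_sigma M lam I V s)" "V s \<in> measurable F lam"
    and A: "A \<in> sets lam"
  shows "AE w in M. real_cond_exp M F (indicator (V t -` A \<inter> space M)) w = (LINT y:A|lam. q (V s w) y)"
proof -
  have sub: "subalgebra M F"
    using subalgebra_past_sigma[of I V M lam s] V F unfolding subalgebra_def by auto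
  interpret sigma_finite_subalgebra M F by (rule sigma_finite_subalgebra_prob[OF M sub])
  show ?thesis
  proof (rule real_cond_exp_charact)
    fix B assume B: "B \<in> sets F"
    then have B': "B \<in> sets M" using sub unfolding subalgebra_def by auto
    have "ennreal (LINT w:B|M. indicator (V t -` A \<inter> space M) w) =
        ennreal (LINT w:B|M. (LINT y:A|lam. q (V s w) y))"
      using set_integral_indicator_process(1)[OF M V(1)[OF V(3)] A B']
        set_integral_kernel(1)[OF M lam q V(1)[OF V(2)] A B'] km B F A
      unfolding kernel_markov_def by auto
    moreover have "0 \<le> (LINT w:B|M. indicator (V t -` A \<inter> space M) w :: real)"
      unfolding set_lebesgue_integral_def by (rule integral_nonneg_AE) auto
    moreover have "0 \<le> (LINT w:B|M. (LINT y:A|lam. q (V s w) y))"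
      unfolding set_lebesgue_integral_def[of M B]
      using density_kernel_nn_integral(2)[OF q _ A] V(1)[OF V(2)]
      by (intro integral_nonneg_AE AE_I2) (auto dest: measurable_space)
    ultimately show "(LINT w:B|M. indicator (V t -` A \<inter> space M) w) =
        (LINT w:B|M. (LINT y:A|lam. q (V s w) y))"
      by simp
  qed (rule set_integral_indicator_process(2)[OF M V(1)[OF V(3)] A sets.top],
      rule set_integral_kernel(2)[OF M lam q V(1)[OF V(2)] A sets.top],
      rule measurable_kernel_integral[OF lam q A F(3)])
qed

lemma kernel_markov_of_markov_process:
  assumes lam: "sigma_finite_measure lam"
    and mp: "markov_process M lam I V" and td: "transition_densities M lam J V p"
    and st: "s \<in> J" "t \<in> J" "s < t" "J \<subseteq> I"
  shows "density_kernel lam (p s t)" "kernel_markov M lam I V s t (p s t)"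
proof -
  show q: "density_kernel lam (p s t)"
    using td st unfolding transition_densities_def density_kernel_def by blast
  have M: "prob_space M" and V: "\<And>u. u \<in> I \<Longrightarrow> V u \<in> measurable M lam"
    using mp unfolding markov_process_def by auto
  have I: "s \<in> I" "t \<in> I" using st by auto
  have sub: "subalgebra M (past_sigma M lam I V s)" by (rule subalgebra_past_sigma[OF V])
  interpret sigma_finite_subalgebra M "past_sigma M lam I V s"
    by (rule sigma_finite_subalgebra_prob[OF M sub])
  show "kernel_markov M lam I V s t (p s t)"
    unfolding kernel_markov_def
  proof (intro ballI)
    fix B A assume B: "B \<in> sets (past_sigma M lam I V s)" and A: "A \<in> sets lam"
    then have B': "B \<in> sets M" using sub unfolding subalgebra_def by auto
    let ?f = "indicator (V t -` A \<inter> space M) :: _ \<Rightarrow> real"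
    have ae: "AE w in M. real_cond_exp M (past_sigma M lam I V s) ?f w = (LINT y:A|lam. p s t (V s w) y)"
    proof -
      have "AE w in M. real_cond_exp M (past_sigma M lam I V s) ?f w =
          real_cond_exp M (present_sigma M lam V s) ?f w"
        using mp I st A unfolding markov_process_def by auto
      moreover have "AE w in M. real_cond_exp M (present_sigma M lam V s) ?f w =
          (LINT y:A|lam. p s t (V s w) y)"
        using td st A unfolding transition_densities_def by auto
      ultimately show ?thesis by eventually_elim simp
    qed
    have "(LINT w:B|M. ?f w) = (LINT w:B|M. real_cond_exp M (past_sigma M lam I V s) ?f w)"
      by (rule real_cond_exp_intA[OF set_integral_indicator_process(2)[OF M V[OF I(2)] A B'] B])
    also have "\<dots> = (LINT w:B|M. (LINT y:A|lam. p s t (V s w) y))"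
      unfolding set_lebesgue_integral_def[of M B]
    proof (rule integral_cong_AE)
      show "(\<lambda>w. indicat_real B w *\<^sub>R (LINT y:A|lam. p s t (V s w) y)) \<in> borel_measurable M"
        using measurable_kernel_integral[OF lam q A V[OF I(1)]] B' by simp
      show "(\<lambda>x. indicat_real B x *\<^sub>R real_cond_exp M (past_sigma M lam I V s) ?f x) \<in> borel_measurable M"
        using B' by simp
    qed (use ae in auto)
    finally show "emeasure M (V t -` A \<inter> B) =
        (\<integral>\<^sup>+w. (\<integral>\<^sup>+y. ennreal (p s t (V s w) y) * indicator A y \<partial>lam) * indicator B w \<partial>M)"
      using set_integral_indicator_process(1)[OF M V[OF I(2)] A B']
        set_integral_kernel(1)[OF M lam q V[OF I(1)] A B'] by simp
  qed
qed

text \<open>This covers the terminal time of a bridge, where there is no transition density: the process is almost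
surely constant there, and conditioning has no effect.\<close>

lemma real_cond_exp_AE_const:
  assumes M: "prob_space M" and F: "subalgebra M F"
    and V: "V \<in> measurable M lam" and A: "A \<in> sets lam" and c: "AE w in M. V w = c"
  shows "AE w in M. real_cond_exp M F (indicator (V -` A \<inter> space M)) w = indicator A c"
proof -
  interpret sigma_finite_subalgebra M F by (rule sigma_finite_subalgebra_prob[OF M F])
  interpret M: prob_space M by fact
  have [measurable]: "V -` A \<inter> space M \<in> sets M" using V A by (auto intro: measurable_sets)
  show ?thesis
  proof (rule real_cond_exp_charact)
    fix B assume "B \<in> sets F"
    then have B[measurable]: "B \<in> sets M" using F unfolding subalgebra_def by auto
    show "(LINT w:B|M. indicator (V -` A \<inter> space M) w) = (LINT w:B|M. indicat_real A c)"
      unfolding set_lebesgue_integral_def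
    proof (rule integral_cong_AE)
      have "AE w in M. w \<in> space M" by simp
      then show "AE w in M. indicat_real B w *\<^sub>R indicat_real (V -` A \<inter> space M) w =
          indicat_real B w *\<^sub>R indicat_real A c"
        using c by eventually_elim (auto split: split_indicator)
    qed measurable
  qed (rule set_integral_indicator_process(2)[OF M V A sets.top], simp_all)
qed

text \<open>Times outside \<open>J\<close> are terminal times at which the process is deterministic; they come after all times
in it, so that no transition into \<open>J\<close> starts from them.\<close>

lemma markov_process_of_kernel:
  assumes M: "prob_space M" and lam: "sigma_finite_measure lam"
    and V: "\<And>u. u \<in> I \<Longrightarrow> V u \<in> measurable M lam"
    and JI: "J \<subseteq> I"
    and q: "\<And>s t. s \<in> J \<Longrightarrow> t \<in> J \<Longrightarrow> s < t \<Longrightarrow> density_kernel lam (p s t)"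
    and km: "\<And>s t. s \<in> J \<Longrightarrow> t \<in> J \<Longrightarrow> s < t \<Longrightarrow> kernel_markov M lam I V s t (p s t)"
    and c: "\<And>t. t \<in> I - J \<Longrightarrow> (AE w in M. V t w = c) \<and> (\<forall>s\<in>J. s < t)"
  shows "markov_process M lam I V" "transition_densities M lam J V p"
proof -
  have sub: "subalgebra M (past_sigma M lam I V s)" for s
    by (rule subalgebra_past_sigma) (rule V)
  have sub2: "subalgebra M (present_sigma M lam V s)" if "s \<in> I" for s
    by (rule subalgebra_present_sigma[OF that]) (rule V)
  have pres: "AE w in M. real_cond_exp M (present_sigma M lam V s) (indicator (V t -` A \<inter> space M)) w =
      (LINT y:A|lam. p s t (V s w) y)"
    if st: "s \<in> J" "t \<in> J" "s < t" and A: "A \<in> sets lam" for s t A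
  proof (rule cond_exp_kernel_markov[where I=I])
    have s: "s \<in> I" using st JI by auto
    show "sets (present_sigma M lam V s) \<subseteq> sets (past_sigma M lam I V s)"
      by (rule present_sigma_subset_past[where V=V, OF s V[OF s]])
    show "V s \<in> measurable (present_sigma M lam V s) lam"
      by (rule measurable_present_sigma[where V=V, OF V[OF s]])
  qed (use M lam V q[OF st] km[OF st] st JI A in auto)
  have past: "AE w in M. real_cond_exp M (past_sigma M lam I V s) (indicator (V t -` A \<inter> space M)) w =
      (LINT y:A|lam. p s t (V s w) y)"
    if st: "s \<in> J" "t \<in> J" "s < t" and A: "A \<in> sets lam" for s t A
  proof (rule cond_exp_kernel_markov[where I=I])
    have s: "s \<in> I" using st JI by auto
    show "V s \<in> measurable (past_sigma M lam I V s) lam"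
      by (rule measurable_past_sigma[where V=V, OF s order_refl V[OF s]])
  qed (use M lam V q[OF st] km[OF st] st JI A in auto)
  show "transition_densities M lam J V p"
    unfolding transition_densities_def
    using q pres unfolding density_kernel_def by blast
  show "markov_process M lam I V"
    unfolding markov_process_def
  proof (intro conjI ballI impI M V)
    fix s t A assume st: "s \<in> I" "t \<in> I" "s \<le> t" and A: "A \<in> sets lam"
    let ?P = "past_sigma M lam I V s" and ?Q = "present_sigma M lam V s"
    let ?f = "indicator (V t -` A \<inter> space M) :: _ \<Rightarrow> real"
    consider "t \<notin> J" | "s = t" | "t \<in> J" "s < t" using st by linarith
    then show "AE w in M. real_cond_exp M ?P ?f w = real_cond_exp M ?Q ?f w"
    proof cases
      case 1
      then have "AE w in M. V t w = c" using c[of t] st by auto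
      then have "AE w in M. real_cond_exp M ?P ?f w = indicator A c"
        "AE w in M. real_cond_exp M ?Q ?f w = indicator A c"
        using real_cond_exp_AE_const[OF M sub V[OF st(2)] A]
          real_cond_exp_AE_const[OF M sub2[OF st(1)] V[OF st(2)] A] by auto
      then show ?thesis by eventually_elim simp
    next
      case 2
      interpret P: sigma_finite_subalgebra M ?P by (rule sigma_finite_subalgebra_prob[OF M sub])
      interpret Q: sigma_finite_subalgebra M ?Q by (rule sigma_finite_subalgebra_prob[OF M sub2[OF st(1)]])
      have int: "integrable M ?f" by (rule set_integral_indicator_process(2)[OF M V A sets.top]) (rule st)
      have "AE w in M. real_cond_exp M ?P ?f w = ?f w"
        by (rule P.real_cond_exp_F_meas[OF int])
          (use 2 measurable_sets[OF measurable_past_sigma[where V=V, OF st(1) order_refl V[OF st(1)]] A] in auto)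
      moreover have "AE w in M. real_cond_exp M ?Q ?f w = ?f w"
        by (rule Q.real_cond_exp_F_meas[OF int])
          (use 2 measurable_sets[OF measurable_present_sigma[where V=V, OF V[OF st(1)]] A] in auto)
      ultimately show ?thesis by eventually_elim simp
    next
      case 3
      then have "s \<in> J" using c[of s] st by (metis DiffI less_asym)
      with pres[OF _ 3 A] past[OF _ 3 A] have
        "AE w in M. real_cond_exp M ?Q ?f w = (LINT y:A|lam. p s t (V s w) y)"
        "AE w in M. real_cond_exp M ?P ?f w = (LINT y:A|lam. p s t (V s w) y)" by auto
      then show ?thesis by eventually_elim simp
    qed
  qed
qed

section \<open>Images, path spaces and uniqueness of finite-dimensional distributions\<close>

text \<open>The lumping criterion: if the law of \<open>f\<close> after one step from \<open>x\<close> depends on \<open>x\<close> only through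
\<open>f x\<close>, the identity for \<open>V\<close> tests more events than the identity for the image, because the
past of the image is contained in the past of \<open>V\<close>.\<close>

lemma kernel_markov_map:
  assumes km: "kernel_markov M lam I V s t q"
    and f: "f \<in> measurable lam lam'"
    and V: "\<And>u. u \<in> I \<Longrightarrow> V u \<in> measurable M lam" and st: "s \<in> I" "t \<in> I"
    and push: "\<And>x A. x \<in> space lam \<Longrightarrow> A \<in> sets lam' \<Longrightarrow>
      (\<integral>\<^sup>+y. ennreal (q x y) * indicator (f -` A \<inter> space lam) y \<partial>lam) =
      (\<integral>\<^sup>+z. ennreal (q' (f x) z) * indicator A z \<partial>lam')"
  shows "kernel_markov M lam' I (\<lambda>u w. f (V u w)) s t q'"
  unfolding kernel_markov_def
proof (intro ballI)
  fix B A assume B: "B \<in> sets (past_sigma M lam' I (\<lambda>u w. f (V u w)) s)" and A: "A \<in> sets lam'"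
  have sub: "sets (past_sigma M lam' I (\<lambda>u w. f (V u w)) s) \<subseteq> sets (past_sigma M lam I V s)"
  proof (rule past_sigma_subset)
    fix u C assume u: "u \<in> I" "u \<le> s" and C: "C \<in> sets lam'"
    have "(\<lambda>w. f (V u w)) -` C \<inter> space M = V u -` (f -` C \<inter> space lam) \<inter> space M"
      using V[OF u(1)] by (auto dest: measurable_space)
    then show "(\<lambda>w. f (V u w)) -` C \<inter> space M \<in> sets (past_sigma M lam I V s)"
      unfolding sets_past_sigma using u measurable_sets[OF f C] by (intro sigma_sets.Basic) blast
  qed simp
  have BM: "B \<subseteq> space M" using sets.sets_into_space[OF B] by simp
  have sp: "\<And>w. w \<in> space M \<Longrightarrow> V s w \<in> space lam" "\<And>w. w \<in> space M \<Longrightarrow> V t w \<in> space lam"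
    using V st by (auto dest: measurable_space)
  have "(\<lambda>w. f (V t w)) -` A \<inter> B = V t -` (f -` A \<inter> space lam) \<inter> B"
    using BM sp by auto
  then have "emeasure M ((\<lambda>w. f (V t w)) -` A \<inter> B) =
      (\<integral>\<^sup>+w. (\<integral>\<^sup>+y. ennreal (q (V s w) y) * indicator (f -` A \<inter> space lam) y \<partial>lam) * indicator B w \<partial>M)"
    using km B sub measurable_sets[OF f A] unfolding kernel_markov_def by (simp only:) blast
  also have "\<dots> = (\<integral>\<^sup>+w. (\<integral>\<^sup>+y. ennreal (q' (f (V s w)) y) * indicator A y \<partial>lam') * indicator B w \<partial>M)"
    by (rule nn_integral_cong) (use push sp A in simp)
  finally show "emeasure M ((\<lambda>w. f (V t w)) -` A \<inter> B) = \<dots>" .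
qed

lemma measurable_kernel_nn_integral:
  assumes "sigma_finite_measure lam" "density_kernel lam q"
    and f[measurable]: "f \<in> borel_measurable lam"
  shows "(\<lambda>x. \<integral>\<^sup>+y. ennreal (q x y) * f y \<partial>lam) \<in> borel_measurable lam"
proof -
  interpret sigma_finite_measure lam by fact
  have [measurable]: "(\<lambda>(x, y). q x y) \<in> borel_measurable (lam \<Otimes>\<^sub>M lam)"
    using assms(2) unfolding density_kernel_def by auto
  show ?thesis by measurable
qed

text \<open>The kernel identity only speaks about the law of the process, so it passes to the coordinate process;
this provides processes on a prescribed sample space.\<close>

lemma kernel_markov_path_space:
  assumes M: "prob_space M" and lam: "sigma_finite_measure lam"
    and V: "\<And>u. V u \<in> measurable M lam"
    and q: "density_kernel lam q" and km: "kernel_markov M lam I V s t q"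
  shows "kernel_markov (distr M (Pi\<^sub>M UNIV (\<lambda>_. lam)) (\<lambda>w u. V u w)) lam I (\<lambda>u x. x u) s t q"
    (is "kernel_markov ?P lam I ?X s t q")
  unfolding kernel_markov_def
proof (intro ballI)
  fix B A assume B: "B \<in> sets (past_sigma ?P lam I ?X s)" and A: "A \<in> sets lam"
  let ?h = "\<lambda>w u. V u w"
  have h[measurable]: "?h \<in> measurable M (Pi\<^sub>M UNIV (\<lambda>_. lam))"
    using measurable_PiM_single'[of UNIV "\<lambda>u w. V u w" M "\<lambda>_. lam"] V
    by (auto simp: PiE_def dest: measurable_space)
  have X[measurable]: "?X u \<in> measurable (Pi\<^sub>M UNIV (\<lambda>_. lam)) lam" for u
    by (rule measurable_component_singleton) simp
  have sp: "?h w \<in> space (Pi\<^sub>M UNIV (\<lambda>_. lam))" if "w \<in> space M" for w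
    using measurable_space[OF h that] .
  have "?h \<in> measurable (past_sigma M lam I V s) (past_sigma ?P lam I ?X s)"
    unfolding past_sigma_def[of ?P]
  proof (rule measurable_measure_of)
    fix C assume "C \<in> {?X u -` A \<inter> space ?P |u A. u \<in> I \<and> u \<le> s \<and> A \<in> sets lam}"
    then obtain u D where C: "C = ?X u -` D \<inter> space ?P" "u \<in> I" "u \<le> s" "D \<in> sets lam" by auto
    have "?h -` C \<inter> space M = V u -` D \<inter> space M" using C(1) sp by auto
    then show "?h -` C \<inter> space (past_sigma M lam I V s) \<in> sets (past_sigma M lam I V s)"
      unfolding sets_past_sigma space_past_sigma using C by (auto intro!: sigma_sets.Basic)
  qed (use sp in auto)
  from measurable_sets[OF this B]
  have B': "?h -` B \<inter> space M \<in> sets (past_sigma M lam I V s)" by simp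
  have BP[measurable]: "B \<in> sets (Pi\<^sub>M UNIV (\<lambda>_. lam))"
    using B subalgebra_past_sigma[of I ?X ?P lam s] X unfolding subalgebra_def by auto
  have At: "?X t -` A \<inter> B \<in> sets (Pi\<^sub>M UNIV (\<lambda>_. lam))"
  proof -
    have "?X t -` A \<inter> B = (?X t -` A \<inter> space (Pi\<^sub>M UNIV (\<lambda>_. lam))) \<inter> B"
      using sets.sets_into_space[OF BP] by auto
    then show ?thesis using measurable_sets[OF X A] BP by auto
  qed
  have g[measurable]: "(\<lambda>x. \<integral>\<^sup>+y. ennreal (q x y) * indicator A y \<partial>lam) \<in> borel_measurable lam"
    using A by (intro measurable_kernel_nn_integral[OF lam q]) auto
  have "emeasure ?P (?X t -` A \<inter> B) = emeasure M (V t -` A \<inter> (?h -` B \<inter> space M))"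
    by (subst emeasure_distr[OF h At]) (auto intro!: arg_cong[where f="emeasure M"])
  also have "\<dots> = (\<integral>\<^sup>+w. (\<integral>\<^sup>+y. ennreal (q (V s w) y) * indicator A y \<partial>lam) * indicator (?h -` B \<inter> space M) w \<partial>M)"
    using km B' A unfolding kernel_markov_def by auto
  also have "\<dots> = (\<integral>\<^sup>+w. (\<integral>\<^sup>+y. ennreal (q (?h w s) y) * indicator A y \<partial>lam) * indicator B (?h w) \<partial>M)"
    by (rule nn_integral_cong) (auto split: split_indicator)
  also have "\<dots> = (\<integral>\<^sup>+x. (\<integral>\<^sup>+y. ennreal (q (x s) y) * indicator A y \<partial>lam) * indicator B x \<partial>?P)"
  proof -
    have [measurable]: "(\<lambda>x. \<integral>\<^sup>+y. ennreal (q (x s) y) * indicator A y \<partial>lam) \<in> borel_measurable (Pi\<^sub>M UNIV (\<lambda>_. lam))"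
      by (rule measurable_compose[OF X g])
    show ?thesis by (subst nn_integral_distr[OF h]) simp_all
  qed
  finally show "emeasure ?P (?X t -` A \<inter> B) =
      (\<integral>\<^sup>+x. (\<integral>\<^sup>+y. ennreal (q (x s) y) * indicator A y \<partial>lam) * indicator B x \<partial>?P)" .
qed

text \<open>Both sides are measures in each of the two arguments separately: first in the set of values at time
\<open>t\<close> for a fixed event of the past, then in the event of the past for a fixed function of \<open>V t\<close>.\<close>

lemma nn_integral_kernel_markov:
  fixes f :: "'e \<Rightarrow> ennreal" and F :: "'w \<Rightarrow> ennreal"
  assumes M: "prob_space M" and lam: "sigma_finite_measure lam"
    and V: "\<And>u. u \<in> I \<Longrightarrow> V u \<in> measurable M lam" and st: "s \<in> I" "t \<in> I"
    and q: "density_kernel lam q" and km: "kernel_markov M lam I V s t q"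
    and f[measurable]: "f \<in> borel_measurable lam"
    and F: "F \<in> borel_measurable (past_sigma M lam I V s)"
  shows "(\<integral>\<^sup>+w. F w * f (V t w) \<partial>M) = (\<integral>\<^sup>+w. F w * (\<integral>\<^sup>+y. ennreal (q (V s w) y) * f y \<partial>lam) \<partial>M)"
proof -
  interpret M: prob_space M by fact
  interpret L: sigma_finite_measure lam by fact
  interpret pair: pair_sigma_finite M lam ..
  let ?P = "past_sigma M lam I V s"
  have sub: "subalgebra M ?P" by (rule subalgebra_past_sigma) (rule V)
  have [measurable]: "V s \<in> measurable M lam" "V t \<in> measurable M lam" using V st by auto
  have qm[measurable]: "(\<lambda>(x, y). q x y) \<in> borel_measurable (lam \<Otimes>\<^sub>M lam)"
    using q unfolding density_kernel_def by auto
  have qs[measurable]: "(\<lambda>(w, y). q (V s w) y) \<in> borel_measurable (M \<Otimes>\<^sub>M lam)"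
    by measurable
  have one: "(\<integral>\<^sup>+w. f (V t w) * indicator B w \<partial>M) =
      (\<integral>\<^sup>+w. (\<integral>\<^sup>+y. ennreal (q (V s w) y) * f y \<partial>lam) * indicator B w \<partial>M)"
    if B: "B \<in> sets ?P" for B
  proof -
    have BM[measurable]: "B \<in> sets M" using B sub unfolding subalgebra_def by auto
    \<comment> \<open>By Fubini, the right-hand side is the integral of \<open>f\<close> against a density.\<close>
    define h where "h y = (\<integral>\<^sup>+w. ennreal (q (V s w) y) * indicator B w \<partial>M)" for y
    have h[measurable]: "h \<in> borel_measurable lam" unfolding h_def by measurable
    have swap: "(\<integral>\<^sup>+y. h y * g y \<partial>lam) =
        (\<integral>\<^sup>+w. (\<integral>\<^sup>+y. ennreal (q (V s w) y) * g y \<partial>lam) * indicator B w \<partial>M)"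
      if [measurable]: "g \<in> borel_measurable lam" for g
    proof -
      have "(\<integral>\<^sup>+y. h y * g y \<partial>lam) = (\<integral>\<^sup>+y. (\<integral>\<^sup>+w. ennreal (q (V s w) y) * indicator B w * g y \<partial>M) \<partial>lam)"
        unfolding h_def by (intro nn_integral_cong nn_integral_multc[symmetric]) measurable
      also have "\<dots> = (\<integral>\<^sup>+w. (\<integral>\<^sup>+y. ennreal (q (V s w) y) * indicator B w * g y \<partial>lam) \<partial>M)"
        by (rule pair.Fubini') measurable
      also have "\<dots> = (\<integral>\<^sup>+w. (\<integral>\<^sup>+y. ennreal (q (V s w) y) * g y \<partial>lam) * indicator B w \<partial>M)"
        by (intro nn_integral_cong, subst nn_integral_multc[symmetric]) (auto simp: ac_simps)
      finally show ?thesis .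
    qed
    have "distr (density M (indicator B)) lam (V t) = density lam h"
    proof (rule measure_eqI)
      fix A assume "A \<in> sets (distr (density M (indicator B)) lam (V t))"
      then have A[measurable]: "A \<in> sets lam" by simp
      have m: "V t -` A \<inter> space M \<in> sets M" by measurable
      have "emeasure (distr (density M (indicator B)) lam (V t)) A = emeasure M (V t -` A \<inter> B)"
      proof -
        have eq: "V t -` A \<inter> B = (V t -` A \<inter> space M) \<inter> B"
          using sets.sets_into_space[OF BM] by auto
        have "emeasure (distr (density M (indicator B)) lam (V t)) A =
            emeasure (density M (indicator B)) (V t -` A \<inter> space M)"
          by (subst emeasure_distr) auto
        also have "\<dots> = (\<integral>\<^sup>+w. indicator ((V t -` A \<inter> space M) \<inter> B) w \<partial>M)"
        proof -
          have "emeasure (density M (indicator B)) (V t -` A \<inter> space M) =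
              (\<integral>\<^sup>+w. indicator B w * indicator (V t -` A \<inter> space M) w \<partial>M)"
            using m by (subst emeasure_density) auto
          also have "\<dots> = (\<integral>\<^sup>+w. indicator ((V t -` A \<inter> space M) \<inter> B) w \<partial>M)"
            by (rule nn_integral_cong) (simp split: split_indicator)
          finally show ?thesis .
        qed
        also have "\<dots> = emeasure M (V t -` A \<inter> B)"
          unfolding eq by (rule nn_integral_indicator) (use m in auto)
        finally show ?thesis .
      qed
      also have "\<dots> = emeasure (density lam h) A"
        using km B A swap[of "indicator A"] unfolding kernel_markov_def
        by (simp add: emeasure_density)
      finally show "emeasure (distr (density M (indicator B)) lam (V t)) A = emeasure (density lam h) A" .
    qed simp
    then have "(\<integral>\<^sup>+y. f y \<partial>distr (density M (indicator B)) lam (V t)) = (\<integral>\<^sup>+y. f y \<partial>density lam h)"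
      by simp
    then show ?thesis
      using swap[OF f] by (simp add: nn_integral_distr nn_integral_density ac_simps)
  qed
  define g1 where "g1 w = f (V t w)" for w
  define g2 where "g2 w = (\<integral>\<^sup>+y. ennreal (q (V s w) y) * f y \<partial>lam)" for w
  have [measurable]: "g1 \<in> borel_measurable M" "g2 \<in> borel_measurable M"
    unfolding g1_def g2_def by measurable
  have id[measurable]: "(\<lambda>w. w) \<in> measurable M ?P"
    by (rule measurableI) (use sub in \<open>auto simp: subalgebra_def\<close>)
  have "distr (density M g1) ?P (\<lambda>w. w) = distr (density M g2) ?P (\<lambda>w. w)"
  proof (rule measure_eqI)
    fix B assume "B \<in> sets (distr (density M g1) ?P (\<lambda>w. w))"
    then have B: "B \<in> sets ?P" by simp
    then have BM[measurable]: "B \<in> sets M" using sub unfolding subalgebra_def by auto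
    show "emeasure (distr (density M g1) ?P (\<lambda>w. w)) B = emeasure (distr (density M g2) ?P (\<lambda>w. w)) B"
      using one[OF B] B sets.sets_into_space[OF BM]
      by (simp add: emeasure_distr emeasure_density Int_absorb2 g1_def[symmetric] g2_def[symmetric])
  qed simp
  then have "(\<integral>\<^sup>+w. F w \<partial>distr (density M g1) ?P (\<lambda>w. w)) = (\<integral>\<^sup>+w. F w \<partial>distr (density M g2) ?P (\<lambda>w. w))"
    by simp
  moreover have "F \<in> borel_measurable M" using measurable_from_subalg[OF sub F] .
  ultimately show ?thesis using F
    by (simp add: nn_integral_distr nn_integral_density g1_def g2_def ac_simps)
qed

text \<open>Removing the latest time \<open>t\<close> replaces the factor at the time \<open>s\<close> before it by its product with the
one-step integral \<open>g s\<close>, which is the same for both processes. The last remaining time is reduced to time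
zero, where both processes are equal to the same constant.\<close>

lemma fdd_unique:
  fixes V :: "real \<Rightarrow> 'w \<Rightarrow> 'e" and V' :: "real \<Rightarrow> 'v \<Rightarrow> 'e" and f :: "real \<Rightarrow> 'e \<Rightarrow> ennreal"
  assumes M: "prob_space M" "prob_space M'" and lam: "sigma_finite_measure lam"
    and V: "\<And>u. u \<in> I \<Longrightarrow> V u \<in> measurable M lam" "\<And>u. u \<in> I \<Longrightarrow> V' u \<in> measurable M' lam"
    and q: "\<And>s t. s \<in> J \<Longrightarrow> t \<in> J \<Longrightarrow> s < t \<Longrightarrow> density_kernel lam (p s t)"
    and km: "\<And>s t. s \<in> J \<Longrightarrow> t \<in> J \<Longrightarrow> s < t \<Longrightarrow> kernel_markov M lam I V s t (p s t)"
      "\<And>s t. s \<in> J \<Longrightarrow> t \<in> J \<Longrightarrow> s < t \<Longrightarrow> kernel_markov M' lam I V' s t (p s t)"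
    and J: "0 \<in> J" "J \<subseteq> I" "J \<subseteq> {0..}"
    and start: "AE w in M. V 0 w = \<alpha>" "AE w in M'. V' 0 w = \<alpha>"
    and S: "finite S" "S \<subseteq> J"
    and f: "\<And>u. f u \<in> borel_measurable lam"
  shows "(\<integral>\<^sup>+w. (\<Prod>u\<in>S. f u (V u w)) \<partial>M) = (\<integral>\<^sup>+w. (\<Prod>u\<in>S. f u (V' u w)) \<partial>M')"
  using S f
proof (induction S arbitrary: f rule: finite_linorder_max_induct)
  case empty
  then show ?case using M by (simp add: prob_space.emeasure_space_1)
next
  case (insert t S)
  have t: "t \<in> J" "t \<in> I" "t \<notin> S" using insert J by auto
  have SI: "\<And>u. u \<in> S \<Longrightarrow> u \<in> I" using insert J by auto
  define g where "g s x = (\<integral>\<^sup>+y. ennreal (p s t x y) * f t y \<partial>lam)" for s x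
  show ?case
  proof (cases "S = {}")
    case True
    have one: "(\<integral>\<^sup>+w. f t (U t w) \<partial>N) = (if t = 0 then f t \<alpha> else g 0 \<alpha>)"
      if N: "prob_space N" and U: "\<And>u. u \<in> I \<Longrightarrow> U u \<in> measurable N lam"
        and k: "\<And>s t. s \<in> J \<Longrightarrow> t \<in> J \<Longrightarrow> s < t \<Longrightarrow> kernel_markov N lam I U s t (p s t)"
        and st: "AE w in N. U 0 w = \<alpha>" for N and U :: "real \<Rightarrow> 'z \<Rightarrow> 'e"
    proof (cases "t = 0")
      case True
      have "(\<integral>\<^sup>+w. f t (U t w) \<partial>N) = (\<integral>\<^sup>+w. f t \<alpha> \<partial>N)"
        using st True by (intro nn_integral_cong_AE) auto
      then show ?thesis using True N by (simp add: prob_space.emeasure_space_1)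
    next
      case False
      then have t0: "0 < t" using t J by force
      have I0: "0 \<in> I" using J by auto
      have "(\<integral>\<^sup>+w. f t (U t w) \<partial>N) = (\<integral>\<^sup>+w. g 0 (U 0 w) \<partial>N)"
        using nn_integral_kernel_markov[where V=U and F="\<lambda>_. 1" and s=0 and t=t and I=I,
            OF N lam U I0 t(2) q[OF J(1) t(1) t0] k[OF J(1) t(1) t0] insert.prems(2)]
        by (simp add: g_def)
      also have "\<dots> = (\<integral>\<^sup>+w. g 0 \<alpha> \<partial>N)"
        using st by (intro nn_integral_cong_AE) auto
      finally show ?thesis using False N by (simp add: prob_space.emeasure_space_1)
    qed
    show ?thesis using one[OF M(1) V(1) km(1) start(1)] one[OF M(2) V(2) km(2) start(2)] True by simp
  next
    case False
    define s where "s = Max S"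
    have "s \<in> S" and le: "\<And>u. u \<in> S \<Longrightarrow> u \<le> s"
      using False insert by (auto simp: s_def)
    then have s: "s \<in> S" "s < t" "s \<in> J" "s \<in> I" using insert SI by auto
    define f' where "f' = f(s := \<lambda>x. f s x * g s x)"
    have gm: "g s \<in> borel_measurable lam"
      unfolding g_def using s t insert.prems(2) by (intro measurable_kernel_nn_integral[OF lam q]) auto
    have f'm: "f' u \<in> borel_measurable lam" for u
      using insert.prems(2)[of u] insert.prems(2)[of s] gm unfolding f'_def by auto
    have one: "(\<integral>\<^sup>+w. (\<Prod>u\<in>insert t S. f u (U u w)) \<partial>N) = (\<integral>\<^sup>+w. (\<Prod>u\<in>S. f' u (U u w)) \<partial>N)"
      if N: "prob_space N" and U: "\<And>u. u \<in> I \<Longrightarrow> U u \<in> measurable N lam"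
        and k: "kernel_markov N lam I U s t (p s t)" for N and U :: "real \<Rightarrow> 'z \<Rightarrow> 'e"
    proof -
      have "(\<integral>\<^sup>+w. (\<Prod>u\<in>insert t S. f u (U u w)) \<partial>N) = (\<integral>\<^sup>+w. (\<Prod>u\<in>S. f u (U u w)) * f t (U t w) \<partial>N)"
        using t insert by (simp add: ac_simps)
      also have "\<dots> = (\<integral>\<^sup>+w. (\<Prod>u\<in>S. f u (U u w)) * g s (U s w) \<partial>N)"
        unfolding g_def
      proof (rule nn_integral_kernel_markov[where V=U and I=I, OF N lam U s(4) t(2) q[OF s(3) t(1) s(2)] k insert.prems(2)])
        show "(\<lambda>w. \<Prod>u\<in>S. f u (U u w)) \<in> borel_measurable (past_sigma N lam I U s)"
        proof (rule borel_measurable_prod_ennreal)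
          fix u assume u: "u \<in> S"
          show "(\<lambda>w. f u (U u w)) \<in> borel_measurable (past_sigma N lam I U s)"
            by (rule measurable_compose[OF measurable_past_sigma[where V=U, OF SI[OF u] le[OF u] U[OF SI[OF u]]] insert.prems(2)])
        qed
      qed
      also have "\<dots> = (\<integral>\<^sup>+w. (\<Prod>u\<in>S. f' u (U u w)) \<partial>N)"
        using s insert unfolding f'_def
        by (subst (1 2) prod.remove[of _ s]) (auto simp: ac_simps intro!: nn_integral_cong prod.cong)
      finally show ?thesis .
    qed
    show ?thesis
      using one[OF M(1) V(1) km(1)[OF s(3) t(1) s(2)]] one[OF M(2) V(2) km(2)[OF s(3) t(1) s(2)]]
        insert.IH[OF _ f'm] insert.prems(1) by simp
  qed
qed

lemma emeasure_path_cylinder: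
  fixes S :: "'e measure" and U :: "real \<Rightarrow> 'w \<Rightarrow> 'e"
  assumes U: "\<And>u. u \<in> I \<Longrightarrow> U u \<in> measurable N S"
    and K: "finite K" "K \<subseteq> I" "\<And>u. u \<in> K \<Longrightarrow> A u \<in> sets S"
  shows "emeasure (distr N (Pi\<^sub>M I (\<lambda>_. S)) (\<lambda>w. \<lambda>t\<in>I. U t w)) (prod_emb I (\<lambda>_. S) K (Pi\<^sub>E K A)) =
      (\<integral>\<^sup>+w. (\<Prod>u\<in>K. indicator (if u \<in> K then A u else {}) (U u w)) \<partial>N)"
proof -
  let ?C = "prod_emb I (\<lambda>_. S) K (Pi\<^sub>E K A)"
  have h: "(\<lambda>w. \<lambda>t\<in>I. U t w) \<in> measurable N (Pi\<^sub>M I (\<lambda>_. S))"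
    by (rule measurable_restrict) (rule U)
  have C: "?C \<in> sets (Pi\<^sub>M I (\<lambda>_. S))" using K by (intro sets_PiM_I) auto
  have "emeasure (distr N (Pi\<^sub>M I (\<lambda>_. S)) (\<lambda>w. \<lambda>t\<in>I. U t w)) ?C =
      (\<integral>\<^sup>+w. indicator ?C (\<lambda>t\<in>I. U t w) \<partial>N)"
    using C by (subst nn_integral_distr[OF h, symmetric]) auto
  also have "\<dots> = (\<integral>\<^sup>+w. (\<Prod>u\<in>K. indicator (if u \<in> K then A u else {}) (U u w)) \<partial>N)"
  proof (rule nn_integral_cong)
    fix w assume w: "w \<in> space N"
    have "U u w \<in> space S" if "u \<in> I" for u using U[OF that] w by (auto dest: measurable_space)
    then have "(\<lambda>t\<in>I. U t w) \<in> ?C \<longleftrightarrow> (\<forall>u\<in>K. U u w \<in> A u)"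
      using K unfolding prod_emb_def by (auto simp: restrict_def PiE_iff extensional_def space_PiM)
    then show "indicator ?C (\<lambda>t\<in>I. U t w) = (\<Prod>u\<in>K. indicator (if u \<in> K then A u else {}) (U u w) :: ennreal)"
      using K(1) by (auto simp: indicator_def of_bool_def prod_zero_iff)
  qed
  finally show ?thesis .
qed

lemma path_law_eqI:
  fixes S :: "'e measure" and V :: "real \<Rightarrow> 'w \<Rightarrow> 'e" and V' :: "real \<Rightarrow> 'v \<Rightarrow> 'e"
  assumes M: "prob_space M" "prob_space M'"
    and V: "\<And>u. u \<in> I \<Longrightarrow> V u \<in> measurable M S" "\<And>u. u \<in> I \<Longrightarrow> V' u \<in> measurable M' S"
    and eq: "\<And>K f. finite K \<Longrightarrow> K \<subseteq> I \<Longrightarrow> (\<And>u. f u \<in> borel_measurable S) \<Longrightarrow>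
      (\<integral>\<^sup>+w. (\<Prod>u\<in>K. f u (V u w)) \<partial>M) = (\<integral>\<^sup>+w. (\<Prod>u\<in>K. f u (V' u w) :: ennreal) \<partial>M')"
  shows "path_law M S I V = path_law M' S I V'"
  unfolding path_law_def
proof (rule measure_eqI_PiM_infinite[where I=I and M="\<lambda>_. S"])
  fix A K assume K: "finite K" "K \<subseteq> I" and A: "\<And>j. j \<in> K \<Longrightarrow> A j \<in> sets S"
  show "emeasure (distr M (Pi\<^sub>M I (\<lambda>_. S)) (\<lambda>w. \<lambda>t\<in>I. V t w)) (prod_emb I (\<lambda>_. S) K (Pi\<^sub>E K A)) =
      emeasure (distr M' (Pi\<^sub>M I (\<lambda>_. S)) (\<lambda>w. \<lambda>t\<in>I. V' t w)) (prod_emb I (\<lambda>_. S) K (Pi\<^sub>E K A))"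
    by (rule trans[OF emeasure_path_cylinder[where U=V, OF V(1) K A]
          trans[OF eq[OF K] emeasure_path_cylinder[where U=V', OF V(2) K A, symmetric]]])
      (use A in auto)
next
  interpret prob_space "distr M (Pi\<^sub>M I (\<lambda>_. S)) (\<lambda>w. \<lambda>t\<in>I. V t w)"
    by (rule prob_space.prob_space_distr[OF M(1)]) (rule measurable_restrict, rule V)
  show "finite_measure (distr M (Pi\<^sub>M I (\<lambda>_. S)) (\<lambda>w. \<lambda>t\<in>I. V t w))" by unfold_locales
qed simp_all

section \<open>Isotropic Gaussian densities\<close>

definition gauss :: "real \<Rightarrow> real ^ 'n \<Rightarrow> real" where
  "gauss v x = 1 / (2 * pi * v) powr (real CARD('n) / 2) * exp (- (norm x)\<^sup>2 / (2 * v))"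

lemma gauss_nonneg [simp]: "0 \<le> gauss v x"
  by (simp add: gauss_def)

lemma borel_measurable_gauss [measurable]: "gauss v \<in> borel_measurable borel"
  unfolding gauss_def by measurable

lemma norm_vec_sq: "(norm (x :: real ^ 'n))\<^sup>2 = (\<Sum>i\<in>UNIV. (x $ i)\<^sup>2)"
  unfolding norm_vec_def L2_set_def by (simp add: sum_nonneg)

lemma gauss_prod:
  assumes "0 < v"
  shows "gauss v (x :: real ^ 'n) = (\<Prod>i\<in>UNIV. normal_density 0 (sqrt v) (x $ i))"
proof -
  have "(2 * pi * v) powr (real CARD('n) / 2) = ((2 * pi * v) powr (1/2)) powr real CARD('n)"
    by (simp add: powr_powr)
  also have "\<dots> = sqrt (2 * pi * v) ^ CARD('n)"
    using assms by (simp add: powr_half_sqrt powr_realpow)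
  finally have "(2 * pi * v) powr (real CARD('n) / 2) = sqrt (2 * pi * v) ^ CARD('n)" .
  moreover have "exp (- (norm x)\<^sup>2 / (2 * v)) = (\<Prod>i\<in>UNIV. exp (- (x $ i)\<^sup>2 / (2 * v)))"
    by (simp add: exp_sum[symmetric] norm_vec_sq sum_negf sum_divide_distrib[symmetric])
  ultimately show ?thesis
    using assms by (simp add: gauss_def normal_density_def prod_dividef prod.distrib power_divide)
qed

lemma nn_integral_prod_vec:
  fixes f :: "'n::finite \<Rightarrow> real \<Rightarrow> ennreal"
  assumes "\<And>i. f i \<in> borel_measurable borel"
  shows "(\<integral>\<^sup>+x. (\<Prod>i\<in>UNIV. f i (x $ i)) \<partial>lborel) = (\<Prod>i\<in>UNIV. \<integral>\<^sup>+y. f i y \<partial>lborel)"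
proof -
  have inj: "inj_on (\<lambda>i. axis i (1::real) :: real ^ 'n) UNIV"
    by (auto simp: inj_on_def axis_eq_axis)
  define f' where "f' b = f (the_inv_into UNIV (\<lambda>i. axis i (1::real)) b)" for b :: "real ^ 'n"
  have f': "f' (axis i 1) = f i" for i
    unfolding f'_def by (simp add: the_inv_into_f_f[OF inj])
  have B: "(Basis :: (real ^ 'n) set) = range (\<lambda>i. axis i 1)" by (auto simp: Basis_vec_def)
  have e: "(\<Prod>b\<in>Basis. g b) = (\<Prod>i\<in>UNIV. g (axis i 1))" for g :: "real ^ 'n \<Rightarrow> ennreal"
    unfolding B by (subst prod.reindex[OF inj]) (simp add: o_def)
  have "(\<integral>\<^sup>+x. (\<Prod>b\<in>Basis. f' b (x \<bullet> b)) \<partial>lborel) = (\<Prod>b\<in>(Basis :: (real ^ 'n) set). \<integral>\<^sup>+y. f' b y \<partial>lborel)"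
    by (rule nn_integral_lborel_prod) (use assms in \<open>auto simp: f'_def\<close>)
  then show ?thesis unfolding e f' by (simp add: inner_axis)
qed

lemma nn_integral_gauss:
  assumes "0 < v" shows "(\<integral>\<^sup>+x. ennreal (gauss v x) \<partial>(lborel :: (real ^ 'n) measure)) = 1"
proof -
  have "(\<integral>\<^sup>+y. ennreal (normal_density 0 (sqrt v) y) \<partial>lborel) = 1"
    using assms by (subst nn_integral_eq_integral) (auto simp: normal_density_nonneg)
  then show ?thesis
    using assms nn_integral_prod_vec[of "\<lambda>_::'n. \<lambda>y. ennreal (normal_density 0 (sqrt v) y)"]
    by (simp add: gauss_prod prod_ennreal normal_density_nonneg)
qed

lemma has_bochner_integral_gauss:
  assumes "0 < v"
  shows "has_bochner_integral lborel (\<lambda>y. gauss v (y - m :: real ^ 'n)) 1"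
proof (rule has_bochner_integral_nn_integral)
  have "(\<integral>\<^sup>+y. ennreal (gauss v (y - m)) \<partial>lborel) =
      (\<integral>\<^sup>+y. ennreal (gauss v y) \<partial>distr lborel borel ((+) (- m)))"
    by (subst nn_integral_distr) auto
  then show "(\<integral>\<^sup>+y. ennreal (gauss v (y - m)) \<partial>lborel) = ennreal 1"
    using nn_integral_gauss[OF assms] by (simp add: lborel_distr_plus)
qed auto

lemma density_kernel_gauss:
  assumes "0 < v"
  shows "density_kernel lborel (\<lambda>x y :: real ^ 'n. gauss v (y - c *\<^sub>R x))"
  unfolding density_kernel_def
  using has_bochner_integral_gauss[OF assms] by auto

text \<open>By factorization over the coordinates this is the convolution of one-dimensional normal densities.\<close>

lemma gauss_convolution:
  assumes "0 < v" "0 < v'"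
  shows "(\<integral>\<^sup>+x. ennreal (gauss v (z - x)) * ennreal (gauss v' x) \<partial>lborel) = ennreal (gauss (v + v') (z :: real ^ 'n))"
proof -
  let ?n = "\<lambda>v. normal_density 0 (sqrt v)"
  have "(\<integral>\<^sup>+x. ennreal (gauss v (z - x)) * ennreal (gauss v' x) \<partial>lborel) =
      (\<integral>\<^sup>+x. (\<Prod>i\<in>UNIV. ennreal (?n v (z $ i - x $ i) * ?n v' (x $ i))) \<partial>lborel)"
    using assms by (intro nn_integral_cong)
      (simp add: gauss_prod prod_ennreal normal_density_nonneg prod.distrib ennreal_mult' prod_nonneg)
  also have "\<dots> = (\<Prod>i\<in>UNIV. \<integral>\<^sup>+y. ennreal (?n v (z $ i - y) * ?n v' y) \<partial>lborel)"
    by (rule nn_integral_prod_vec[where f="\<lambda>i y. ennreal (?n v (z $ i - y) * ?n v' y)"]) simp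
  also have "\<dots> = (\<Prod>i\<in>UNIV. ennreal (?n (v + v') (z $ i)))"
    using assms fun_cong[OF conv_normal_density_zero_mean[of "sqrt v" "sqrt v'"]] by simp
  also have "\<dots> = ennreal (gauss (v + v') z)"
    using assms by (simp add: gauss_prod prod_ennreal normal_density_nonneg)
  finally show ?thesis .
qed

lemma gauss_scale:
  assumes "0 < v" "c \<noteq> 0"
  shows "\<bar>c\<bar> ^ CARD('n) * gauss (c\<^sup>2 * v) (c *\<^sub>R x) = gauss v (x :: real ^ 'n)"
proof -
  have "(2 * pi * (c\<^sup>2 * v)) powr (real CARD('n) / 2) = (c\<^sup>2 * (2 * pi * v)) powr (real CARD('n) / 2)"
    by (simp add: ac_simps)
  also have "\<dots> = (c\<^sup>2) powr (real CARD('n) / 2) * (2 * pi * v) powr (real CARD('n) / 2)"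
    using assms by (simp add: powr_mult)
  also have "(c\<^sup>2) powr (real CARD('n) / 2) = (\<bar>c\<bar> powr 2) powr (real CARD('n) / 2)"
    using assms by (simp add: powr_numeral)
  also have "\<dots> = \<bar>c\<bar> ^ CARD('n)"
    unfolding powr_powr using assms by (simp add: powr_realpow)
  finally show ?thesis using assms by (simp add: gauss_def power_mult_distrib)
qed

lemma nn_integral_gauss_scale:
  fixes f :: "real ^ 'n \<Rightarrow> ennreal"
  assumes "0 < v" "c \<noteq> 0" and [measurable]: "f \<in> borel_measurable borel"
  shows "(\<integral>\<^sup>+x. f (c *\<^sub>R x) * ennreal (gauss v x) \<partial>lborel) = (\<integral>\<^sup>+y. f y * ennreal (gauss (c\<^sup>2 * v) y) \<partial>lborel)"
proof -
  have "(\<integral>\<^sup>+y. f y * ennreal (gauss (c\<^sup>2 * v) y) \<partial>lborel) =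
      (\<integral>\<^sup>+x. ennreal (\<bar>c\<bar> ^ CARD('n)) * (f (c *\<^sub>R x) * ennreal (gauss (c\<^sup>2 * v) (c *\<^sub>R x))) \<partial>lborel)"
    by (subst lborel_affine[OF assms(2), of 0]) (simp add: nn_integral_density nn_integral_distr)
  also have "\<dots> = (\<integral>\<^sup>+x. f (c *\<^sub>R x) * ennreal (gauss v x) \<partial>lborel)"
    by (intro nn_integral_cong) (simp add: gauss_scale[OF assms(1,2), symmetric] ennreal_mult' ac_simps)
  finally show ?thesis by simp
qed

lemma prob_space_gauss:
  assumes "0 < v" shows "prob_space (density lborel (\<lambda>x. ennreal (gauss v (x :: real ^ 'n))))"
  by (rule prob_spaceI) (simp add: emeasure_density nn_integral_gauss[OF assms])

section \<open>Gaussian vectors independent of a sub-sigma-algebra\<close>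

text \<open>Independence and the normal law are stated in one equation, which determines the joint law of \<open>X\<close>
with any \<open>F\<close>-measurable data.\<close>

definition indep_gaussian :: "'w measure \<Rightarrow> 'w measure \<Rightarrow> ('w \<Rightarrow> real ^ 'n) \<Rightarrow> real \<Rightarrow> bool" where
  "indep_gaussian N F X v \<longleftrightarrow> 0 < v \<and> X \<in> borel_measurable N \<and>
     (\<forall>B\<in>sets F. \<forall>A\<in>sets borel.
        emeasure N (X -` A \<inter> B) = emeasure N B * (\<integral>\<^sup>+y. ennreal (gauss v y) * indicator A y \<partial>lborel))"

text \<open>Under the assumption, the joint law of the identity map into \<open>F\<close> and of \<open>X\<close> is a product measure, so the
Gaussian variable can be integrated out with the \<open>F\<close>-measurable data frozen.\<close>

lemma nn_integral_indep_gaussian: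
  fixes g :: "'w \<Rightarrow> real ^ 'n \<Rightarrow> ennreal"
  assumes N: "prob_space N" and sub: "subalgebra N F" and X: "indep_gaussian N F X v"
    and g: "(\<lambda>(w, y). g w y) \<in> borel_measurable (F \<Otimes>\<^sub>M borel)"
  shows "(\<integral>\<^sup>+w. g w (X w) \<partial>N) = (\<integral>\<^sup>+w. \<integral>\<^sup>+y. g w y * ennreal (gauss v y) \<partial>lborel \<partial>N)"
proof -
  interpret N: prob_space N by fact
  let ?G = "density (lborel :: (real ^ 'n) measure) (\<lambda>x. ennreal (gauss v x))"
  let ?N = "restr_to_subalg N F"
  have v: "0 < v" and Xm[measurable]: "X \<in> borel_measurable N"
    using X by (auto simp: indep_gaussian_def)
  interpret G: prob_space ?G by (rule prob_space_gauss[OF v])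
  interpret N': prob_space ?N by (rule prob_space_restr_to_subalg[OF sub N])
  have sN: "sets ?N = sets F" "space ?N = space N" by (simp_all add: sets_restr_to_subalg[OF sub] space_restr_to_subalg)
  have sF: "space F = space N" "sets F \<subseteq> sets N" using sub by (auto simp: subalgebra_def)
  have id: "(\<lambda>w. w) \<in> measurable N F"
    by (rule measurableI) (use sub in \<open>auto simp: subalgebra_def\<close>)
  have H[measurable]: "(\<lambda>w. (w, X w)) \<in> measurable N (F \<Otimes>\<^sub>M borel)"
    using id by measurable
  have "?N \<Otimes>\<^sub>M ?G = distr N (F \<Otimes>\<^sub>M borel) (\<lambda>w. (w, X w))"
  proof (rule pair_measure_eqI)
    show "sigma_finite_measure ?N" "sigma_finite_measure ?G" by unfold_locales
    show "sets (?N \<Otimes>\<^sub>M ?G) = sets (distr N (F \<Otimes>\<^sub>M borel) (\<lambda>w. (w, X w)))"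
      unfolding sets_distr by (rule sets_pair_measure_cong; use sN in simp)
    fix B A assume "B \<in> sets ?N" "A \<in> sets ?G"
    then have B: "B \<in> sets F" and A: "A \<in> sets borel" using sN by auto
    have BN: "B \<subseteq> space N" using sets.sets_into_space[OF B] sF by simp
    have "emeasure (distr N (F \<Otimes>\<^sub>M borel) (\<lambda>w. (w, X w))) (B \<times> A) = emeasure N (X -` A \<inter> B)"
      using A B BN by (subst emeasure_distr) (auto intro!: arg_cong[where f="emeasure N"])
    then show "emeasure ?N B * emeasure ?G A = emeasure (distr N (F \<Otimes>\<^sub>M borel) (\<lambda>w. (w, X w))) (B \<times> A)"
      using X A B by (simp add: emeasure_restr_to_subalg[OF sub B] indep_gaussian_def emeasure_density)
  qed
  note eq = this
  have s1: "sets (?N \<Otimes>\<^sub>M ?G) = sets (F \<Otimes>\<^sub>M borel)" "sets (?N \<Otimes>\<^sub>M borel) = sets (F \<Otimes>\<^sub>M borel)"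
    by (rule sets_pair_measure_cong; use sN in simp)+
  have g': "(\<lambda>(w, y). g w y) \<in> borel_measurable (?N \<Otimes>\<^sub>M ?G)"
    using g unfolding measurable_cong_sets[OF s1(1) refl] .
  have gb: "(\<lambda>(w, y). g w y) \<in> borel_measurable (?N \<Otimes>\<^sub>M borel)"
    using g unfolding measurable_cong_sets[OF s1(2) refl] .
  have gw: "g w \<in> borel_measurable borel" if "w \<in> space N" for w
    using measurable_Pair2[OF gb, of w] that sN by simp
  have "(\<integral>\<^sup>+w. g w (X w) \<partial>N) = (\<integral>\<^sup>+z. (case z of (w, y) \<Rightarrow> g w y) \<partial>distr N (F \<Otimes>\<^sub>M borel) (\<lambda>w. (w, X w)))"
    using g by (subst nn_integral_distr) auto
  also have "\<dots> = (\<integral>\<^sup>+w. \<integral>\<^sup>+y. g w y \<partial>?G \<partial>?N)"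
    unfolding eq[symmetric] using G.nn_integral_fst[OF g'] by simp
  also have "\<dots> = (\<integral>\<^sup>+w. \<integral>\<^sup>+y. g w y * ennreal (gauss v y) \<partial>lborel \<partial>?N)"
    using gw sN by (intro nn_integral_cong) (simp add: nn_integral_density ac_simps)
  also have "\<dots> = (\<integral>\<^sup>+w. \<integral>\<^sup>+y. g w y * ennreal (gauss v y) \<partial>lborel \<partial>N)"
  proof (rule nn_integral_subalgebra2[OF sub])
    have "(\<lambda>w. \<integral>\<^sup>+y. (case (w, y) of (w, y) \<Rightarrow> g w y) * ennreal (gauss v y) \<partial>lborel) \<in> borel_measurable F"
      using g by measurable
    then show "(\<lambda>w. \<integral>\<^sup>+y. g w y * ennreal (gauss v y) \<partial>lborel) \<in> borel_measurable F" by simp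
  qed
  finally show ?thesis .
qed

lemma nn_integral_lborel_shift:
  fixes f :: "'a::euclidean_space \<Rightarrow> ennreal"
  assumes [measurable]: "f \<in> borel_measurable borel"
  shows "(\<integral>\<^sup>+y. f (m + y) \<partial>lborel) = (\<integral>\<^sup>+y. f y \<partial>lborel)"
proof -
  have "(\<integral>\<^sup>+y. f y \<partial>distr lborel borel ((+) m)) = (\<integral>\<^sup>+y. f (m + y) \<partial>lborel)"
    by (subst nn_integral_distr) auto
  then show ?thesis by (simp add: lborel_distr_plus)
qed

text \<open>A linear recursion with an independent Gaussian innovation has a Gaussian kernel. The equation
for \<open>V t\<close> only has to hold almost surely, and \<open>F\<close> may be larger than the past of \<open>V\<close>.\<close>

lemma kernel_markov_indep_gaussian:
  fixes V :: "real \<Rightarrow> 'w \<Rightarrow> real ^ 'n"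
  assumes N: "prob_space N" and sub: "subalgebra N F" and X: "indep_gaussian N F X v"
    and past: "sets (past_sigma N lborel I V s) \<subseteq> sets F"
    and Vs: "V s \<in> borel_measurable F" and Vt: "V t \<in> borel_measurable N"
    and ae: "AE w in N. V t w = c *\<^sub>R V s w + X w"
  shows "kernel_markov N lborel I V s t (\<lambda>x y. gauss v (y - c *\<^sub>R x))"
  unfolding kernel_markov_def
proof (intro ballI)
  fix B A assume "B \<in> sets (past_sigma N lborel I V s)" and "A \<in> sets (lborel :: (real ^ 'n) measure)"
  then have B[measurable]: "B \<in> sets F" and A[measurable]: "A \<in> sets borel" using past by auto
  note Vs[measurable] Vt[measurable]
  have BN[measurable]: "B \<in> sets N" using B sub by (auto simp: subalgebra_def)
  have [measurable]: "V s \<in> borel_measurable N" by (rule measurable_from_subalg[OF sub Vs])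
  have Xm[measurable]: "X \<in> borel_measurable N" using X by (auto simp: indep_gaussian_def)
  have "V t -` A \<inter> B = (V t -` A \<inter> space N) \<inter> B" using sets.sets_into_space[OF BN] by auto
  then have "emeasure N (V t -` A \<inter> B) = (\<integral>\<^sup>+w. indicator ((V t -` A \<inter> space N) \<inter> B) w \<partial>N)"
    by (subst nn_integral_indicator) (simp_all only:, measurable)
  also have "\<dots> = (\<integral>\<^sup>+w. indicator A (c *\<^sub>R V s w + X w) * indicator B w \<partial>N)"
  proof (rule nn_integral_cong_AE)
    have "AE w in N. w \<in> space N" by simp
    then show "AE w in N. indicator ((V t -` A \<inter> space N) \<inter> B) w =
        (indicator A (c *\<^sub>R V s w + X w) * indicator B w :: ennreal)"
      using ae by eventually_elim (auto split: split_indicator)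
  qed
  also have "\<dots> = (\<integral>\<^sup>+w. \<integral>\<^sup>+y. indicator A (c *\<^sub>R V s w + y) * indicator B w * ennreal (gauss v y) \<partial>lborel \<partial>N)"
    by (rule nn_integral_indep_gaussian[OF N sub X]) measurable
  also have "\<dots> = (\<integral>\<^sup>+w. (\<integral>\<^sup>+y. ennreal (gauss v (y - c *\<^sub>R V s w)) * indicator A y \<partial>lborel) * indicator B w \<partial>N)"
  proof (rule nn_integral_cong)
    fix w
    have "(\<integral>\<^sup>+y. indicator A (c *\<^sub>R V s w + y) * indicator B w * ennreal (gauss v y) \<partial>lborel) =
      (\<integral>\<^sup>+y. indicator A (c *\<^sub>R V s w + y) * ennreal (gauss v ((c *\<^sub>R V s w + y) - c *\<^sub>R V s w)) * indicator B w \<partial>lborel)"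
      by (intro nn_integral_cong) (simp add: ac_simps)
    also have "\<dots> = (\<integral>\<^sup>+y. indicator A y * ennreal (gauss v (y - c *\<^sub>R V s w)) * indicator B w \<partial>lborel)"
      by (rule nn_integral_lborel_shift) measurable
    also have "\<dots> = (\<integral>\<^sup>+y. ennreal (gauss v (y - c *\<^sub>R V s w)) * indicator A y \<partial>lborel) * indicator B w"
      by (subst nn_integral_multc) (auto simp: ac_simps)
    finally show "(\<integral>\<^sup>+y. indicator A (c *\<^sub>R V s w + y) * indicator B w * ennreal (gauss v y) \<partial>lborel) =
      (\<integral>\<^sup>+y. ennreal (gauss v (y - c *\<^sub>R V s w)) * indicator A y \<partial>lborel) * indicator B w" .
  qed
  finally show "emeasure N (V t -` A \<inter> B) =
    (\<integral>\<^sup>+w. (\<integral>\<^sup>+y. ennreal (gauss v (y - c *\<^sub>R V s w)) * indicator A y \<partial>lborel) * indicator B w \<partial>N)" .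
qed

lemma indep_gaussian_scale:
  fixes X :: "'w \<Rightarrow> real ^ 'n"
  assumes X: "indep_gaussian N F X v" and c: "c \<noteq> 0"
  shows "indep_gaussian N F (\<lambda>w. c *\<^sub>R X w) (c\<^sup>2 * v)"
  unfolding indep_gaussian_def
proof (intro conjI ballI)
  have v: "0 < v" and [measurable]: "X \<in> borel_measurable N" using X by (auto simp: indep_gaussian_def)
  show "0 < c\<^sup>2 * v" using v c by simp
  show "(\<lambda>w. c *\<^sub>R X w) \<in> borel_measurable N" by measurable
  fix B and A :: "(real ^ 'n) set" assume B: "B \<in> sets F" and A[measurable]: "A \<in> sets borel"
  have m: "(\<lambda>x. c *\<^sub>R x) -` A \<in> sets borel"
  proof -
    have "(\<lambda>x. c *\<^sub>R x) -` A \<inter> space (borel :: (real ^ 'n) measure) \<in> sets borel" by measurable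
    then show ?thesis by simp
  qed
  have "emeasure N ((\<lambda>w. c *\<^sub>R X w) -` A \<inter> B) = emeasure N (X -` ((\<lambda>x. c *\<^sub>R x) -` A) \<inter> B)"
    by (rule arg_cong[where f="emeasure N"]) auto
  also have "\<dots> = emeasure N B * (\<integral>\<^sup>+y. indicator A (c *\<^sub>R y) * ennreal (gauss v y) \<partial>lborel)"
    using X B m unfolding indep_gaussian_def by (simp add: indicator_vimage ac_simps)
  also have "(\<integral>\<^sup>+y. indicator A (c *\<^sub>R y) * ennreal (gauss v y) \<partial>lborel) =
      (\<integral>\<^sup>+y. ennreal (gauss (c\<^sup>2 * v) y) * indicator A y \<partial>lborel)"
    by (subst nn_integral_gauss_scale[OF v c]) (auto simp: ac_simps)
  finally show "emeasure N ((\<lambda>w. c *\<^sub>R X w) -` A \<inter> B) =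
      emeasure N B * (\<integral>\<^sup>+y. ennreal (gauss (c\<^sup>2 * v) y) * indicator A y \<partial>lborel)" .
qed

text \<open>Freezing first the data in \<open>G\<close> and then those in \<open>F\<close> leaves a convolution of two Gaussian
densities.\<close>

lemma indep_gaussian_add:
  fixes X Y :: "'w \<Rightarrow> real ^ 'n"
  assumes N: "prob_space N" and F: "subalgebra N F" and G: "subalgebra N G" "sets F \<subseteq> sets G"
    and X: "indep_gaussian N F X v" "X \<in> borel_measurable G" and Y: "indep_gaussian N G Y v'"
  shows "indep_gaussian N F (\<lambda>w. X w + Y w) (v + v')"
  unfolding indep_gaussian_def
proof (intro conjI ballI)
  have v: "0 < v" "0 < v'" and [measurable]: "X \<in> borel_measurable N" "Y \<in> borel_measurable N"
    using X Y by (auto simp: indep_gaussian_def)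
  note X(2)[measurable]
  show "0 < v + v'" using v by simp
  show "(\<lambda>w. X w + Y w) \<in> borel_measurable N" by measurable
  fix B and A :: "(real ^ 'n) set" assume B: "B \<in> sets F" and A[measurable]: "A \<in> sets borel"
  have BG[measurable]: "B \<in> sets G" and BN[measurable]: "B \<in> sets N"
    using B G F by (auto simp: subalgebra_def)
  note B[measurable]
  have eq: "(\<lambda>w. X w + Y w) -` A \<inter> B = ((\<lambda>w. X w + Y w) -` A \<inter> space N) \<inter> B"
    using sets.sets_into_space[OF BN] by auto
  have "emeasure N ((\<lambda>w. X w + Y w) -` A \<inter> B) = (\<integral>\<^sup>+w. indicator (((\<lambda>w. X w + Y w) -` A \<inter> space N) \<inter> B) w \<partial>N)"
    unfolding eq by (rule nn_integral_indicator[symmetric]) measurable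
  also have "\<dots> = (\<integral>\<^sup>+w. indicator A (X w + Y w) * indicator B w \<partial>N)"
    by (rule nn_integral_cong) (simp split: split_indicator)
  also have "\<dots> = (\<integral>\<^sup>+w. \<integral>\<^sup>+y. indicator A (X w + y) * indicator B w * ennreal (gauss v' y) \<partial>lborel \<partial>N)"
    by (rule nn_integral_indep_gaussian[OF N G(1) Y]) measurable
  also have "\<dots> = (\<integral>\<^sup>+w. \<integral>\<^sup>+x. (\<integral>\<^sup>+y. indicator A (x + y) * indicator B w * ennreal (gauss v' y) \<partial>lborel) * ennreal (gauss v x) \<partial>lborel \<partial>N)"
    by (rule nn_integral_indep_gaussian[OF N F X(1)]) measurable
  also have "\<dots> = (\<integral>\<^sup>+w. (\<integral>\<^sup>+z. ennreal (gauss (v + v') z) * indicator A z \<partial>lborel) * indicator B w \<partial>N)"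
  proof (rule nn_integral_cong)
    fix w
    have "(\<integral>\<^sup>+x. (\<integral>\<^sup>+y. indicator A (x + y) * indicator B w * ennreal (gauss v' y) \<partial>lborel) * ennreal (gauss v x) \<partial>lborel) =
        (\<integral>\<^sup>+x. \<integral>\<^sup>+y. indicator A (x + y) * ennreal (gauss v' ((x + y) - x)) * (indicator B w * ennreal (gauss v x)) \<partial>lborel \<partial>lborel)"
      by (intro nn_integral_cong, subst nn_integral_multc[symmetric]) (auto simp: ac_simps)
    also have "\<dots> = (\<integral>\<^sup>+x. \<integral>\<^sup>+z. indicator A z * ennreal (gauss v' (z - x)) * (indicator B w * ennreal (gauss v x)) \<partial>lborel \<partial>lborel)"
      by (intro nn_integral_cong nn_integral_lborel_shift) measurable
    also have "\<dots> = (\<integral>\<^sup>+z. \<integral>\<^sup>+x. indicator A z * ennreal (gauss v' (z - x)) * (indicator B w * ennreal (gauss v x)) \<partial>lborel \<partial>lborel)"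
      by (rule lborel_pair.Fubini'[symmetric]) measurable
    also have "\<dots> = (\<integral>\<^sup>+z. \<integral>\<^sup>+x. (ennreal (gauss v' (z - x)) * ennreal (gauss v x)) * (indicator A z * indicator B w) \<partial>lborel \<partial>lborel)"
      by (simp add: ac_simps)
    also have "\<dots> = (\<integral>\<^sup>+z. ennreal (gauss (v + v') z) * (indicator A z * indicator B w) \<partial>lborel)"
      by (intro nn_integral_cong, subst nn_integral_multc)
        (auto simp: add.commute gauss_convolution[OF v(2,1)])
    also have "\<dots> = (\<integral>\<^sup>+z. ennreal (gauss (v + v') z) * indicator A z \<partial>lborel) * indicator B w"
      by (subst nn_integral_multc[symmetric]) (auto simp: ac_simps)
    finally show "(\<integral>\<^sup>+x. (\<integral>\<^sup>+y. indicator A (x + y) * indicator B w * ennreal (gauss v' y) \<partial>lborel) * ennreal (gauss v x) \<partial>lborel) = \<dots>" .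
  qed
  also have "\<dots> = emeasure N B * (\<integral>\<^sup>+y. ennreal (gauss (v + v') y) * indicator A y \<partial>lborel)"
    by (subst nn_integral_cmult) (auto simp: ac_simps)
  finally show "emeasure N ((\<lambda>w. X w + Y w) -` A \<inter> B) = \<dots>" .
qed

text \<open>All the \<open>Xn\<close> have the same law given each event of \<open>F\<close>, so dominated convergence identifies the integrals of
bounded continuous functions of \<open>X\<close>. Indicators of open sets are increasing limits of such functions, and
open sets form a generator that is stable under intersections.\<close>

lemma indep_gaussian_limit:
  fixes X :: "'w \<Rightarrow> real ^ 'n"
  assumes N: "prob_space N" and sub: "subalgebra N F" and v: "0 < v"
    and Xn: "\<And>k. indep_gaussian N F (Xn k) v"
    and Xm: "X \<in> borel_measurable N" and lim: "AE w in N. (\<lambda>k. Xn k w) \<longlonglongrightarrow> X w"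
  shows "indep_gaussian N F X v"
  unfolding indep_gaussian_def
proof (intro conjI ballI v Xm)
  interpret N: prob_space N by fact
  fix B and A :: "(real ^ 'n) set" assume B: "B \<in> sets F" and A: "A \<in> sets borel"
  have BN[measurable]: "B \<in> sets N" using B sub by (auto simp: subalgebra_def)
  note Xm[measurable]
  have Xnm[measurable]: "Xn k \<in> borel_measurable N" for k using Xn by (auto simp: indep_gaussian_def)
  define \<mu> where "\<mu> = distr (density N (indicator B)) borel X"
  define \<mu>n where "\<mu>n k = distr (density N (indicator B)) borel (Xn k)" for k
  define \<gamma> where "\<gamma> = density (density (lborel :: (real ^ 'n) measure) (\<lambda>y. ennreal (gauss v y))) (\<lambda>_. emeasure N B)"
  have em: "emeasure (distr (density N (indicator B)) borel Z) C = emeasure N (Z -` C \<inter> B)"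
    if [measurable]: "Z \<in> borel_measurable N" and [measurable]: "C \<in> sets borel" for Z and C :: "(real ^ 'n) set"
  proof -
    have eq: "Z -` C \<inter> B = (Z -` C \<inter> space N) \<inter> B" using sets.sets_into_space[OF BN] by auto
    have "emeasure (distr (density N (indicator B)) borel Z) C = (\<integral>\<^sup>+w. indicator B w * indicator (Z -` C \<inter> space N) w \<partial>N)"
      by (simp add: emeasure_distr emeasure_density)
    also have "\<dots> = (\<integral>\<^sup>+w. indicator ((Z -` C \<inter> space N) \<inter> B) w \<partial>N)"
      by (rule nn_integral_cong) (simp split: split_indicator)
    also have "\<dots> = emeasure N (Z -` C \<inter> B)" unfolding eq by (rule nn_integral_indicator) measurable
    finally show ?thesis .
  qed
  have g: "emeasure \<gamma> C = emeasure N B * (\<integral>\<^sup>+y. ennreal (gauss v y) * indicator C y \<partial>lborel)"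
    if [measurable]: "C \<in> sets borel" for C
    unfolding \<gamma>_def
    by (simp add: emeasure_density nn_integral_density nn_integral_cmult mult.left_commute)
  have mun: "\<mu>n k = \<gamma>" for k
  proof (rule measure_eqI)
    fix C assume "C \<in> sets (\<mu>n k)"
    then have C: "C \<in> sets borel" by (simp add: \<mu>n_def)
    show "emeasure (\<mu>n k) C = emeasure \<gamma> C"
      unfolding g[OF C] using em[OF Xnm C, of k] Xn[of k] B C by (simp add: \<mu>n_def indep_gaussian_def)
  qed (simp add: \<mu>n_def \<gamma>_def)
  have fin: "finite_measure (distr (density N (indicator B)) borel Z)" if [measurable]: "Z \<in> borel_measurable N" for Z :: "'w \<Rightarrow> real ^ 'n"
    by (rule finite_measureI) (simp add: em)
  have "\<mu> = \<gamma>"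
  proof (rule measure_eqI_generator_eq[where E="{U. open U}" and \<Omega>=UNIV and A="\<lambda>_. UNIV"])
    show "Int_stable {U :: (real ^ 'n) set. open U}" by (auto simp: Int_stable_def)
    show "sets \<mu> = sigma_sets UNIV {U. open U}" "sets \<gamma> = sigma_sets UNIV {U. open U}"
      by (simp_all add: \<mu>_def \<gamma>_def borel_def)
    show "emeasure \<mu> UNIV \<noteq> \<infinity>" for i :: nat
      by (simp add: \<mu>_def em)
    fix U :: "(real ^ 'n) set" assume "U \<in> {U. open U}"
    then have U: "open U" by simp
    \<comment> \<open>The distance to the complement is only meaningful if \<open>U\<close> is not the whole space.\<close>
    show "emeasure \<mu> U = emeasure \<gamma> U"
    proof (cases "U = UNIV")
      case True
      then show ?thesis using em[OF Xm, of UNIV] em[OF Xnm[of 0], of UNIV] mun[of 0] by (simp add: \<mu>_def \<mu>n_def)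
    next
      case nU: False
    define \<phi> :: "nat \<Rightarrow> real ^ 'n \<Rightarrow> real" where "\<phi> m x = min 1 (real m * infdist x (- U))" for m x
    have \<phi>c: "continuous_on UNIV (\<phi> m)" for m unfolding \<phi>_def by (intro continuous_intros)
    then have \<phi>m[measurable]: "\<phi> m \<in> borel_measurable borel" for m by (rule borel_measurable_continuous_onI)
    have \<phi>b: "0 \<le> \<phi> m x" "\<phi> m x \<le> 1" for m x by (auto simp: \<phi>_def infdist_nonneg)
    have I: "(\<integral>x. \<phi> m x \<partial>\<mu>) = (\<integral>x. \<phi> m x \<partial>\<gamma>)" for m
    proof -
      have e: "(\<integral>x. \<phi> m x \<partial>distr (density N (indicator B)) borel Z) = (\<integral>w. \<phi> m (Z w) * indicator B w \<partial>N)"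
        if [measurable]: "Z \<in> borel_measurable N" for Z
      proof -
        have "(\<integral>x. \<phi> m x \<partial>distr (density N (indicator B)) borel Z) = (\<integral>w. \<phi> m (Z w) \<partial>density N (\<lambda>w. ennreal (indicator B w)))"
          by (subst integral_distr) (auto simp: ennreal_indicator)
        also have "\<dots> = (\<integral>w. \<phi> m (Z w) * indicator B w \<partial>N)"
          by (subst integral_density) (auto simp: mult.commute)
        finally show ?thesis .
      qed
      have "(\<lambda>k. \<integral>w. \<phi> m (Xn k w) * indicator B w \<partial>N) \<longlonglongrightarrow> (\<integral>w. \<phi> m (X w) * indicator B w \<partial>N)"
      proof (rule integral_dominated_convergence[where w="\<lambda>_. 1"])
        show "AE w in N. (\<lambda>k. \<phi> m (Xn k w) * indicator B w) \<longlonglongrightarrow> \<phi> m (X w) * indicator B w"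
          using lim
        proof eventually_elim
          case (elim w)
          have "isCont (\<phi> m) (X w)" using \<phi>c by (simp add: continuous_on_eq_continuous_at)
          from isCont_tendsto_compose[OF this elim] show ?case by (intro tendsto_mult) auto
        qed
        show "AE w in N. norm (\<phi> m (Xn k w) * indicator B w) \<le> 1" for k
          using \<phi>b by (auto simp: abs_mult split: split_indicator)
      qed auto
      moreover have "(\<integral>w. \<phi> m (Xn k w) * indicator B w \<partial>N) = (\<integral>x. \<phi> m x \<partial>\<gamma>)" for k
        using e[OF Xnm[of k]] mun[of k] by (simp add: \<mu>n_def)
      ultimately have "(\<integral>w. \<phi> m (X w) * indicator B w \<partial>N) = (\<integral>x. \<phi> m x \<partial>\<gamma>)"
        by (simp add: LIMSEQ_const_iff)
      then show ?thesis using e[OF Xm] by (simp add: \<mu>_def)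
    qed
    have L: "(\<lambda>m. \<integral>x. \<phi> m x \<partial>\<rho>) \<longlonglongrightarrow> measure \<rho> U"
      if fr: "finite_measure \<rho>" and s: "sets \<rho> = sets borel" for \<rho>
    proof -
      interpret finite_measure \<rho> by fact
      note s[measurable_cong]
      have "(\<lambda>m. \<integral>x. \<phi> m x \<partial>\<rho>) \<longlonglongrightarrow> (\<integral>x. indicator U x \<partial>\<rho>)"
      proof (rule integral_dominated_convergence[where w="\<lambda>_. 1"])
        show "AE x in \<rho>. (\<lambda>m. \<phi> m x) \<longlonglongrightarrow> indicator U x"
        proof (rule AE_I2)
          fix x
          show "(\<lambda>m. \<phi> m x) \<longlonglongrightarrow> indicator U x"
          proof (cases "x \<in> U")
            case False
            then have "infdist x (- U) = 0" by simp
            then show ?thesis using False by (simp add: \<phi>_def)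
          next
            case True
              have "- U \<noteq> {}" using nU by auto
              then have d: "infdist x (- U) > 0"
                using True closed_Compl[OF U] \<open>- U \<noteq> {}\<close> in_closed_iff_infdist_zero[of "- U" x] infdist_nonneg[of x "- U"] by auto
              obtain M :: nat where M: "1 / infdist x (- U) \<le> real M" using real_arch_simple by blast
              have "\<phi> m x = 1" if "m \<ge> M" for m
              proof -
                have "1 / infdist x (- U) \<le> real m" using M that by (meson of_nat_mono order_trans)
                then show ?thesis using d by (simp add: \<phi>_def field_simps)
              qed
              then have "eventually (\<lambda>m. \<phi> m x = indicator U x) sequentially"
                using True by (auto simp: eventually_sequentially)
              then show ?thesis by (rule tendsto_eventually)
          qed
        qed
        show "AE x in \<rho>. norm (\<phi> m x) \<le> 1" for m using \<phi>b by auto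
        show "(indicator U :: _ \<Rightarrow> real) \<in> borel_measurable \<rho>"
          using U by (intro borel_measurable_indicator) (simp add: s)
      qed (use \<phi>m s in auto)
      then show ?thesis using U s by simp
    qed
    interpret m: finite_measure \<mu> unfolding \<mu>_def by (rule fin) measurable
    interpret g: finite_measure \<gamma> unfolding mun[of 0, symmetric] \<mu>n_def by (rule fin) measurable
    have "measure \<mu> U = measure \<gamma> U"
      using L[of \<mu>] L[of \<gamma>] I m.finite_measure_axioms g.finite_measure_axioms
      by (auto simp: \<mu>_def \<gamma>_def intro: LIMSEQ_unique)
    then show ?thesis by (simp add: m.emeasure_eq_measure g.emeasure_eq_measure)
    qed
  qed auto
  then show "emeasure N (X -` A \<inter> B) = emeasure N B * (\<integral>\<^sup>+y. ennreal (gauss v y) * indicator A y \<partial>lborel)"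
    using em[OF Xm A] g[OF A] by (simp add: \<mu>_def)
qed

section \<open>Radial integrals of powers and exponentials of a linear form\<close>

lemma cosh_sums_even: "(\<lambda>k. x ^ (2 * k) / fact (2 * k)) sums cosh (x :: real)"
proof -
  have "(\<lambda>k. (\<lambda>n. if even n then x ^ n /\<^sub>R fact n else 0) (2 * k)) sums cosh x"
    by (subst sums_mono_reindex) (use cosh_converges[of x] in \<open>auto simp: strict_mono_def elim!: evenE\<close>)
  then show ?thesis by (simp add: divide_inverse mult.commute)
qed

text \<open>An even weight \<open>G\<close> only sees the even part \<open>cosh\<close> of the exponential, whose power series has
nonnegative terms and can be integrated term by term.\<close>

lemma nn_integral_exp_inner_even:
  fixes G :: "'a::euclidean_space \<Rightarrow> ennreal"
  assumes [measurable]: "G \<in> borel_measurable borel" and even: "\<And>y. G (- y) = G y"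
  shows "(\<integral>\<^sup>+y. G y * ennreal (exp (y \<bullet> \<theta>)) \<partial>lborel) =
    (\<Sum>k. ennreal (1 / fact (2 * k)) * (\<integral>\<^sup>+y. G y * ennreal ((y \<bullet> \<theta>) ^ (2 * k)) \<partial>lborel))"
proof -
  let ?I = "\<integral>\<^sup>+y. G y * ennreal (exp (y \<bullet> \<theta>)) \<partial>lborel"
  have "?I = (\<integral>\<^sup>+y. G (- y) * ennreal (exp ((- y) \<bullet> \<theta>)) \<partial>lborel)"
    by (subst lborel_affine[of "-1" 0]) (simp_all add: nn_integral_density nn_integral_distr)
  then have "?I = (\<integral>\<^sup>+y. G y * ennreal (exp (- (y \<bullet> \<theta>))) \<partial>lborel)" by (simp add: even)
  moreover have "?I = ennreal (1 / 2) * (?I + ?I)"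
  proof -
    have "ennreal (1 / 2) * 2 = 1"
      by (subst ennreal_numeral[symmetric], subst ennreal_mult'[symmetric]) auto
    then show ?thesis by (simp add: mult_2[symmetric] mult.assoc[symmetric])
  qed
  ultimately have "?I = ennreal (1 / 2) * (?I + (\<integral>\<^sup>+y. G y * ennreal (exp (- (y \<bullet> \<theta>))) \<partial>lborel))"
    by simp
  also have "\<dots> = (\<integral>\<^sup>+y. ennreal (1 / 2) * (G y * ennreal (exp (y \<bullet> \<theta>)) + G y * ennreal (exp (- (y \<bullet> \<theta>)))) \<partial>lborel)"
    by (simp add: nn_integral_add nn_integral_cmult)
  also have "\<dots> = (\<integral>\<^sup>+y. G y * ennreal (cosh (y \<bullet> \<theta>)) \<partial>lborel)"
  proof (rule nn_integral_cong)
    fix y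
    have "ennreal (1 / 2) * (ennreal (exp (y \<bullet> \<theta>)) + ennreal (exp (- (y \<bullet> \<theta>)))) = ennreal (cosh (y \<bullet> \<theta>))"
      by (subst ennreal_plus[symmetric], simp, simp, subst ennreal_mult'[symmetric]) (simp_all add: cosh_def)
    then show "ennreal (1 / 2) * (G y * ennreal (exp (y \<bullet> \<theta>)) + G y * ennreal (exp (- (y \<bullet> \<theta>)))) =
        G y * ennreal (cosh (y \<bullet> \<theta>))"
      by (simp only: distrib_left[symmetric] mult.left_commute)
  qed
  also have "\<dots> = (\<integral>\<^sup>+y. (\<Sum>k. ennreal (1 / fact (2 * k)) * (G y * ennreal ((y \<bullet> \<theta>) ^ (2 * k)))) \<partial>lborel)"
  proof (rule nn_integral_cong)
    fix y
    have "ennreal (cosh (y \<bullet> \<theta>)) = (\<Sum>k. ennreal ((y \<bullet> \<theta>) ^ (2 * k) / fact (2 * k)))"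
      using cosh_sums_even[of "y \<bullet> \<theta>"]
      by (subst suminf_ennreal2) (auto simp: zero_le_even_power sums_iff)
    then have "G y * ennreal (cosh (y \<bullet> \<theta>)) = (\<Sum>k. G y * ennreal ((y \<bullet> \<theta>) ^ (2 * k) / fact (2 * k)))"
      by simp
    also have "\<dots> = (\<Sum>k. ennreal (1 / fact (2 * k)) * (G y * ennreal ((y \<bullet> \<theta>) ^ (2 * k))))"
      by (intro suminf_cong) (simp add: mult.left_commute ennreal_mult'[symmetric])
    finally show "G y * ennreal (cosh (y \<bullet> \<theta>)) = \<dots>" .
  qed
  also have "\<dots> = (\<Sum>k. \<integral>\<^sup>+y. ennreal (1 / fact (2 * k)) * (G y * ennreal ((y \<bullet> \<theta>) ^ (2 * k))) \<partial>lborel)"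
    by (rule nn_integral_suminf) measurable
  also have "\<dots> = (\<Sum>k. ennreal (1 / fact (2 * k)) * (\<integral>\<^sup>+y. G y * ennreal ((y \<bullet> \<theta>) ^ (2 * k)) \<partial>lborel))"
    by (intro suminf_cong nn_integral_cmult) measurable
  finally show ?thesis .
qed

text \<open>Equality for positive arguments suffices: after division by the first power whose coefficients are not
yet compared, let the argument decrease to zero.\<close>

lemma powser_coeff_eqI:
  fixes a :: "nat \<Rightarrow> real"
  assumes "\<And>w. 0 < w \<Longrightarrow> (\<lambda>k. a k * w ^ k) sums f w" "\<And>w. 0 < w \<Longrightarrow> (\<lambda>k. b k * w ^ k) sums f w"
  shows "a k = b k"
proof (induction k rule: less_induct)
  case (less k)
  define c where "c j = a (j + k) - b (j + k)" for j
  have c: "(\<lambda>j. c j * w ^ j) sums 0" if w: "0 < w" for w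
  proof -
    have "(\<lambda>j. (a j - b j) * w ^ j) sums 0"
      using sums_diff[OF assms(1,2)[OF w]] by (simp add: left_diff_distrib)
    then have "(\<lambda>j. (a (j + k) - b (j + k)) * w ^ (j + k)) sums 0"
      by (subst sums_iff_shift) (use less in simp)
    then have "(\<lambda>j. inverse (w ^ k) * ((a (j + k) - b (j + k)) * w ^ (j + k))) sums (inverse (w ^ k) * 0)"
      by (rule sums_mult)
    moreover have "inverse (w ^ k) * ((a (j + k) - b (j + k)) * w ^ (j + k)) = c j * w ^ j" for j
      using w by (simp add: c_def power_add)
    ultimately show ?thesis by (simp only: mult_zero_right)
  qed
  have "isCont (\<lambda>w. \<Sum>j. c j * w ^ j) 0"
    by (rule isCont_powser[where K=1]) (use c[of 1] in \<open>auto simp: sums_iff\<close>)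
  then have "((\<lambda>w. \<Sum>j. c j * w ^ j) \<longlongrightarrow> c 0) (at_right 0)"
    unfolding isCont_def by (auto intro: tendsto_mono at_le)
  moreover have "((\<lambda>w. \<Sum>j. c j * w ^ j) \<longlongrightarrow> 0) (at_right 0)"
    by (rule tendsto_eventually) (use c in \<open>auto simp: eventually_at_right_less sums_iff intro: eventually_at_rightI[of 0 1]\<close>)
  ultimately have "c 0 = 0" by (rule tendsto_unique[rotated]) simp
  then show ?case by (simp add: c_def)
qed

lemma gauss_inner_exp:
  "(\<integral>\<^sup>+y. ennreal (gauss 1 y) * ennreal (exp (y \<bullet> \<theta>)) \<partial>lborel) = ennreal (exp ((norm (\<theta> :: real ^ 'n))\<^sup>2 / 2))"
proof -
  have one: "(\<integral>\<^sup>+x. ennreal (std_normal_density x * exp (x * s)) \<partial>lborel) = ennreal (exp (s\<^sup>2 / 2))" for s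
  proof -
    have "std_normal_density x * exp (x * s) = exp (s\<^sup>2 / 2) * normal_density s 1 x" for x
      by (simp add: normal_density_def exp_add[symmetric] field_simps power2_eq_square)
    moreover have "(\<integral>\<^sup>+x. ennreal (normal_density s 1 x) \<partial>lborel) = 1"
      by (subst nn_integral_eq_integral) auto
    ultimately show ?thesis by (simp add: ennreal_mult' nn_integral_cmult)
  qed
  have "(\<integral>\<^sup>+y. ennreal (gauss 1 y) * ennreal (exp (y \<bullet> \<theta>)) \<partial>lborel) =
      (\<integral>\<^sup>+y. (\<Prod>i\<in>UNIV. ennreal (std_normal_density (y $ i) * exp (y $ i * \<theta> $ i))) \<partial>lborel)"
    by (intro nn_integral_cong)
      (simp add: gauss_prod inner_vec_def exp_sum prod_ennreal ennreal_mult'[symmetric] prod.distrib prod_nonneg)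
  also have "\<dots> = (\<Prod>i\<in>UNIV. ennreal (exp ((\<theta> $ i)\<^sup>2 / 2)))"
    by (subst nn_integral_prod_vec[where f="\<lambda>i x. ennreal (std_normal_density x * exp (x * \<theta> $ i))"]) (simp_all add: one)
  also have "\<dots> = ennreal (exp ((norm \<theta>)\<^sup>2 / 2))"
    by (simp add: prod_ennreal exp_sum[symmetric] norm_vec_sq sum_divide_distrib)
  finally show ?thesis .
qed

text \<open>The exponential integral of \<open>sqrt w *\<^sub>R \<theta>\<close> is known in closed form and, by expansion, is a
power series in \<open>w\<close> whose coefficients are the even moments divided by factorials; comparing coefficients gives the moments.\<close>

lemma gauss_inner_moment:
  fixes \<theta> :: "real ^ 'n"
  shows "(\<integral>\<^sup>+y. ennreal ((y \<bullet> \<theta>) ^ (2 * k)) * ennreal (gauss 1 y) \<partial>lborel) =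
    ennreal (norm \<theta> ^ (2 * k) * (fact (2 * k) / (2 ^ k * fact k)))"
proof -
  define m where "m k = (\<integral>\<^sup>+y. ennreal (gauss 1 y) * ennreal ((y \<bullet> \<theta>) ^ (2 * k)) \<partial>lborel)" for k
  have ser: "(\<Sum>k. ennreal (w ^ k / fact (2 * k)) * m k) = ennreal (exp (w * (norm \<theta>)\<^sup>2 / 2))" if w: "0 < w" for w
  proof -
    have pw: "sqrt w ^ (2 * k) = w ^ k" for k using w by (simp add: power_mult)
    have "ennreal (exp (w * (norm \<theta>)\<^sup>2 / 2)) =
        (\<integral>\<^sup>+y. ennreal (gauss 1 y) * ennreal (exp (y \<bullet> (sqrt w *\<^sub>R \<theta>))) \<partial>lborel)"
      unfolding gauss_inner_exp using w by (simp add: power_mult_distrib)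
    also have "\<dots> = (\<Sum>k. ennreal (1 / fact (2 * k)) *
        (\<integral>\<^sup>+y. ennreal (gauss 1 y) * ennreal ((y \<bullet> (sqrt w *\<^sub>R \<theta>)) ^ (2 * k)) \<partial>lborel))"
      by (rule nn_integral_exp_inner_even) (auto simp: gauss_def)
    also have "\<dots> = (\<Sum>k. ennreal (w ^ k / fact (2 * k)) * m k)"
    proof (rule suminf_cong)
      fix k
      have "(\<integral>\<^sup>+y. ennreal (gauss 1 y) * ennreal ((y \<bullet> (sqrt w *\<^sub>R \<theta>)) ^ (2 * k)) \<partial>lborel) =
          (\<integral>\<^sup>+y. ennreal (w ^ k) * (ennreal (gauss 1 y) * ennreal ((y \<bullet> \<theta>) ^ (2 * k))) \<partial>lborel)"
        using w by (intro nn_integral_cong)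
          (simp add: power_mult_distrib pw ennreal_mult' zero_le_even_power mult.left_commute)
      also have "\<dots> = ennreal (w ^ k) * m k" unfolding m_def by (rule nn_integral_cmult) measurable
      finally show "ennreal (1 / fact (2 * k)) *
          (\<integral>\<^sup>+y. ennreal (gauss 1 y) * ennreal ((y \<bullet> (sqrt w *\<^sub>R \<theta>)) ^ (2 * k)) \<partial>lborel) =
          ennreal (w ^ k / fact (2 * k)) * m k"
        using w by (simp add: mult.assoc[symmetric] ennreal_mult'[symmetric])
    qed
    finally show ?thesis by simp
  qed
  have mfin: "m k \<noteq> \<infinity>" for k
  proof
    assume "m k = \<infinity>"
    then have "ennreal (1 ^ k / fact (2 * k)) * m k = \<infinity>" by (simp add: ennreal_mult_eq_top_iff)
    moreover have "ennreal (1 ^ k / fact (2 * k)) * m k \<le> (\<Sum>k. ennreal (1 ^ k / fact (2 * k)) * m k)"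
      by (rule order_trans[OF _ sum_le_suminf[of _ "{k}"]]) auto
    ultimately show False using ser[of 1] by (simp add: top_unique)
  qed
  define \<mu> where "\<mu> k = enn2real (m k)" for k
  have \<mu>: "m k = ennreal (\<mu> k)" "0 \<le> \<mu> k" for k
    using mfin[of k] by (simp_all add: \<mu>_def less_top)
  have "(\<lambda>k. (\<mu> k / fact (2 * k)) * w ^ k) sums exp (w * (norm \<theta>)\<^sup>2 / 2)" if w: "0 < w" for w
  proof -
    have nn: "0 \<le> \<mu> k / fact (2 * k) * w ^ k" for k using \<mu> w by simp
    have "(\<Sum>k. ennreal ((\<mu> k / fact (2 * k)) * w ^ k)) = ennreal (exp (w * (norm \<theta>)\<^sup>2 / 2))"
      using ser[OF w] \<mu> w by (simp add: ennreal_mult'[symmetric] mult.commute)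
    moreover have s: "summable (\<lambda>k. (\<mu> k / fact (2 * k)) * w ^ k)"
      by (rule summable_suminf_not_top) (use nn calculation in auto)
    ultimately show ?thesis
      using suminf_ennreal2[of "\<lambda>k. (\<mu> k / fact (2 * k)) * w ^ k", OF nn s] suminf_nonneg[OF s nn]
      by (simp add: sums_iff)
  qed
  moreover have "(\<lambda>k. (((norm \<theta>)\<^sup>2 / 2) ^ k / fact k) * w ^ k) sums exp (w * (norm \<theta>)\<^sup>2 / 2)" for w
  proof -
    have "(\<lambda>k. (x ^ k / fact k) * w ^ k) sums exp (w * x)" for x :: real
      using exp_converges[of "w * x"] by (simp add: divide_inverse power_mult_distrib mult.commute mult.left_commute)
    from this[of "(norm \<theta>)\<^sup>2 / 2"] show ?thesis by simp
  qed
  ultimately have "\<mu> k / fact (2 * k) = ((norm \<theta>)\<^sup>2 / 2) ^ k / fact k" by (rule powser_coeff_eqI)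
  moreover have "((norm \<theta>)\<^sup>2 / 2) ^ k = norm \<theta> ^ (2 * k) / 2 ^ k"
    by (simp add: power_divide power_mult)
  ultimately have "\<mu> k = norm \<theta> ^ (2 * k) / 2 ^ k / fact k * fact (2 * k)"
    by (simp add: divide_eq_eq)
  then have "\<mu> k = norm \<theta> ^ (2 * k) * (fact (2 * k) / (2 ^ k * fact k))" by simp
  then show ?thesis using \<mu>(1)[of k] by (simp add: m_def mult.commute)
qed

text \<open>The substitution \<open>u = r\<^sup>2 / 2\<close> on \<open>[0, n]\<close>, followed by \<open>n\<close> to infinity, turns the integral
into the Gamma integral.\<close>

lemma radial_gauss_moment:
  "(\<integral>\<^sup>+r. ennreal (r ^ p * exp (- r\<^sup>2 / 2)) * indicator {0..} r \<partial>lborel) =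
     ennreal (2 powr ((real p + 1) / 2 - 1) * Gamma ((real p + 1) / 2))"
proof -
  let ?s = "(real p + 1) / 2"
  let ?c = "2 powr (?s - 1)"
  let ?f = "\<lambda>u::real. ?c * (u powr (?s - 1) * exp (- u))"
  let ?h = "\<lambda>r::real. ennreal (r ^ p * exp (- r\<^sup>2 / 2))"
  have lim: "(\<integral>\<^sup>+x. g x * indicator {0..} x \<partial>lborel) = (SUP n::nat. \<integral>\<^sup>+x. g x * indicator {0..b n} x \<partial>lborel)"
    if [measurable]: "g \<in> borel_measurable borel" and b: "incseq b" "filterlim b at_top sequentially"
    for g :: "real \<Rightarrow> ennreal" and b :: "nat \<Rightarrow> real"
  proof -
    have "(SUP n. \<integral>\<^sup>+x. g x * indicator {0..b n} x \<partial>lborel) = (\<integral>\<^sup>+x. (SUP n. g x * indicator {0..b n} x) \<partial>lborel)"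
    proof (rule nn_integral_monotone_convergence_SUP[symmetric])
      show "incseq (\<lambda>n x. g x * indicator {0..b n} x)"
      proof (rule incseq_SucI, rule le_funI)
        fix n x
        have "b n \<le> b (Suc n)" using b(1) by (rule incseq_SucD)
        then show "g x * indicator {0..b n} x \<le> g x * indicator {0..b (Suc n)} x"
          by (auto split: split_indicator)
      qed
    qed measurable
    also have "\<dots> = (\<integral>\<^sup>+x. g x * indicator {0..} x \<partial>lborel)"
    proof (rule nn_integral_cong)
      fix x :: real
      obtain n where n: "x \<le> b n"
        using b(2) unfolding filterlim_at_top eventually_sequentially by blast
      show "(SUP n. g x * indicator {0..b n} x) = g x * indicator {0..} x"
      proof (rule antisym)
        show "(SUP n. g x * indicator {0..b n} x) \<le> g x * indicator {0..} x"
          by (rule SUP_least) (auto intro!: mult_left_mono split: split_indicator)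
        show "g x * indicator {0..} x \<le> (SUP n. g x * indicator {0..b n} x)"
          by (rule SUP_upper2[of n]) (use n in \<open>auto split: split_indicator\<close>)
      qed
    qed
    finally show ?thesis by simp
  qed
  have sub: "(\<integral>\<^sup>+r. ?h r * indicator {0..real n} r \<partial>lborel) =
      (\<integral>\<^sup>+u. ennreal (?f u) * indicator {0..(real n)\<^sup>2 / 2} u \<partial>lborel)" for n
  proof -
    have "(\<integral>\<^sup>+u. ennreal (?f u) * indicator {0..(real n)\<^sup>2 / 2} u \<partial>lborel) =
        (\<integral>\<^sup>+u. ?f u * indicator {0\<^sup>2 / 2..(real n)\<^sup>2 / 2} u \<partial>lborel)"
      by (intro nn_integral_cong) (auto split: split_indicator)
    also have "\<dots> = (\<integral>\<^sup>+x. ?f (x\<^sup>2 / 2) * x * indicator {0..real n} x \<partial>lborel)"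
      by (rule nn_integral_substitution[where g="\<lambda>x. x\<^sup>2 / 2" and g'="\<lambda>x. x"])
        (auto simp: set_borel_measurable_def intro!: derivative_eq_intros continuous_intros)
    also have "\<dots> = (\<integral>\<^sup>+r. ?h r * indicator {0..real n} r \<partial>lborel)"
    proof (rule nn_integral_cong_AE)
      have "AE x in lborel. x \<noteq> (0::real)" by (rule AE_lborel_singleton)
      then show "AE x in lborel. ennreal (?f (x\<^sup>2 / 2) * x * indicator {0..real n} x) = ?h x * indicator {0..real n} x"
      proof eventually_elim
        case (elim x)
        show ?case
        proof (cases "x > 0")
          case True
          have "(x\<^sup>2 / 2) powr (?s - 1) = (x\<^sup>2) powr (?s - 1) / ?c"
            using True by (simp add: powr_divide)
          also have "(x\<^sup>2) powr (?s - 1) = (x powr 2) powr (?s - 1)"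
            using True by (subst powr_numeral) simp_all
          also have "\<dots> = x powr (2 * (?s - 1))" by (rule powr_powr)
          finally have "?f (x\<^sup>2 / 2) * x = x powr (2 * (?s - 1)) * x powr 1 * exp (- x\<^sup>2 / 2)"
            using True by simp
          also have "x powr (2 * (?s - 1)) * x powr 1 = x powr real p"
            by (subst powr_add[symmetric]) (simp add: field_simps)
          finally show ?thesis using True by (simp add: powr_realpow split: split_indicator)
        qed (use elim in \<open>auto split: split_indicator\<close>)
      qed
    qed
    finally show ?thesis by simp
  qed
  have "(\<integral>\<^sup>+r. ?h r * indicator {0..} r \<partial>lborel) = (SUP n. \<integral>\<^sup>+r. ?h r * indicator {0..real n} r \<partial>lborel)"
    by (rule lim) (auto simp: incseq_def filterlim_real_sequentially)
  also have "\<dots> = (\<integral>\<^sup>+u. ennreal (?f u) * indicator {0..} u \<partial>lborel)"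
    unfolding sub
  proof (rule lim[symmetric])
    show "incseq (\<lambda>n. (real n)\<^sup>2 / 2)" by (auto simp: incseq_def intro!: divide_right_mono power_mono)
    show "filterlim (\<lambda>n. (real n)\<^sup>2 / 2) at_top sequentially"
    proof (rule filterlim_at_top_mono[OF filterlim_real_sequentially])
      have "real n \<le> (real n)\<^sup>2 / 2" if "2 \<le> n" for n
        using mult_right_mono[of 2 "real n" "real n"] that by (simp add: power2_eq_square)
      then show "\<forall>\<^sub>F n in sequentially. real n \<le> (real n)\<^sup>2 / 2"
        by (auto simp: eventually_sequentially)
    qed
  qed measurable
  also have "\<dots> = (\<integral>\<^sup>+u. ennreal ?c * ennreal (indicator {0..} u * u powr (?s - 1) / exp u) \<partial>lborel)"
  proof (rule nn_integral_cong)
    have "ennreal (c * (x * exp (- u))) * indicator {0..} u = ennreal c * ennreal (indicator {0..} u * x / exp u)"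
      if "0 \<le> c" for c x u :: real
      using ennreal_mult'[OF that, of "x * exp (- u)"] by (cases "0 \<le> u") (simp_all add: exp_minus divide_inverse)
    then show "ennreal (?f u) * indicator {0..} u = ennreal ?c * ennreal (indicator {0..} u * u powr (?s - 1) / exp u)" for u
      using powr_ge_zero by blast
  qed
  also have "\<dots> = ennreal ?c * ennreal (Gamma ?s)"
    by (subst nn_integral_cmult, measurable, subst Gamma_conv_nn_integral_real) (simp_all only:, simp)
  also have "\<dots> = ennreal (?c * Gamma ?s)" by (rule ennreal_mult'[symmetric]) simp
  finally show ?thesis .
qed

lemma nn_integral_inner_power_cball:
  fixes \<theta> :: "real ^ 'n"
  assumes r: "0 < r"
  shows "(\<integral>\<^sup>+y. ennreal ((y \<bullet> \<theta>) ^ (2 * k)) * indicator (cball 0 r) y \<partial>lborel) =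
    ennreal (r ^ (CARD('n) + 2 * k)) * (\<integral>\<^sup>+y. ennreal ((y \<bullet> \<theta>) ^ (2 * k)) * indicator (cball 0 1) y \<partial>lborel)"
proof -
  have [measurable]: "cball (0 :: real ^ 'n) \<rho> \<in> sets borel" for \<rho> by simp
  have "(\<integral>\<^sup>+y. ennreal ((y \<bullet> \<theta>) ^ (2 * k)) * indicator (cball 0 r) y \<partial>lborel) =
    (\<integral>\<^sup>+y. ennreal (r ^ CARD('n)) * (ennreal (((r *\<^sub>R y) \<bullet> \<theta>) ^ (2 * k)) * indicator (cball 0 r) (r *\<^sub>R y)) \<partial>lborel)"
    using r by (subst lborel_affine[of r 0]) (simp_all add: nn_integral_density nn_integral_distr)
  also have "\<dots> = (\<integral>\<^sup>+y. ennreal (r ^ (CARD('n) + 2 * k)) * (ennreal ((y \<bullet> \<theta>) ^ (2 * k)) * indicator (cball 0 1) y) \<partial>lborel)"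
    using r by (intro nn_integral_cong)
      (auto simp: power_mult_distrib power_add ennreal_mult' zero_le_even_power ac_simps split: split_indicator)
  also have "\<dots> = ennreal (r ^ (CARD('n) + 2 * k)) * (\<integral>\<^sup>+y. ennreal ((y \<bullet> \<theta>) ^ (2 * k)) * indicator (cball 0 1) y \<partial>lborel)"
    by (rule nn_integral_cmult) measurable
  finally show ?thesis .
qed

text \<open>The image under the norm of the measure with density \<open>(y \<bullet> \<theta>) ^ (2 * k)\<close> scales like a power of the
radius by homogeneity, so it has a density proportional to a power. This replaces polar coordinates.\<close>

lemma norm_distr_inner_power:
  fixes \<theta> :: "real ^ 'n"
  obtains C where "0 \<le> C" and "\<And>g. g \<in> borel_measurable borel \<Longrightarrow>
    (\<integral>\<^sup>+y. g (norm y) * ennreal ((y \<bullet> \<theta>) ^ (2 * k)) \<partial>lborel) =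
    (\<integral>\<^sup>+r. g r * ennreal (C * r ^ (CARD('n) - 1 + 2 * k)) * indicator {0..} r \<partial>lborel)"
proof -
  let ?h = "\<lambda>y :: real ^ 'n. ennreal ((y \<bullet> \<theta>) ^ (2 * k))"
  let ?q = "CARD('n) - 1 + 2 * k"
  have q: "CARD('n) + 2 * k = Suc ?q" by (simp add: Suc_leI)
  have "(\<integral>\<^sup>+y. ?h y * indicator (cball 0 1) y \<partial>lborel) \<le> (\<integral>\<^sup>+y. ennreal (norm \<theta> ^ (2 * k)) * indicator (cball 0 1) y \<partial>(lborel :: (real ^ 'n) measure))"
  proof (rule nn_integral_mono)
    fix y :: "real ^ 'n"
    have "(y \<bullet> \<theta>) ^ (2 * k) \<le> norm \<theta> ^ (2 * k)" if "norm y \<le> 1"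
    proof -
      have "\<bar>y \<bullet> \<theta>\<bar> \<le> norm \<theta>"
        using Cauchy_Schwarz_ineq2[of y \<theta>] mult_right_mono[OF that norm_ge_zero[of \<theta>]] by simp
      then have "\<bar>y \<bullet> \<theta>\<bar> ^ (2 * k) \<le> norm \<theta> ^ (2 * k)" by (intro power_mono) auto
      then show ?thesis by (simp add: power_even_abs)
    qed
    then show "?h y * indicator (cball 0 1) y \<le> ennreal (norm \<theta> ^ (2 * k)) * indicator (cball 0 1) y"
      by (auto simp: ennreal_leI split: split_indicator)
  qed
  also have "\<dots> < \<infinity>"
    using emeasure_lborel_cball_finite[of "0 :: real ^ 'n" 1]
    by (subst nn_integral_cmult_indicator) (auto simp: ennreal_mult_less_top)
  finally obtain \<phi> where \<phi>: "0 \<le> \<phi>" "(\<integral>\<^sup>+y. ?h y * indicator (cball 0 1) y \<partial>lborel) = ennreal \<phi>"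
    by (cases "\<integral>\<^sup>+y. ?h y * indicator (cball 0 1) y \<partial>lborel") auto
  define C where "C = real (Suc ?q) * \<phi>"
  have C: "0 \<le> C" using \<phi> by (simp add: C_def)
  let ?d = "\<lambda>r. ennreal (C * r ^ ?q) * indicator {0..} r"
  have "distr (density lborel ?h) borel norm = density lborel ?d"
  proof (rule measure_eqI_generator_eq[where E="range atMost" and \<Omega>=UNIV and A="\<lambda>i. {..real i}"])
    show "Int_stable (range (atMost :: real \<Rightarrow> _))" by (auto simp: Int_stable_def)
    show "sets (distr (density lborel ?h) borel norm) = sigma_sets UNIV (range (atMost :: real \<Rightarrow> _))"
      "sets (density lborel ?d) = sigma_sets UNIV (range (atMost :: real \<Rightarrow> _))"
      by (simp_all add: borel_eq_atMost)
    show "(\<Union>i. {..real i}) = UNIV" by (auto intro: real_arch_simple)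
    have L: "emeasure (distr (density lborel ?h) borel norm) {..r} =
        (\<integral>\<^sup>+y. ?h y * indicator (cball 0 r) y \<partial>lborel)" for r
    proof -
      have e: "norm -` {..r} = cball (0 :: real ^ 'n) r" by auto
      have "emeasure (distr (density lborel ?h) borel norm) {..r} = emeasure (density lborel ?h) (cball 0 r)"
        by (subst emeasure_distr) (auto simp: e)
      then show ?thesis by (simp add: emeasure_density)
    qed
    have R: "emeasure (distr (density lborel ?h) borel norm) {..r} = ennreal (r ^ Suc ?q * \<phi>)" if "0 < r" for r
      unfolding L nn_integral_inner_power_cball[OF that] q \<phi> using that \<phi>(1) by (simp add: ennreal_mult')
    have Z: "emeasure (distr (density lborel ?h) borel norm) {..r} = 0" if "r \<le> 0" for r
    proof -
      have "(\<integral>\<^sup>+y. ?h y * indicator (cball 0 r) y \<partial>lborel) = (\<integral>\<^sup>+y. 0 \<partial>(lborel :: (real ^ 'n) measure))"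
      proof (rule nn_integral_cong_AE)
        have "AE y in lborel. y \<noteq> (0 :: real ^ 'n)" by (rule AE_lborel_singleton)
        then show "AE y in lborel. ?h y * indicator (cball 0 r) y = 0"
        proof eventually_elim
          case (elim y)
          then have "0 < norm y" by simp
          then have "r < norm y" using that by linarith
          then have "y \<notin> cball 0 r" by simp
          then show ?case by simp
        qed
      qed
      then show ?thesis unfolding L by simp
    qed
    show "emeasure (distr (density lborel ?h) borel norm) {..real i} \<noteq> \<infinity>" for i
    proof (cases "0 < real i")
      case True
      show ?thesis unfolding R[OF True] by simp
    next
      case False
      then have "emeasure (distr (density lborel ?h) borel norm) {..real i} = 0" by (intro Z) simp
      then show ?thesis by (simp only:) simp
    qed
    fix X assume "X \<in> range (atMost :: real \<Rightarrow> _)"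
    then obtain r where X: "X = {..r}" by auto
    show "emeasure (distr (density lborel ?h) borel norm) X = emeasure (density lborel ?d) X"
    proof (cases "0 < r")
      case True
      have "emeasure (density lborel ?d) X = (\<integral>\<^sup>+x. ennreal (C * x ^ ?q) * indicator {0..r} x \<partial>lborel)"
        unfolding X by (subst emeasure_density) (auto intro!: nn_integral_cong split: split_indicator)
      also have "\<dots> = ennreal (r ^ Suc ?q * \<phi> - 0 ^ Suc ?q * \<phi>)"
        using True C
        by (intro nn_integral_FTC_Icc) (auto simp: C_def intro!: derivative_eq_intros)
      also have "\<dots> = ennreal (r ^ Suc ?q * \<phi>)"
        by (simp only: power_0_Suc mult_zero_left diff_zero)
      finally show ?thesis using R[OF True] X by (simp only:)
    next
      case False
      have dm: "?d \<in> borel_measurable lborel" by measurable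
      have "emeasure (density lborel ?d) X = (\<integral>\<^sup>+x. ?d x * indicator {..r} x \<partial>lborel)"
        unfolding X by (rule emeasure_density[OF dm]) simp
      also have "\<dots> = (\<integral>\<^sup>+x. 0 \<partial>(lborel :: real measure))"
      proof (rule nn_integral_cong_AE)
        have "AE y in lborel. y \<noteq> (0 :: real)" by (rule AE_lborel_singleton)
        then show "AE x in lborel. ?d x * indicator {..r} x = 0"
          by eventually_elim (use False in \<open>auto split: split_indicator\<close>)
      qed
      finally have "emeasure (density lborel ?d) X = 0" by simp
      then show ?thesis using Z[of r] False X by simp
    qed
  qed auto
  note eq = this
  show thesis
  proof (rule that[OF C])
    fix g :: "real \<Rightarrow> ennreal" assume [measurable]: "g \<in> borel_measurable borel"
    have "(\<integral>\<^sup>+r. g r \<partial>distr (density lborel ?h) borel norm) = (\<integral>\<^sup>+r. g r \<partial>density lborel ?d)"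
      unfolding eq ..
    then show "(\<integral>\<^sup>+y. g (norm y) * ?h y \<partial>lborel) =
        (\<integral>\<^sup>+r. g r * ennreal (C * r ^ ?q) * indicator {0..} r \<partial>lborel)"
      by (simp add: nn_integral_distr nn_integral_density ac_simps)
  qed
qed

text \<open>The constant left open by homogeneity is found by testing with \<open>g r = exp (- r\<^sup>2 / 2)\<close>, where
one side is a Gaussian moment and the other one a Gamma integral.\<close>

lemma nn_integral_norm_inner_power:
  fixes \<theta> :: "real ^ 'n"
  assumes [measurable]: "g \<in> borel_measurable borel"
  shows "(\<integral>\<^sup>+y. g (norm y) * ennreal ((y \<bullet> \<theta>) ^ (2 * k)) \<partial>lborel) =
    (\<integral>\<^sup>+r. g r * ennreal ((2 * pi) powr (real CARD('n) / 2) * norm \<theta> ^ (2 * k) * fact (2 * k) /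
      (2 ^ k * fact k * 2 powr (real CARD('n) / 2 + real k - 1) * Gamma (real CARD('n) / 2 + real k)) *
      r ^ (CARD('n) - 1 + 2 * k)) * indicator {0..} r \<partial>lborel)"
proof -
  obtain C where C: "0 \<le> C" and eq: "\<And>g. g \<in> borel_measurable borel \<Longrightarrow>
    (\<integral>\<^sup>+y. g (norm y) * ennreal ((y \<bullet> \<theta>) ^ (2 * k)) \<partial>lborel) =
    (\<integral>\<^sup>+r. g r * ennreal (C * r ^ (CARD('n) - 1 + 2 * k)) * indicator {0..} r \<partial>lborel)"
    using norm_distr_inner_power by blast
  let ?p = "CARD('n) - 1 + 2 * k"
  let ?D = "2 powr (real CARD('n) / 2 + real k - 1) * Gamma (real CARD('n) / 2 + real k)"
  let ?P = "(2 * pi) powr (real CARD('n) / 2)"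
  have n: "0 < CARD('n)" by simp
  have p: "(real ?p + 1) / 2 = real CARD('n) / 2 + real k" using n by (simp add: of_nat_diff Suc_leI field_simps)
  have D: "0 < ?D" using n by (intro mult_pos_pos Gamma_real_pos) (auto intro!: add_pos_nonneg)
  have "ennreal (?P * (norm \<theta> ^ (2 * k) * (fact (2 * k) / (2 ^ k * fact k)))) =
      ennreal ?P * (\<integral>\<^sup>+y. ennreal ((y \<bullet> \<theta>) ^ (2 * k)) * ennreal (gauss 1 y) \<partial>lborel)"
    unfolding gauss_inner_moment by (rule ennreal_mult') simp
  also have "\<dots> = (\<integral>\<^sup>+y. ennreal (exp (- (norm y)\<^sup>2 / 2)) * ennreal ((y \<bullet> \<theta>) ^ (2 * k)) \<partial>lborel)"
    by (subst nn_integral_cmult[symmetric])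
      (auto simp: gauss_def ennreal_mult'[symmetric] zero_le_even_power intro!: nn_integral_cong)
  also have "\<dots> = (\<integral>\<^sup>+r. ennreal (exp (- r\<^sup>2 / 2)) * ennreal (C * r ^ ?p) * indicator {0..} r \<partial>lborel)"
    by (rule eq[of "\<lambda>r. ennreal (exp (- r\<^sup>2 / 2))"]) measurable
  also have "\<dots> = (\<integral>\<^sup>+r. ennreal C * (ennreal (r ^ ?p * exp (- r\<^sup>2 / 2)) * indicator {0..} r) \<partial>lborel)"
    using C by (intro nn_integral_cong) (auto simp: ennreal_mult'[symmetric] ac_simps split: split_indicator)
  also have "\<dots> = ennreal (C * ?D)"
    by (subst nn_integral_cmult, measurable, subst radial_gauss_moment, simp only: p)
      (rule ennreal_mult'[OF C, symmetric])
  finally have "C * ?D = ?P * (norm \<theta> ^ (2 * k) * (fact (2 * k) / (2 ^ k * fact k)))"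
    using C D by (subst (asm) ennreal_inj) auto
  moreover have "c = p * a * b / (e * h * d1 * d2)"
    if "e * h \<noteq> 0" "d1 * d2 \<noteq> 0" "c * (d1 * d2) = p * (a * (b / (e * h)))" for c p a b e h d1 d2 :: real
    using that by (simp add: field_simps)
  ultimately have "C = ?P * norm \<theta> ^ (2 * k) * fact (2 * k) / (2 ^ k * fact k *
      2 powr (real CARD('n) / 2 + real k - 1) * Gamma (real CARD('n) / 2 + real k))"
    using D by (metis fact_nonzero less_irrefl mult_eq_0_iff power_not_zero zero_neq_numeral)
  then show ?thesis using eq[OF assms] by simp
qed

section \<open>The radial density as the norm of a Gaussian vector\<close>

text \<open>The entire function with \<open>bessel_I \<nu> z = (z / 2) powr \<nu> * bessel_series \<nu> ((z / 2)\<^sup>2)\<close>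
for \<open>z > 0\<close>; it is regular at zero, where \<open>bessel_I\<close> may be singular.\<close>

definition bessel_series :: "real \<Rightarrow> real \<Rightarrow> real" where
  "bessel_series \<nu> w = (\<Sum>k. 1 / (fact k * Gamma (\<nu> + real k + 1)) * w ^ k)"

text \<open>The density of the norm of a Gaussian vector in dimension \<open>d\<close> with variance \<open>c\<close> whose mean has norm
\<open>m\<close>. It covers the separate cases of \<open>radial_density\<close> at the boundary, because the
powers of \<open>x\<close> cancel against those in \<open>bessel_I\<close>, and because \<open>r ^ (d - 1)\<close>
is one at \<open>r = 0\<close> in dimension one.\<close>

definition radial_kernel :: "nat \<Rightarrow> real \<Rightarrow> real \<Rightarrow> real \<Rightarrow> real" where
  "radial_kernel d c m r =
     r ^ (d - 1) * exp (- (m\<^sup>2 + r\<^sup>2) / (2 * c)) * bessel_series (real d / 2 - 1) ((m * r / (2 * c))\<^sup>2) /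
       (2 powr (real d / 2 - 1) * c powr (real d / 2))"

text \<open>The recursion of the Gamma function bounds \<open>Gamma (\<nu> + k + 1)\<close> below by a geometric sequence,
so the series is dominated by an exponential series.\<close>

lemma bessel_series_summable:
  assumes "0 < \<nu> + 1"
  shows "summable (\<lambda>k. 1 / (fact k * Gamma (\<nu> + real k + 1)) * w ^ k)"
proof (rule summable_comparison_test')
  \<comment> \<open>For \<open>\<nu> = -1/2\<close> the first factor of the recursion is less than one.\<close>
  define \<delta> where "\<delta> = min 1 (\<nu> + 1)"
  have \<delta>: "0 < \<delta>" "\<delta> \<le> 1" "\<delta> \<le> \<nu> + 1" using assms by (auto simp: \<delta>_def)
  have G: "\<delta> ^ k * Gamma (\<nu> + 1) \<le> Gamma (\<nu> + real k + 1)" for k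
  proof (induction k)
    case (Suc k)
    have pos: "0 < \<nu> + real k + 1" using assms by simp
    have "\<delta> ^ Suc k * Gamma (\<nu> + 1) = \<delta> * (\<delta> ^ k * Gamma (\<nu> + 1))" by simp
    also have "\<dots> \<le> (\<nu> + real k + 1) * Gamma (\<nu> + real k + 1)"
      using Suc \<delta> assms by (intro mult_mono) (auto intro!: mult_nonneg_nonneg)
    also have "\<dots> = Gamma ((\<nu> + real k + 1) + 1)"
      by (rule Gamma_plus1[symmetric]) (use pos nonpos_Ints_nonpos in fastforce)
    finally show ?case by (simp add: ac_simps)
  qed simp
  have G0: "0 < Gamma (\<nu> + 1)" using assms by simp
  show "summable (\<lambda>k. inverse (fact k) * (\<bar>w\<bar> / \<delta>) ^ k * inverse (Gamma (\<nu> + 1)))"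
    by (intro summable_mult2 summable_exp)
  fix k :: nat assume "0 \<le> k"
  have "norm (1 / (fact k * Gamma (\<nu> + real k + 1)) * w ^ k) = \<bar>w\<bar> ^ k / fact k / \<bar>Gamma (\<nu> + real k + 1)\<bar>"
    by (simp add: abs_mult power_abs)
  also have "\<dots> \<le> \<bar>w\<bar> ^ k / fact k / (\<delta> ^ k * Gamma (\<nu> + 1))"
    using G[of k] G0 \<delta> by (intro divide_left_mono) (auto intro!: mult_pos_pos)
  also have "\<dots> = inverse (fact k) * (\<bar>w\<bar> / \<delta>) ^ k * inverse (Gamma (\<nu> + 1))"
    by (simp add: divide_inverse power_mult_distrib power_inverse)
  finally show "norm (1 / (fact k * Gamma (\<nu> + real k + 1)) * w ^ k) \<le> \<dots>" .
qed

lemma isCont_bessel_series: "0 < \<nu> + 1 \<Longrightarrow> isCont (bessel_series \<nu>) w"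
  unfolding bessel_series_def[abs_def]
  by (rule isCont_powser_converges_everywhere) (rule bessel_series_summable)

lemma bessel_series_nonneg:
  assumes "0 < \<nu> + 1" "0 \<le> w" shows "0 \<le> bessel_series \<nu> w"
  unfolding bessel_series_def
  by (rule suminf_nonneg[OF bessel_series_summable[OF assms(1)]])
    (use assms in \<open>auto intro!: mult_nonneg_nonneg divide_nonneg_nonneg\<close>)

lemma bessel_I_series:
  assumes "0 < \<nu> + 1" "0 < z"
  shows "bessel_I \<nu> z = (z / 2) powr \<nu> * bessel_series \<nu> ((z / 2)\<^sup>2)"
proof -
  have eq: "(z / 2) powr (2 * real m + \<nu>) / (fact m * Gamma (\<nu> + real m + 1)) =
      (z / 2) powr \<nu> * (1 / (fact m * Gamma (\<nu> + real m + 1)) * ((z / 2)\<^sup>2) ^ m)" for m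
  proof -
    have "(z / 2) powr (2 * real m + \<nu>) = (z / 2) powr real (2 * m) * (z / 2) powr \<nu>"
      by (simp add: powr_add)
    also have "(z / 2) powr real (2 * m) = (z / 2) ^ (2 * m)"
      using assms by (intro powr_realpow) simp
    also have "\<dots> = ((z / 2)\<^sup>2) ^ m" by (rule power_mult)
    finally show ?thesis by simp
  qed
  show ?thesis
    unfolding bessel_I_def bessel_series_def eq
    by (rule suminf_mult[OF bessel_series_summable[OF assms(1)]])
qed

lemma continuous_on_radial_kernel:
  assumes "0 < d" "0 < c" shows "continuous_on UNIV (\<lambda>z. radial_kernel d c (e * fst z) (snd z))"
proof -
  have "0 < (real d / 2 - 1) + 1" using assms by simp
  then have "continuous_on UNIV (bessel_series (real d / 2 - 1))"
    by (auto intro!: continuous_at_imp_continuous_on isCont_bessel_series)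
  moreover have "continuous_on UNIV (\<lambda>z. (e * fst z * snd z / (2 * c))\<^sup>2)"
    using assms by (intro continuous_intros) simp
  ultimately have "continuous_on UNIV (\<lambda>z. bessel_series (real d / 2 - 1) ((e * fst z * snd z / (2 * c))\<^sup>2))"
    by (rule continuous_on_compose2) simp
  then show ?thesis
    unfolding radial_kernel_def using assms by (intro continuous_on_divide continuous_on_mult) (auto intro!: continuous_intros)
qed

lemma radial_kernel_nonneg:
  assumes "0 < d" "0 \<le> r" shows "0 \<le> radial_kernel d c m r"
  using assms bessel_series_nonneg[of "real d / 2 - 1" "(m * r / (2 * c))\<^sup>2"]
  unfolding radial_kernel_def by simp

lemma radial_density_pos_eq:
  assumes d: "0 < d" and c: "0 < \<sigma>\<^sup>2 * kappa a t" and x: "0 \<le> x" and y: "0 < y"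
  shows "radial_density_pos (real d / 2 - 1) a \<sigma> t x y = radial_kernel d (\<sigma>\<^sup>2 * kappa a t) (exp (a * t) * x) y"
proof -
  define c where "c = \<sigma>\<^sup>2 * kappa a t"
  define \<nu> where "\<nu> = real d / 2 - 1"
  have c0: "0 < c" using c by (simp add: c_def)
  have nu: "0 < \<nu> + 1" using d by (simp add: \<nu>_def)
  have e2: "exp (2 * a * t) * x\<^sup>2 = (exp (a * t) * x)\<^sup>2"
    by (simp add: power_mult_distrib exp_double[symmetric] mult.assoc)
  have yp: "y powr (2 * \<nu> + 1) = y ^ (d - 1)"
  proof -
    have "2 * \<nu> + 1 = real (d - 1)" using d by (simp add: \<nu>_def of_nat_diff Suc_leI)
    then show ?thesis using y by (simp add: powr_realpow)
  qed
  have cp: "c powr (real d / 2) = c powr \<nu> * c"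
    using c0 powr_add[of c \<nu> 1] by (simp add: \<nu>_def)
  have rk: "radial_kernel d c (exp (a * t) * x) y =
      y powr (2 * \<nu> + 1) * exp (- ((exp (a * t) * x)\<^sup>2 + y\<^sup>2) / (2 * c)) *
        bessel_series \<nu> ((exp (a * t) * x * y / (2 * c))\<^sup>2) / (2 powr \<nu> * (c powr \<nu> * c))"
    unfolding radial_kernel_def \<nu>_def[symmetric] yp cp ..
  show ?thesis
  proof (cases "x > 0")
    case True
    define z where "z = exp (a * t) * x * y / c"
    define A where "A = exp (- a * \<nu> * t) * y powr (\<nu> + 1) / (c * x powr \<nu>)"
    define G where "G = exp (- ((exp (a * t) * x)\<^sup>2 + y\<^sup>2) / (2 * c))"
    define S where "S = bessel_series \<nu> ((exp (a * t) * x * y / (2 * c))\<^sup>2)"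
    have z: "0 < z" using True y c0 by (simp add: z_def)
    have A: "A * (z / 2) powr \<nu> = y powr (2 * \<nu> + 1) / (2 powr \<nu> * (c powr \<nu> * c))"
    proof -
      have E: "exp (a * t) powr \<nu> = exp (a * \<nu> * t)" by (simp add: powr_def mult.commute mult.left_commute)
      have "(z / 2) powr \<nu> = (exp (a * t) * x * y / (c * 2)) powr \<nu>" by (simp add: z_def)
      also have "\<dots> = exp (a * \<nu> * t) * x powr \<nu> * y powr \<nu> / (c powr \<nu> * 2 powr \<nu>)"
        unfolding E[symmetric] using True y c0 by (simp add: powr_divide powr_mult)
      finally have 1: "(z / 2) powr \<nu> = exp (a * \<nu> * t) * x powr \<nu> * y powr \<nu> / (c powr \<nu> * 2 powr \<nu>)" .
      have 2: "y powr (2 * \<nu> + 1) = y powr (\<nu> + 1) * y powr \<nu>"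
        by (simp add: powr_add[symmetric])
      have 3: "exp (- a * \<nu> * t) * exp (a * \<nu> * t) = 1" by (simp add: exp_add[symmetric])
      have gen: "E' * y1 / (k * xn) * (E * xn * y2 / (cn * n2)) = y1 * y2 / (n2 * (cn * k))"
        if "E' * E = 1" "xn \<noteq> 0" for E' E xn y1 y2 cn n2 k :: real
      proof -
        have "E' * y1 / (k * xn) * (E * xn * y2 / (cn * n2)) = (E' * E) * (xn / xn) * (y1 * y2 / (n2 * (cn * k)))"
          by (simp add: ac_simps)
        then show ?thesis using that by simp
      qed
      show ?thesis unfolding A_def 1 2 by (rule gen[OF 3]) (use True in simp)
    qed
    have B: "bessel_I \<nu> z = (z / 2) powr \<nu> * S"
      using bessel_I_series[OF nu z] by (simp add: z_def S_def mult.commute)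
    have c2: "2 * \<sigma>\<^sup>2 * kappa a t = 2 * c" by (simp add: c_def)
    have "radial_density_pos \<nu> a \<sigma> t x y = A * G * bessel_I \<nu> z"
      using True unfolding radial_density_pos_def c2 e2 c_def[symmetric] A_def G_def z_def by simp
    also have "\<dots> = (A * (z / 2) powr \<nu>) * G * S" unfolding B by (simp only: mult.assoc mult.left_commute mult.commute)
    also have "\<dots> = y powr (2 * \<nu> + 1) * G * S / (2 powr \<nu> * (c powr \<nu> * c))" unfolding A by simp
    finally show ?thesis unfolding c_def[symmetric] \<nu>_def[symmetric] rk G_def S_def .
  next
    case False
    then have x0: "x = 0" using x by simp
    have b0: "bessel_series \<nu> 0 = 1 / Gamma (\<nu> + 1)"
      unfolding bessel_series_def by (subst powser_zero) simp
    have c2: "2 * \<sigma>\<^sup>2 * kappa a t = 2 * c" by (simp add: c_def)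
    have c1: "c powr (\<nu> + 1) = c powr \<nu> * c" using c0 by (simp add: powr_add)
    show ?thesis
      unfolding radial_density_pos_def c2 c_def[symmetric] \<nu>_def[symmetric] rk c1 using x0 b0 by simp
  qed
qed

text \<open>At \<open>y = 0\<close> the density is defined as a limit, and \<open>radial_kernel\<close> is continuous there.\<close>

lemma radial_density_eq:
  assumes d: "0 < d" and c: "0 < \<sigma>\<^sup>2 * kappa a t" and x: "0 \<le> x" and y: "0 \<le> y"
  shows "radial_density d a \<sigma> t x y = radial_kernel d (\<sigma>\<^sup>2 * kappa a t) (exp (a * t) * x) y"
proof (cases "y > 0")
  case True
  then show ?thesis by (simp add: radial_density_def Let_def radial_density_pos_eq[OF d c x])
next
  case False
  then have y0: "y = 0" using y by simp
  let ?k = "radial_kernel d (\<sigma>\<^sup>2 * kappa a t) (exp (a * t) * x)"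
  have "continuous_on UNIV ?k"
    using continuous_on_compose2[OF continuous_on_radial_kernel[OF d c, of "exp (a * t)"],
        of UNIV "\<lambda>y. (x, y)"] by (simp add: continuous_intros)
  then have "(?k \<longlongrightarrow> ?k 0) (at_right 0)"
    by (simp add: continuous_on_eq_continuous_within continuous_within Lim_at_imp_Lim_at_within)
  moreover have "eventually (\<lambda>y. ?k y = radial_density_pos (real d / 2 - 1) a \<sigma> t x y) (at_right 0)"
    by (rule eventually_at_rightI[of 0 1]) (simp_all add: radial_density_pos_eq[OF d c x])
  ultimately have "(radial_density_pos (real d / 2 - 1) a \<sigma> t x \<longlongrightarrow> ?k 0) (at_right 0)"
    by (rule Lim_transform_eventually)
  then have "Lim (at_right 0) (radial_density_pos (real d / 2 - 1) a \<sigma> t x) = ?k 0"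
    by (intro tendsto_Lim) simp
  then show ?thesis by (simp add: radial_density_def Let_def y0)
qed

text \<open>Expanding the exponential and integrating each even power radially, the Gamma function from the radial
integral of degree \<open>2 * k\<close> becomes the one in the \<open>k\<close>-th term of the Bessel series.\<close>

lemma nn_integral_norm_exp_inner:
  fixes \<theta> :: "real ^ 'n"
  assumes g[measurable]: "g \<in> borel_measurable borel"
  shows "(\<integral>\<^sup>+y. g (norm y) * ennreal (exp (y \<bullet> \<theta>)) \<partial>lborel) =
    (\<integral>\<^sup>+r. g r * ennreal ((2 * pi) powr (real CARD('n) / 2) / 2 powr (real CARD('n) / 2 - 1) *
      (r ^ (CARD('n) - 1) * bessel_series (real CARD('n) / 2 - 1) ((norm \<theta> * r / 2)\<^sup>2))) * indicator {0..} r \<partial>lborel)"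
proof -
  let ?n = "real CARD('n)" and ?P = "(2 * pi) powr (real CARD('n) / 2)"
  let ?\<nu> = "real CARD('n) / 2 - 1"
  define A where "A k = ?P * norm \<theta> ^ (2 * k) * fact (2 * k) /
      (2 ^ k * fact k * 2 powr (?n / 2 + real k - 1) * Gamma (?n / 2 + real k))" for k
  have nu: "0 < ?\<nu> + 1" by simp
  have Gp: "0 < Gamma (?n / 2 + real k)" for k
    by (rule Gamma_real_pos) (simp add: add_pos_nonneg)
  have A0: "0 \<le> A k" for k
    unfolding A_def using Gp[of k] by (intro divide_nonneg_nonneg mult_nonneg_nonneg) auto
  have "(\<integral>\<^sup>+y. g (norm y) * ennreal (exp (y \<bullet> \<theta>)) \<partial>lborel) =
      (\<Sum>k. ennreal (1 / fact (2 * k)) * (\<integral>\<^sup>+y. g (norm y) * ennreal ((y \<bullet> \<theta>) ^ (2 * k)) \<partial>lborel))"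
    by (rule nn_integral_exp_inner_even) simp_all
  also have "\<dots> = (\<Sum>k. ennreal (1 / fact (2 * k)) *
      (\<integral>\<^sup>+r. g r * ennreal (A k * r ^ (CARD('n) - 1 + 2 * k)) * indicator {0..} r \<partial>lborel))"
    unfolding A_def by (intro suminf_cong, subst nn_integral_norm_inner_power[OF g]) simp
  also have "\<dots> = (\<Sum>k. \<integral>\<^sup>+r. ennreal (1 / fact (2 * k)) * (g r * ennreal (A k * r ^ (CARD('n) - 1 + 2 * k)) * indicator {0..} r) \<partial>lborel)"
    by (intro suminf_cong nn_integral_cmult[symmetric]) measurable
  also have "\<dots> = (\<integral>\<^sup>+r. (\<Sum>k. ennreal (1 / fact (2 * k)) * (g r * ennreal (A k * r ^ (CARD('n) - 1 + 2 * k)) * indicator {0..} r)) \<partial>lborel)"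
    by (rule nn_integral_suminf[symmetric]) measurable
  also have "\<dots> = (\<integral>\<^sup>+r. g r * ennreal (?P / 2 powr ?\<nu> *
      (r ^ (CARD('n) - 1) * bessel_series ?\<nu> ((norm \<theta> * r / 2)\<^sup>2))) * indicator {0..} r \<partial>lborel)"
  proof (rule nn_integral_cong)
    fix r :: real
    show "(\<Sum>k. ennreal (1 / fact (2 * k)) * (g r * ennreal (A k * r ^ (CARD('n) - 1 + 2 * k)) * indicator {0..} r)) =
        g r * ennreal (?P / 2 powr ?\<nu> * (r ^ (CARD('n) - 1) * bessel_series ?\<nu> ((norm \<theta> * r / 2)\<^sup>2))) * indicator {0..} r"
    proof (cases "0 \<le> r")
      case r: True
      define w where "w = (norm \<theta> * r / 2)\<^sup>2"
      define B where "B = ?P / 2 powr ?\<nu> * r ^ (CARD('n) - 1)"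
      define b where "b k = 1 / (fact k * Gamma (?\<nu> + real k + 1)) * w ^ k" for k
      have w: "0 \<le> w" by (simp add: w_def)
      have bn: "0 \<le> b k" for k
        unfolding b_def using Gp[of k] w by (intro mult_nonneg_nonneg divide_nonneg_nonneg) auto
      have Bn: "0 \<le> B" using r by (simp add: B_def)
      have sm: "summable b" unfolding b_def by (rule bessel_series_summable[OF nu])
      have coef: "1 / fact (2 * k) * (A k * r ^ (CARD('n) - 1 + 2 * k)) = B * b k" for k
      proof -
        have 1: "2 powr (?n / 2 + real k - 1) = 2 powr ?\<nu> * 2 ^ k"
          using powr_add[of 2 ?\<nu> "real k"] by (simp add: powr_realpow algebra_simps)
        have 2: "w ^ k = norm \<theta> ^ (2 * k) * r ^ (2 * k) / (2 ^ k * 2 ^ k)"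
          unfolding w_def by (simp add: power_divide power_mult_distrib power_mult[symmetric] mult.commute[of k] flip: power_mult_distrib power_add)
        have 3: "?\<nu> + real k + 1 = ?n / 2 + real k" by simp
        have gen: "1 / f2 * (p * t * f2 / (p2 * fk * (p\<nu> * p2) * G) * (r1 * r2)) =
            p / p\<nu> * r1 * (1 / (fk * G) * (t * r2 / (p2 * p2)))"
          if "f2 \<noteq> 0" for f2 p t p2 fk p\<nu> G r1 r2 :: real
        proof -
          have "1 / f2 * (p * t * f2 / (p2 * fk * (p\<nu> * p2) * G) * (r1 * r2)) = p * t * (r1 * r2) / (p2 * fk * (p\<nu> * p2) * G)"
            using that by simp
          also have "\<dots> = p * r1 * (t * r2) / (p\<nu> * (fk * G * (p2 * p2)))" by (simp only: ac_simps)
          also have "p * r1 * (t * r2) / (p\<nu> * (fk * G * (p2 * p2))) = p / p\<nu> * r1 * (1 / (fk * G) * (t * r2 / (p2 * p2)))"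
            by simp
          finally show ?thesis .
        qed
        show ?thesis unfolding A_def B_def b_def 1 2 3 power_add by (rule gen) simp
      qed
      have "(\<Sum>k. ennreal (1 / fact (2 * k)) * (g r * ennreal (A k * r ^ (CARD('n) - 1 + 2 * k)) * indicator {0..} r)) =
          (\<Sum>k. g r * ennreal (B * b k))"
      proof (rule suminf_cong)
        fix k
        have "ennreal (1 / fact (2 * k)) * ennreal (A k * r ^ (CARD('n) - 1 + 2 * k)) = ennreal (B * b k)"
          unfolding coef[symmetric] by (rule ennreal_mult'[symmetric]) simp
        then show "ennreal (1 / fact (2 * k)) * (g r * ennreal (A k * r ^ (CARD('n) - 1 + 2 * k)) * indicator {0..} r) = g r * ennreal (B * b k)"
          using r by (simp add: mult.left_commute)
      qed
      also have "\<dots> = g r * ennreal (\<Sum>k. B * b k)"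
        using bn Bn sm by (simp add: suminf_ennreal2 summable_mult)
      also have "(\<Sum>k. B * b k) = B * bessel_series ?\<nu> w"
        unfolding bessel_series_def b_def[symmetric] by (rule suminf_mult[OF sm])
      finally show ?thesis using r by (simp add: B_def w_def mult.assoc)
    qed simp
  qed
  finally show ?thesis .
qed

text \<open>Completing the square leaves the exponential of the linear form \<open>y \<bullet> m / c\<close> under a radial weight.\<close>

lemma norm_gauss_eq_radial:
  fixes m :: "real ^ 'n"
  assumes c: "0 < c" and g[measurable]: "g \<in> borel_measurable borel"
  shows "(\<integral>\<^sup>+y. ennreal (gauss c (y - m)) * g (norm y) \<partial>lborel) =
    (\<integral>\<^sup>+r. ennreal (radial_kernel CARD('n) c (norm m) r) * g r * indicator {0..} r \<partial>lborel)"
proof -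
  let ?K = "1 / (2 * pi * c) powr (real CARD('n) / 2)"
  let ?e = "\<lambda>r::real. exp (- ((norm m)\<^sup>2 + r\<^sup>2) / (2 * c))"
  let ?\<theta> = "inverse c *\<^sub>R m"
  let ?P = "(2 * pi) powr (real CARD('n) / 2)" and ?\<nu> = "real CARD('n) / 2 - 1"
  have ge: "gauss c (y - m) = ?K * ?e (norm y) * exp (y \<bullet> ?\<theta>)" for y
  proof -
    have "(norm (y - m))\<^sup>2 = (norm y)\<^sup>2 + (norm m)\<^sup>2 - 2 * (y \<bullet> m)"
      unfolding power2_norm_eq_inner by (simp add: inner_diff_left inner_diff_right inner_commute)
    then have "- (norm (y - m))\<^sup>2 / (2 * c) = - ((norm m)\<^sup>2 + (norm y)\<^sup>2) / (2 * c) + y \<bullet> ?\<theta>"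
      using c by (simp add: field_simps)
    then show ?thesis unfolding gauss_def by (simp add: exp_add)
  qed
  have "(\<integral>\<^sup>+y. ennreal (gauss c (y - m)) * g (norm y) \<partial>lborel) =
      (\<integral>\<^sup>+y. (g (norm y) * ennreal (?K * ?e (norm y))) * ennreal (exp (y \<bullet> ?\<theta>)) \<partial>lborel)"
    unfolding ge
  proof (rule nn_integral_cong)
    fix y
    have "ennreal (?K * ?e (norm y) * exp (y \<bullet> ?\<theta>)) = ennreal (?K * ?e (norm y)) * ennreal (exp (y \<bullet> ?\<theta>))"
      by (rule ennreal_mult') simp
    then show "ennreal (?K * ?e (norm y) * exp (y \<bullet> ?\<theta>)) * g (norm y) =
        (g (norm y) * ennreal (?K * ?e (norm y))) * ennreal (exp (y \<bullet> ?\<theta>))"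
      by (simp only: ac_simps)
  qed
  also have "\<dots> = (\<integral>\<^sup>+r. (g r * ennreal (?K * ?e r)) * ennreal (?P / 2 powr ?\<nu> *
      (r ^ (CARD('n) - 1) * bessel_series ?\<nu> ((norm ?\<theta> * r / 2)\<^sup>2))) * indicator {0..} r \<partial>lborel)"
    by (rule nn_integral_norm_exp_inner[where g="\<lambda>r. g r * ennreal (?K * ?e r)"]) measurable
  also have "\<dots> = (\<integral>\<^sup>+r. ennreal (radial_kernel CARD('n) c (norm m) r) * g r * indicator {0..} r \<partial>lborel)"
  proof (rule nn_integral_cong)
    fix r
    have w: "norm ?\<theta> * r / 2 = norm m * r / (2 * c)" using c by (simp add: field_simps)
    have p: "(2 * pi * c) powr (real CARD('n) / 2) = ?P * c powr (real CARD('n) / 2)"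
      using c by (simp add: powr_mult)
    have gen: "1 / (P * cn) * e * (P / n2 * (x * b)) = x * e * b / (n2 * cn)"
      if "P \<noteq> 0" for P cn e n2 x b :: real
    proof -
      have "1 / (P * cn) * e * (P / n2 * (x * b)) = e * (x * b) / (cn * n2)" using that by simp
      also have "\<dots> = x * e * b / (n2 * cn)" by (simp only: ac_simps)
      finally show ?thesis .
    qed
    have "?K * ?e r * (?P / 2 powr ?\<nu> * (r ^ (CARD('n) - 1) * bessel_series ?\<nu> ((norm ?\<theta> * r / 2)\<^sup>2))) =
        radial_kernel CARD('n) c (norm m) r"
      unfolding w p radial_kernel_def by (rule gen) simp
    then have e: "ennreal (?K * ?e r) * ennreal (?P / 2 powr ?\<nu> *
        (r ^ (CARD('n) - 1) * bessel_series ?\<nu> ((norm ?\<theta> * r / 2)\<^sup>2))) =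
        ennreal (radial_kernel CARD('n) c (norm m) r)"
      by (subst ennreal_mult'[symmetric]) (simp, simp only:)
    have ac: "(h * k) * l * i = (k * l) * h * i" for h k l i :: ennreal by (simp only: ac_simps)
    show "(g r * ennreal (?K * ?e r)) * ennreal (?P / 2 powr ?\<nu> *
      (r ^ (CARD('n) - 1) * bessel_series ?\<nu> ((norm ?\<theta> * r / 2)\<^sup>2))) * indicator {0..} r =
      ennreal (radial_kernel CARD('n) c (norm m) r) * g r * indicator {0..} r"
      by (rule trans[OF ac]) (simp only: e)
  qed
  finally show ?thesis .
qed

section \<open>Sub-sigma-algebras up to null sets\<close>

text \<open>The solution \<open>Z\<close> is determined by the Wiener process only up to null sets, so its past need not be
contained in the past of \<open>W\<close>, but it is contained in this enlargement.\<close>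

definition ae_completion :: "'w measure \<Rightarrow> 'w measure \<Rightarrow> 'w measure" where
  "ae_completion N F = sigma (space N) {B \<in> sets N. \<exists>B'\<in>sets F. AE w in N. w \<in> B \<longleftrightarrow> w \<in> B'}"

lemma space_ae_completion [simp]: "space (ae_completion N F) = space N"
  unfolding ae_completion_def by (rule space_measure_of) (auto dest: sets.sets_into_space)

lemma sets_ae_completion:
  assumes "subalgebra N F"
  shows "sets (ae_completion N F) = {B \<in> sets N. \<exists>B'\<in>sets F. AE w in N. w \<in> B \<longleftrightarrow> w \<in> B'}" (is "_ = ?S")
proof -
  have sF: "space F = space N" using assms by (simp add: subalgebra_def)
  have cl: "B \<in> ?S" if "B \<in> sigma_sets (space N) ?S" for B
    using that
  proof induction
    case (Basic B)
    then show ?case .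
  next
    case Empty
    show ?case using sets.empty_sets[of F] by force
  next
    case (Compl B)
    then obtain B' where B: "B \<in> sets N" "B' \<in> sets F" "AE w in N. w \<in> B \<longleftrightarrow> w \<in> B'" by auto
    have "AE w in N. w \<in> space N" by simp
    with B(3) have "AE w in N. w \<in> space N - B \<longleftrightarrow> w \<in> space F - B'"
      by eventually_elim (auto simp: sF)
    moreover have "space F - B' \<in> sets F" using B(2) by (rule sets.compl_sets)
    ultimately show ?case using B(1) by blast
  next
    case (Union A)
    then have "\<forall>i. \<exists>B'\<in>sets F. AE w in N. w \<in> A i \<longleftrightarrow> w \<in> B'" by auto
    then obtain A' where A': "\<And>i. A' i \<in> sets F" "\<And>i. AE w in N. w \<in> A i \<longleftrightarrow> w \<in> A' i" by metis
    have "AE w in N. \<forall>i. w \<in> A i \<longleftrightarrow> w \<in> A' i" using A'(2) by (simp add: AE_all_countable)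
    then have "AE w in N. w \<in> (\<Union>i. A i) \<longleftrightarrow> w \<in> (\<Union>i. A' i)" by eventually_elim simp
    moreover have "(\<Union>i. A' i) \<in> sets F" using A'(1) by (intro sets.countable_UN) auto
    moreover have "(\<Union>i. A i) \<in> sets N" using Union by (intro sets.countable_UN) auto
    ultimately show ?case by (intro CollectI conjI bexI[of _ "\<Union>i. A' i"])
  qed
  have "sigma_sets (space N) ?S = ?S"
    by (rule antisym, rule subsetI, erule cl, rule sigma_sets_superset_generator)
  then show ?thesis
    unfolding ae_completion_def by (subst sets_measure_of) (auto dest: sets.sets_into_space)
qed

lemma subalgebra_ae_completion: "subalgebra N F \<Longrightarrow> subalgebra N (ae_completion N F)"
  using sets_ae_completion[of N F] by (auto simp: subalgebra_def)

lemma sets_ae_completion_superset: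
  assumes "subalgebra N F" shows "sets F \<subseteq> sets (ae_completion N F)"
  using assms unfolding sets_ae_completion[OF assms] by (auto simp: subalgebra_def)

lemma measurable_ae_completion_AE:
  assumes F: "subalgebra N F" and X': "X' \<in> measurable (ae_completion N F) L"
    and X: "X \<in> measurable N L" and ae: "AE w in N. X w = X' w"
  shows "X \<in> measurable (ae_completion N F) L"
proof (rule measurableI)
  fix A assume A: "A \<in> sets L"
  have "X' -` A \<inter> space N \<in> sets (ae_completion N F)" using measurable_sets[OF X' A] by simp
  then obtain B' where B': "B' \<in> sets F" "AE w in N. w \<in> X' -` A \<inter> space N \<longleftrightarrow> w \<in> B'"
    unfolding sets_ae_completion[OF F] by auto
  have "AE w in N. w \<in> X -` A \<inter> space N \<longleftrightarrow> w \<in> B'"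
    using B'(2) ae by eventually_elim auto
  then show "X -` A \<inter> space (ae_completion N F) \<in> sets (ae_completion N F)"
    unfolding space_ae_completion unfolding sets_ae_completion[OF F] using measurable_sets[OF X A] B'(1) by blast
qed (use X in \<open>auto dest: measurable_space\<close>)

lemma measurable_ae_completion_limit:
  fixes X :: "'w \<Rightarrow> 'a::euclidean_space"
  assumes F: "subalgebra N F" and Xn: "\<And>n. Xn n \<in> borel_measurable (ae_completion N F)"
    and X: "X \<in> borel_measurable N" and lim: "AE w in N. (\<lambda>n. Xn n w) \<longlonglongrightarrow> X w"
  shows "X \<in> borel_measurable (ae_completion N F)"
proof (rule measurable_ae_completion_AE[OF F _ X])
  show "(\<lambda>w. lim (\<lambda>n. Xn n w)) \<in> borel_measurable (ae_completion N F)"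
    by (rule borel_measurable_lim_metric) (rule Xn)
  show "AE w in N. X w = lim (\<lambda>n. Xn n w)"
    using lim by eventually_elim (simp add: limI)
qed

text \<open>The defining equation is insensitive to changing the event on a null set.\<close>

lemma indep_gaussian_ae_completion:
  assumes F: "subalgebra N F" and X: "indep_gaussian N F X v"
  shows "indep_gaussian N (ae_completion N F) X v"
  unfolding indep_gaussian_def
proof (intro conjI ballI)
  show "0 < v" and Xm: "X \<in> borel_measurable N" using X by (auto simp: indep_gaussian_def)
  fix B and A :: "(real ^ 'b) set" assume B: "B \<in> sets (ae_completion N F)" and A: "A \<in> sets borel"
  then obtain B' where B': "B \<in> sets N" "B' \<in> sets F" "AE w in N. w \<in> B \<longleftrightarrow> w \<in> B'"
    unfolding sets_ae_completion[OF F] by auto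
  have BN: "B' \<in> sets N" using B'(2) F by (auto simp: subalgebra_def)
  have inter: "X -` A \<inter> C \<in> sets N" if "C \<in> sets N" for C
  proof -
    have "X -` A \<inter> C = (X -` A \<inter> space N) \<inter> C" using sets.sets_into_space[OF that] by auto
    then show ?thesis using measurable_sets[OF Xm A] that by auto
  qed
  have "emeasure N (X -` A \<inter> B) = emeasure N (X -` A \<inter> B')" "emeasure N B = emeasure N B'"
    using B' BN inter by (auto intro!: emeasure_eq_AE)
  then show "emeasure N (X -` A \<inter> B) = emeasure N B * (\<integral>\<^sup>+y. ennreal (gauss v y) * indicator A y \<partial>lborel)"
    using X B'(2) A by (simp add: indep_gaussian_def)
qed

section \<open>Increments of the Wiener process\<close>

context
  fixes N :: "'w measure" and W :: "real \<Rightarrow> 'w \<Rightarrow> real ^ 'n"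
  assumes W: "wiener_process N W"
begin

abbreviation (input) wiener_past :: "real \<Rightarrow> 'w measure" where
  "wiener_past s \<equiv> past_sigma N borel {0..} W s"

lemma wiener_prob_space: "prob_space N"
  using W by (auto simp: wiener_process_def)

lemma wiener_measurable: "0 \<le> t \<Longrightarrow> W t \<in> borel_measurable N"
  using W by (auto simp: wiener_process_def)

lemma subalgebra_wiener_past: "subalgebra N (wiener_past s)"
  by (rule subalgebra_past_sigma) (simp add: wiener_measurable)

lemma measurable_wiener_past: "0 \<le> u \<Longrightarrow> u \<le> s \<Longrightarrow> W u \<in> borel_measurable (wiener_past s)"
  by (rule measurable_past_sigma) (simp_all add: wiener_measurable)

lemma wiener_past_mono: "s \<le> t \<Longrightarrow> sets (wiener_past s) \<subseteq> sets (wiener_past t)"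
  unfolding sets_past_sigma by (rule sigma_sets_mono') force

text \<open>On the grid formed by zero, the times in \<open>J\<close>, and \<open>s\<close>, the values of \<open>W\<close> are almost surely sums of
increments since \<open>W\<close> starts at zero, so the cylinder event is a function of increments before \<open>s\<close>.\<close>

lemma wiener_cylinder_indep:
  assumes J: "finite J" "J \<subseteq> {0..s}" and s: "0 \<le> s" "s < t"
    and A: "\<And>u. u \<in> J \<Longrightarrow> A u \<in> sets borel" and C: "C \<in> sets borel"
  shows "measure N ({w \<in> space N. \<forall>u\<in>J. W u w \<in> A u} \<inter> ((\<lambda>w. W t w - W s w) -` C \<inter> space N)) =
    measure N {w \<in> space N. \<forall>u\<in>J. W u w \<in> A u} * measure N ((\<lambda>w. W t w - W s w) -` C \<inter> space N)"
proof -
  interpret prob_space N by (rule wiener_prob_space)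
  define K where "K = insert 0 (insert s J)"
  define xs where "xs = sorted_list_of_set K"
  define m where "m = length xs - 1"
  \<comment> \<open>The grid has \<open>\<tau> m = s\<close> and \<open>\<tau> (Suc m) = t\<close>.\<close>
  define \<tau> where "\<tau> i = (if i \<le> m then xs ! i else t + (real i - real (Suc m)))" for i
  have K: "finite K" "K \<noteq> {}" "K \<subseteq> {0..s}" using J s by (auto simp: K_def)
  have xs: "set xs = K" "sorted_wrt (<) xs" "length xs = Suc m"
    using K by (auto simp: xs_def m_def card_gt_0_iff)
  have mono: "xs ! i < xs ! j" if "i < j" "j \<le> m" for i j
    using sorted_wrt_nth_less[OF xs(2)] that xs(3) by simp
  have inK: "xs ! i \<in> K" if "i \<le> m" for i using that xs nth_mem[of i xs] by simp
  have x0: "xs ! 0 = 0"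
  proof -
    obtain i where i: "i \<le> m" "xs ! i = 0" using xs K_def by (metis in_set_conv_nth insertI1 less_Suc_eq_le)
    moreover have "0 \<le> xs ! 0" using inK[of 0] K(3) by auto
    ultimately show ?thesis using mono[of 0 i] by (cases "i = 0") auto
  qed
  have xm: "xs ! m = s"
  proof -
    obtain i where i: "i \<le> m" "xs ! i = s" using xs K_def by (metis in_set_conv_nth insertI1 insertI2 less_Suc_eq_le)
    moreover have "xs ! m \<le> s" using inK[of m] K(3) by auto
    ultimately show ?thesis using mono[of i m] by (cases "i = m") auto
  qed
  have t0: "0 \<le> \<tau> 0" by (simp add: \<tau>_def x0)
  have tm: "\<tau> i < \<tau> (Suc i)" if "i < Suc m" for i
    using that mono[of i "Suc i"] inK[of i] K(3) s by (auto simp: \<tau>_def less_Suc_eq)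
  have tS: "\<tau> (Suc m) = t" "\<tau> m = s" by (simp_all add: \<tau>_def xm)
  define \<Delta> where "\<Delta> i w = W (\<tau> (Suc i)) w - W (\<tau> i) w" for i w
  have \<Delta>m: "\<Delta> m w = W t w - W s w" for w by (simp add: \<Delta>_def tS)
  have iv: "indep_vars (\<lambda>_. borel) \<Delta> {..<Suc m}"
    using W t0 tm unfolding wiener_process_def \<Delta>_def by blast
  have Wt: "\<And>u. u \<in> J \<Longrightarrow> W u \<in> borel_measurable N" and Wts: "(\<lambda>w. W t w - W s w) \<in> borel_measurable N"
    using J s by (auto intro!: borel_measurable_diff wiener_measurable)
  have "\<forall>u\<in>J. \<exists>k\<le>m. xs ! k = u"
    using xs(1,3) K_def by (metis in_set_conv_nth insertI2 less_Suc_eq_le)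
  then obtain k where k: "\<And>u. u \<in> J \<Longrightarrow> k u \<le> m" "\<And>u. u \<in> J \<Longrightarrow> xs ! k u = u" by metis
  let ?P = "Pi\<^sub>M {..<m} (\<lambda>_. borel) :: (nat \<Rightarrow> real ^ 'n) measure"
  let ?R = "\<lambda>w. restrict (\<lambda>i. \<Delta> i w) {..<m}"
  let ?X = "(\<lambda>w. W t w - W s w) -` C \<inter> space N"
  define Q where "Q = {f \<in> space ?P. \<forall>u\<in>J. (\<Sum>i<k u. f i) \<in> A u}"
  define B where "B = {w \<in> space N. \<forall>u\<in>J. W u w \<in> A u}"
  have Q: "Q \<in> sets ?P"
    unfolding Q_def
  proof (rule sets.sets_Collect_finite_All[OF _ J(1)])
    fix u assume u: "u \<in> J"
    have Sm: "(\<lambda>f. \<Sum>i<k u. f i) \<in> borel_measurable ?P"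
      using k(1)[OF u] by (intro borel_measurable_sum measurable_component_singleton) auto
    have "{f \<in> space ?P. (\<Sum>i<k u. f i) \<in> A u} = (\<lambda>f. \<Sum>i<k u. f i) -` A u \<inter> space ?P" by auto
    then show "{f \<in> space ?P. (\<Sum>i<k u. f i) \<in> A u} \<in> sets ?P"
      using measurable_sets[OF Sm A[OF u]] by simp
  qed
  have B: "B \<in> events"
    unfolding B_def
  proof (rule sets.sets_Collect_finite_All[OF _ J(1)])
    fix u assume u: "u \<in> J"
    have "{w \<in> space N. W u w \<in> A u} = W u -` A u \<inter> space N" by auto
    then show "{w \<in> space N. W u w \<in> A u} \<in> events" using measurable_sets[OF Wt[OF u] A[OF u]] by simp
  qed
  have X: "?X \<in> events" using measurable_sets[OF Wts C] .
  have ir: "indep_var ?P ?R (Pi\<^sub>M {m} (\<lambda>_. borel)) (\<lambda>w. restrict (\<lambda>i. \<Delta> i w) {m})"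
    by (rule indep_var_restrict[OF iv]) auto
  let ?Q' = "(\<lambda>f. f m) -` C \<inter> space (Pi\<^sub>M {m} (\<lambda>_. borel))"
  have Q': "?Q' \<in> sets (Pi\<^sub>M {m} (\<lambda>_. borel))"
  proof -
    have "(\<lambda>f. f m) \<in> measurable (Pi\<^sub>M {m} (\<lambda>_. borel)) (borel :: (real ^ 'n) measure)"
      by (rule measurable_component_singleton) simp
    from measurable_sets[OF this C] show ?thesis .
  qed
  have XQ: "(\<lambda>w. restrict (\<lambda>i. \<Delta> i w) {m}) -` ?Q' \<inter> space N = ?X"
    by (auto simp: \<Delta>m space_PiM)
  have Rm: "?R \<in> measurable N ?P" using indep_var_rv1[OF ir] .
  have "prob (?R -` Q \<inter> space N \<inter> ?X) =
      prob ((\<lambda>w. (?R w, restrict (\<lambda>i. \<Delta> i w) {m})) -` (Q \<times> ?Q') \<inter> space N)"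
    unfolding XQ[symmetric] by (rule arg_cong[where f=prob]) auto
  also have "\<dots> = prob (?R -` Q \<inter> space N) * prob ?X"
    unfolding XQ[symmetric] by (rule indep_varD[OF ir Q Q'])
  finally have main: "prob (?R -` Q \<inter> space N \<inter> ?X) = prob (?R -` Q \<inter> space N) * prob ?X" .
  have RQ: "?R -` Q \<inter> space N \<in> events" using measurable_sets[OF Rm Q] .
  have "AE w in N. W 0 w = 0" using W by (auto simp: wiener_process_def)
  moreover have "AE w in N. w \<in> space N" by simp
  ultimately have ae: "AE w in N. w \<in> B \<longleftrightarrow> w \<in> ?R -` Q \<inter> space N"
  proof eventually_elim
    case (elim w)
    have "(\<Sum>i<k u. ?R w i) = W u w" if u: "u \<in> J" for u
    proof -
      have "(\<Sum>i<k u. ?R w i) = (\<Sum>i<k u. W (\<tau> (Suc i)) w - W (\<tau> i) w)"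
        using k(1)[OF u] by (intro sum.cong) (auto simp: \<Delta>_def)
      also have "\<dots> = W (\<tau> (k u)) w - W (\<tau> 0) w" by (rule sum_lessThan_telescope)
      also have "\<tau> (k u) = u" using k[OF u] by (simp add: \<tau>_def)
      also have "\<tau> 0 = 0" by (simp add: \<tau>_def x0)
      finally show ?thesis using elim by simp
    qed
    moreover have "?R w \<in> space ?P" by (simp add: space_PiM)
    ultimately show ?case using elim by (simp add: B_def Q_def)
  qed
  have "prob (B \<inter> ?X) = prob (?R -` Q \<inter> space N \<inter> ?X)"
    using ae B X RQ by (intro measure_eq_AE) auto
  moreover have "prob B = prob (?R -` Q \<inter> space N)"
    using ae B RQ by (intro measure_eq_AE) auto
  ultimately show ?thesis using main by (simp only: B_def)
qed

text \<open>Cylinder events are stable under intersection and generate the past, so independence extends from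
them to the whole past.\<close>

lemma wiener_increment_gaussian:
  assumes s: "0 \<le> s" "s < t"
  shows "indep_gaussian N (wiener_past s) (\<lambda>w. W t w - W s w) (t - s)"
  unfolding indep_gaussian_def
proof (intro conjI ballI)
  interpret prob_space N by (rule wiener_prob_space)
  let ?X = "\<lambda>w. W t w - W s w"
  show v: "0 < t - s" using s by simp
  show X: "?X \<in> borel_measurable N" using s by (auto intro!: borel_measurable_diff wiener_measurable)
  fix B and C :: "(real ^ 'n) set" assume B: "B \<in> sets (wiener_past s)" and C: "C \<in> sets borel"
  define E where "E = {{w \<in> space N. \<forall>u\<in>J. W u w \<in> A u} | J A. finite J \<and> J \<subseteq> {0..s} \<and> (\<forall>u\<in>J. A u \<in> sets (borel :: (real ^ 'n) measure))}"
  have XC: "?X -` C \<inter> space N \<in> events" using measurable_sets[OF X C] .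
  have Eev: "E \<subseteq> events"
  proof
    fix D assume "D \<in> E"
    then obtain J A where D: "D = {w \<in> space N. \<forall>u\<in>J. W u w \<in> A u}" "finite J" "J \<subseteq> {0..s}"
      "\<And>u. u \<in> J \<Longrightarrow> A u \<in> sets borel" unfolding E_def by blast
    show "D \<in> events" unfolding D(1)
    proof (rule sets.sets_Collect_finite_All[OF _ D(2)])
      fix u assume u: "u \<in> J"
      have "{w \<in> space N. W u w \<in> A u} = W u -` A u \<inter> space N" by auto
      moreover have "W u \<in> borel_measurable N" using u D(3) by (intro wiener_measurable) auto
      ultimately show "{w \<in> space N. W u w \<in> A u} \<in> events" using measurable_sets[OF _ D(4)[OF u]] by simp
    qed
  qed
  have "Int_stable E"
  proof (rule Int_stableI)
    fix D D' assume "D \<in> E" "D' \<in> E"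
    then obtain J A J' A' where D: "D = {w \<in> space N. \<forall>u\<in>J. W u w \<in> A u}" "finite J" "J \<subseteq> {0..s}"
      "\<forall>u\<in>J. A u \<in> sets borel" and D': "D' = {w \<in> space N. \<forall>u\<in>J'. W u w \<in> A' u}" "finite J'" "J' \<subseteq> {0..s}"
      "\<forall>u\<in>J'. A' u \<in> sets borel" unfolding E_def by blast
    let ?A = "\<lambda>u. (if u \<in> J then A u else UNIV) \<inter> (if u \<in> J' then A' u else UNIV)"
    have "D \<inter> D' = {w \<in> space N. \<forall>u\<in>J \<union> J'. W u w \<in> ?A u}"
      unfolding D(1) D'(1) by auto
    moreover have "\<forall>u\<in>J \<union> J'. ?A u \<in> sets borel" using D(4) D'(4) by auto
    ultimately show "D \<inter> D' \<in> E" unfolding E_def using D(2,3) D'(2,3)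
      by (intro CollectI exI[of _ "J \<union> J'"] exI[of _ ?A]) simp
  qed
  moreover have "indep_set E {?X -` C \<inter> space N}"
  proof (rule indep_setI[OF Eev])
    fix D G assume "D \<in> E" and G: "G \<in> {?X -` C \<inter> space N}"
    then obtain J A where D: "D = {w \<in> space N. \<forall>u\<in>J. W u w \<in> A u}" "finite J" "J \<subseteq> {0..s}"
      "\<And>u. u \<in> J \<Longrightarrow> A u \<in> sets borel" unfolding E_def by blast
    show "prob (D \<inter> G) = prob D * prob G"
      using wiener_cylinder_indep[OF D(2,3) s D(4) C] G unfolding D(1) by simp
  qed (use XC in simp)
  ultimately have "indep_set (sigma_sets (space N) E) (sigma_sets (space N) {?X -` C \<inter> space N})"
    by (intro indep_set_sigma_sets) (simp_all add: Int_stable_def)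
  moreover have "B \<in> sigma_sets (space N) E"
  proof -
    have "{W u -` A \<inter> space N |u A. u \<in> {0..} \<and> u \<le> s \<and> A \<in> sets borel} \<subseteq> E"
    proof
      fix D assume "D \<in> {W u -` A \<inter> space N |u A. u \<in> {0..} \<and> u \<le> s \<and> A \<in> sets borel}"
      then obtain u A where "D = W u -` A \<inter> space N" "0 \<le> u" "u \<le> s" "A \<in> sets borel" by auto
      moreover have "W u -` A \<inter> space N = {w \<in> space N. \<forall>v\<in>{u}. W v w \<in> A}" by auto
      ultimately show "D \<in> E" unfolding E_def
        by (intro CollectI exI[of _ "{u}"] exI[of _ "\<lambda>_. A"]) auto
    qed
    then show ?thesis using B sigma_sets_mono' unfolding sets_past_sigma by blast
  qed
  moreover have "?X -` C \<inter> space N \<in> sigma_sets (space N) {?X -` C \<inter> space N}" by blast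
  ultimately have ind: "prob (B \<inter> (?X -` C \<inter> space N)) = prob B * prob (?X -` C \<inter> space N)"
    by (rule indep_setD)
  have BN: "B \<subseteq> space N" using sets.sets_into_space[OF B] by simp
  have "distributed N lborel ?X (\<lambda>x. ennreal (\<Prod>i\<in>UNIV. normal_density 0 (sqrt (t - s)) (x $ i)))"
    using W s unfolding wiener_process_def by blast
  then have "emeasure N (?X -` C \<inter> space N) = (\<integral>\<^sup>+y. ennreal (gauss (t - s) y) * indicator C y \<partial>lborel)"
    using C v by (subst distributed_emeasure) (simp_all add: gauss_prod)
  moreover have "?X -` C \<inter> B = B \<inter> (?X -` C \<inter> space N)" using BN by auto
  moreover have "emeasure N (B \<inter> (?X -` C \<inter> space N)) = emeasure N B * emeasure N (?X -` C \<inter> space N)"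
    unfolding emeasure_eq_measure ind by (rule ennreal_mult) simp_all
  ultimately show "emeasure N (?X -` C \<inter> B) = emeasure N B * (\<integral>\<^sup>+y. ennreal (gauss (t - s) y) * indicator C y \<partial>lborel)"
    by (simp only:)
qed

lemma wiener_sum_gaussian:
  assumes s: "0 \<le> u 0" and u: "\<And>i. u i < u (Suc i)" and c: "\<And>i. c i \<noteq> 0"
  shows "indep_gaussian N (wiener_past (u 0)) (\<lambda>w. \<Sum>i<Suc n. c i *\<^sub>R (W (u (Suc i)) w - W (u i) w))
      (\<Sum>i<Suc n. (c i)\<^sup>2 * (u (Suc i) - u i))"
    and "(\<lambda>w. \<Sum>i<Suc n. c i *\<^sub>R (W (u (Suc i)) w - W (u i) w)) \<in> borel_measurable (wiener_past (u (Suc n)))"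
proof -
  have mono: "incseq u" using u by (intro incseq_SucI less_imp_le) 
  have u0: "0 \<le> u i" for i using s mono by (meson incseqD le0 order_trans)
  have le: "i \<le> j \<Longrightarrow> u i \<le> u j" for i j using mono by (rule incseqD)
  have inc: "indep_gaussian N (wiener_past (u i)) (\<lambda>w. c i *\<^sub>R (W (u (Suc i)) w - W (u i) w)) ((c i)\<^sup>2 * (u (Suc i) - u i))" for i
    by (rule indep_gaussian_scale[OF wiener_increment_gaussian[OF u0 u] c])
  show meas: "(\<lambda>w. \<Sum>i<Suc n. c i *\<^sub>R (W (u (Suc i)) w - W (u i) w)) \<in> borel_measurable (wiener_past (u (Suc n)))" for n
    by (intro borel_measurable_sum borel_measurable_scaleR borel_measurable_const borel_measurable_diff measurable_wiener_past)
      (auto intro!: le u0)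
  show "indep_gaussian N (wiener_past (u 0)) (\<lambda>w. \<Sum>i<Suc n. c i *\<^sub>R (W (u (Suc i)) w - W (u i) w))
      (\<Sum>i<Suc n. (c i)\<^sup>2 * (u (Suc i) - u i))"
  proof (induction n)
    case 0
    show ?case using inc[of 0] by simp
  next
    case (Suc n)
    show ?case
      using indep_gaussian_add[OF wiener_prob_space subalgebra_wiener_past subalgebra_wiener_past
          wiener_past_mono[OF le[of 0 "Suc n"]] Suc.IH meas inc[of "Suc n"]]
      by (simp add: add.assoc)
  qed
qed

end

section \<open>The Ornstein-Uhlenbeck process\<close>

text \<open>With \<open>\<psi> r = exp (a * (t - r))\<close>, the sum of the differences of \<open>\<psi> *\<^sub>R Z\<close> telescopes, and on
an interval \<open>[p, q]\<close> such a difference deviates from \<open>(\<sigma> * \<psi> p) *\<^sub>R (W q - W p)\<close> by the integral of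
\<open>a *\<^sub>R (\<psi> p *\<^sub>R Z r - \<psi> r *\<^sub>R Z q)\<close>, which is small by uniform continuity. The argument
is pathwise and replaces the stochastic integral.\<close>

lemma ou_riemann_sums:
  fixes Z W :: "real \<Rightarrow> 'a::euclidean_space"
  assumes Z: "continuous_on {0..} Z"
    and eq: "\<And>t. 0 \<le> t \<Longrightarrow> Z t = Z 0 + integral {0..t} (\<lambda>u. a *\<^sub>R Z u) + \<sigma> *\<^sub>R (W t - W 0)"
    and st: "0 \<le> s" "s < t"
  defines "u \<equiv> \<lambda>n i. s + (t - s) * real i / real (Suc n)"
  shows "(\<lambda>n. \<Sum>i<Suc n. (\<sigma> * exp (a * (t - u n i))) *\<^sub>R (W (u n (Suc i)) - W (u n i)))
      \<longlonglongrightarrow> Z t - exp (a * (t - s)) *\<^sub>R Z s"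
proof -
  define \<psi> where "\<psi> r = exp (a * (t - r))" for r
  have d\<psi>: "(\<psi> has_vector_derivative (- a * \<psi> r)) (at r within S)" for r S
    unfolding \<psi>_def has_real_derivative_iff_has_vector_derivative[symmetric]
    by (auto intro!: derivative_eq_intros)
  define G where "G = (\<lambda>(p, q). \<psi> p *\<^sub>R Z q)"
  have Gc: "continuous_on ({s..t} \<times> {s..t}) G"
    unfolding G_def \<psi>_def case_prod_beta
    by (intro continuous_intros continuous_on_compose2[OF Z]) (use st in auto)
  have Gu: "uniformly_continuous_on ({s..t} \<times> {s..t}) G"
    by (rule compact_uniformly_continuous[OF Gc]) (intro compact_Times compact_Icc)
  have Zi: "(\<lambda>u. a *\<^sub>R Z u) integrable_on {p..q}" if "0 \<le> p" for p q
    using that by (intro integrable_continuous_real continuous_intros continuous_on_subset[OF Z]) auto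
  have step: "norm ((\<psi> q *\<^sub>R Z q - \<psi> p *\<^sub>R Z p) - (\<sigma> * \<psi> p) *\<^sub>R (W q - W p)) \<le> \<bar>a\<bar> * e * (q - p)"
    if pq: "0 \<le> p" "p \<le> q" and e: "\<And>r. r \<in> {p..q} \<Longrightarrow> norm (\<psi> p *\<^sub>R Z r - \<psi> r *\<^sub>R Z q) \<le> e" for p q e
  proof -
    have e0: "0 \<le> e" using e[of p] pq by (meson atLeastAtMost_iff norm_ge_zero order_refl order_trans)
    have "integral {0..q} (\<lambda>u. a *\<^sub>R Z u) = integral {0..p} (\<lambda>u. a *\<^sub>R Z u) + integral {p..q} (\<lambda>u. a *\<^sub>R Z u)"
      using pq by (intro Henstock_Kurzweil_Integration.integral_combine[symmetric] Zi) auto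
    then have Zq: "Z q = Z 0 + (integral {0..p} (\<lambda>u. a *\<^sub>R Z u) + integral {p..q} (\<lambda>u. a *\<^sub>R Z u)) + \<sigma> *\<^sub>R (W q - W 0)"
      using eq[of q] pq by (simp only: order_trans[OF pq])
    have "\<sigma> *\<^sub>R (wq - wp) = zq - zp - B"
      if "zq = z0 + (A + B) + \<sigma> *\<^sub>R (wq - w0)" "zp = z0 + A + \<sigma> *\<^sub>R (wp - w0)" for zq zp z0 A B wq wp w0 :: 'a
      unfolding that by (simp add: algebra_simps)
    from this[OF Zq eq[OF pq(1)]]
    have W: "\<sigma> *\<^sub>R (W q - W p) = Z q - Z p - integral {p..q} (\<lambda>u. a *\<^sub>R Z u)" .
    have 1: "((\<lambda>r. \<psi> p *\<^sub>R (a *\<^sub>R Z r)) has_integral \<psi> p *\<^sub>R integral {p..q} (\<lambda>u. a *\<^sub>R Z u)) {p..q}"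
      by (intro has_integral_cmul integrable_integral Zi pq)
    have "((\<lambda>r. - a * \<psi> r) has_integral (\<psi> q - \<psi> p)) {p..q}"
      by (rule fundamental_theorem_of_calculus[OF pq(2)]) (rule d\<psi>)
    then have 2: "((\<lambda>r. (- a * \<psi> r) *\<^sub>R Z q) has_integral (\<psi> q - \<psi> p) *\<^sub>R Z q) {p..q}"
      by (rule has_integral_scaleR_left)
    have "((\<lambda>r. a *\<^sub>R (\<psi> p *\<^sub>R Z r - \<psi> r *\<^sub>R Z q)) has_integral
        (\<psi> p *\<^sub>R integral {p..q} (\<lambda>u. a *\<^sub>R Z u) + (\<psi> q - \<psi> p) *\<^sub>R Z q)) {p..q}"
      using has_integral_add[OF 1 2] by (simp add: algebra_simps)
    then have "norm (\<psi> p *\<^sub>R integral {p..q} (\<lambda>u. a *\<^sub>R Z u) + (\<psi> q - \<psi> p) *\<^sub>R Z q) \<le> (\<bar>a\<bar> * e) * measure lborel (cbox p q)"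
      unfolding cbox_interval[symmetric]
      by (rule has_integral_bound[rotated]) (use e0 e in \<open>auto simp: mult_left_mono\<close>)
    also have "measure lborel (cbox p q) = q - p" using pq by simp
    also have "\<psi> p *\<^sub>R integral {p..q} (\<lambda>u. a *\<^sub>R Z u) + (\<psi> q - \<psi> p) *\<^sub>R Z q =
        (\<psi> q *\<^sub>R Z q - \<psi> p *\<^sub>R Z p) - \<psi> p *\<^sub>R (\<sigma> *\<^sub>R (W q - W p))"
      unfolding W by (simp add: algebra_simps)
    finally show ?thesis by (simp add: mult.commute)
  qed
  show ?thesis
  proof (rule LIMSEQ_I)
    fix \<epsilon> :: real assume \<epsilon>: "0 < \<epsilon>"
    \<comment> \<open>The summand one avoids a division by zero for \<open>a = 0\<close>.\<close>
    define e where "e = \<epsilon> / (2 * (\<bar>a\<bar> + 1) * (t - s))"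
    have e: "0 < e" using \<epsilon> st by (simp add: e_def)
    obtain \<delta> where \<delta>: "0 < \<delta>" and G\<delta>: "\<And>x y. x \<in> {s..t} \<times> {s..t} \<Longrightarrow> y \<in> {s..t} \<times> {s..t} \<Longrightarrow> dist y x < \<delta> \<Longrightarrow> dist (G y) (G x) < e"
      using Gu e unfolding uniformly_continuous_on_def by metis
    obtain n0 :: nat where n0: "2 * (t - s) / \<delta> < real n0" using reals_Archimedean2 by blast
    show "\<exists>n0. \<forall>n\<ge>n0. norm ((\<Sum>i<Suc n. (\<sigma> * exp (a * (t - u n i))) *\<^sub>R (W (u n (Suc i)) - W (u n i))) -
        (Z t - exp (a * (t - s)) *\<^sub>R Z s)) < \<epsilon>"
    proof (intro exI allI impI)
      fix n assume n: "n0 \<le> n"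
      let ?h = "(t - s) / real (Suc n)"
      have h: "0 < ?h" "2 * ?h < \<delta>"
      proof -
        show "0 < ?h" using st by simp
        have "2 * (t - s) / \<delta> < real (Suc n)" using n0 n by linarith
        then show "2 * ?h < \<delta>" using \<delta> by (simp add: field_simps)
      qed
      have uS: "u n (Suc i) = u n i + ?h" for i by (simp add: u_def add_divide_distrib distrib_left)
      have u0: "u n 0 = s" and uN: "u n (Suc n) = t" by (simp_all add: u_def)
      have ur: "s \<le> u n i" "u n i \<le> t" if "i \<le> Suc n" for i
      proof -
        show "s \<le> u n i" using st by (simp add: u_def)
        have "(t - s) * (real i / real (Suc n)) \<le> (t - s) * 1"
          using that st by (intro mult_left_mono) auto
        then show "u n i \<le> t" by (simp add: u_def)
      qed
      let ?f = "\<lambda>i. \<psi> (u n i) *\<^sub>R Z (u n i)"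
      have "norm ((?f (Suc i) - ?f i) - (\<sigma> * \<psi> (u n i)) *\<^sub>R (W (u n (Suc i)) - W (u n i))) \<le> \<bar>a\<bar> * e * ?h" if i: "i < Suc n" for i
      proof -
        have rng: "s \<le> u n i" "u n (Suc i) \<le> t" "u n i \<le> u n (Suc i)" using ur[of i] ur[of "Suc i"] i uS[of i] h by auto
        have "norm (\<psi> (u n i) *\<^sub>R Z r - \<psi> r *\<^sub>R Z (u n (Suc i))) \<le> e" if r: "r \<in> {u n i..u n (Suc i)}" for r
        proof -
          have "dist (u n i, r) (r, u n (Suc i)) \<le> dist (u n i) r + dist r (u n (Suc i))"
            unfolding dist_Pair_Pair by (rule sqrt_sum_squares_le_sum) auto
          also have "\<dots> = ?h" using r uS[of i] by (auto simp: dist_real_def)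
          also have "?h < \<delta>" using h by linarith
          finally have "dist (G (u n i, r)) (G (r, u n (Suc i))) < e"
            using r rng by (intro G\<delta>) auto
          then show ?thesis by (simp add: G_def dist_norm)
        qed
        from step[OF _ rng(3) this] show ?thesis using rng st uS[of i] by simp
      qed
      then have "norm (\<Sum>i<Suc n. ((?f (Suc i) - ?f i) - (\<sigma> * \<psi> (u n i)) *\<^sub>R (W (u n (Suc i)) - W (u n i)))) \<le> (\<Sum>i<Suc n. \<bar>a\<bar> * e * ?h)"
        by (intro sum_norm_le) auto
      also have "(\<Sum>i<Suc n. ((?f (Suc i) - ?f i) - (\<sigma> * \<psi> (u n i)) *\<^sub>R (W (u n (Suc i)) - W (u n i)))) =
          (?f (Suc n) - ?f 0) - (\<Sum>i<Suc n. (\<sigma> * \<psi> (u n i)) *\<^sub>R (W (u n (Suc i)) - W (u n i)))"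
        by (subst sum_subtractf, subst sum_lessThan_telescope[of ?f "Suc n"]) (rule refl)
      also have "?f (Suc n) - ?f 0 = Z t - exp (a * (t - s)) *\<^sub>R Z s"
        unfolding u0 uN by (simp add: \<psi>_def)
      also have "(\<Sum>i<Suc n. \<bar>a\<bar> * e * ?h) = \<bar>a\<bar> * e * (t - s)"
        unfolding sum_constant by (simp add: field_simps)
      also have "\<dots> \<le> (\<bar>a\<bar> + 1) * e * (t - s)" using e st by (intro mult_right_mono) auto
      also have "\<dots> = \<epsilon> / 2"
      proof -
        have "\<bar>a\<bar> + 1 \<noteq> 0" "t - s \<noteq> 0" using st by auto
        then show ?thesis unfolding e_def by (simp add: divide_simps)
      qed
      also have "\<dots> < \<epsilon>" using \<epsilon> by simp
      finally show "norm ((\<Sum>i<Suc n. (\<sigma> * exp (a * (t - u n i))) *\<^sub>R (W (u n (Suc i)) - W (u n i))) -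
        (Z t - exp (a * (t - s)) *\<^sub>R Z s)) < \<epsilon>"
        unfolding \<psi>_def by (subst norm_minus_commute)
    qed
  qed
qed

lemma kappa_0 [simp]: "kappa a 0 = 0"
  by (simp add: kappa_def)

lemma kappa_has_derivative: "(kappa a has_real_derivative exp (2 * a * t)) (at t within S)"
proof (cases "a = 0")
  case True
  then have "kappa a = (\<lambda>t. t)" by (auto simp: kappa_def)
  then show ?thesis using True by simp
next
  case False
  then have "kappa a = (\<lambda>t. (exp (2 * a * t) - 1) / (2 * a))" by (auto simp: kappa_def)
  then show ?thesis using False by (auto intro!: derivative_eq_intros)
qed

lemma kappa_ode: "exp (2 * a * t) = 2 * a * kappa a t + 1"
  by (simp add: kappa_def)

lemma kappa_add: "kappa a (s + t) = kappa a t + exp (2 * a * t) * kappa a s"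
proof (cases "a = 0")
  case False
  then show ?thesis by (simp add: kappa_def field_simps exp_add[symmetric])
qed (simp add: kappa_def)

lemma kappa_pos:
  assumes "0 < t" shows "0 < kappa a t"
proof (cases "a = 0")
  case False
  then consider "0 < a" | "a < 0" by linarith
  then show ?thesis
  proof cases
    case 1
    then show ?thesis using assms False by (simp add: kappa_def)
  next
    case 2
    then have "exp (2 * a * t) < 1" using assms by (simp add: mult_neg_pos)
    then show ?thesis using 2 False by (simp add: kappa_def divide_neg_neg)
  qed
qed (use assms in \<open>simp add: kappa_def\<close>)

text \<open>The function \<open>kappa a\<close> solves the equation of \<open>ou_riemann_sums\<close> with rate \<open>2 * a\<close>, unit noise coefficient
and the identity as driving path, so these sums are another instance of that lemma.\<close>

lemma kappa_riemann_sums: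
  assumes st: "0 \<le> s" "s < t"
  defines "u \<equiv> \<lambda>n i. s + (t - s) * real i / real (Suc n)"
  shows "(\<lambda>n. \<Sum>i<Suc n. exp (2 * a * (t - u n i)) * (u n (Suc i) - u n i)) \<longlonglongrightarrow> kappa a (t - s)"
proof -
  have "(\<lambda>n. \<Sum>i<Suc n. (1 * exp (2 * a * (t - u n i))) *\<^sub>R (u n (Suc i) - u n i))
      \<longlonglongrightarrow> kappa a t - exp (2 * a * (t - s)) *\<^sub>R kappa a s"
    unfolding u_def
  proof (rule ou_riemann_sums[OF _ _ st, where W="\<lambda>r. r"])
    show "continuous_on {0..} (kappa a)"
      by (rule DERIV_continuous_on[OF kappa_has_derivative])
    fix r :: real assume r: "0 \<le> r"
    have "((\<lambda>u. exp (2 * a * u) - 1) has_integral ((kappa a r - r) - (kappa a 0 - 0))) {0..r}"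
      by (rule fundamental_theorem_of_calculus[OF r])
        (auto intro!: derivative_eq_intros kappa_has_derivative
          simp: has_real_derivative_iff_has_vector_derivative[symmetric])
    then have "((\<lambda>u. (2 * a) *\<^sub>R kappa a u) has_integral (kappa a r - r)) {0..r}"
      by (simp add: kappa_ode)
    then have I: "integral {0..r} (\<lambda>u. (2 * a) *\<^sub>R kappa a u) = kappa a r - r" by (rule integral_unique)
    show "kappa a r = kappa a 0 + integral {0..r} (\<lambda>u. (2 * a) *\<^sub>R kappa a u) + 1 *\<^sub>R (r - 0)"
      unfolding I by simp
  qed
  moreover have "kappa a t - exp (2 * a * (t - s)) * kappa a s = kappa a (t - s)"
    using kappa_add[of a s "t - s"] by simp
  ultimately show ?thesis by simp
qed

context
  fixes N :: "'w measure" and W Z :: "real \<Rightarrow> 'w \<Rightarrow> real ^ 'n" and a \<sigma> :: real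
  assumes W: "wiener_process N W" and Z: "ou_solution N W a \<sigma> Z" and \<sigma>: "\<sigma> \<noteq> 0"
begin

lemma ou_measurable: "0 \<le> t \<Longrightarrow> Z t \<in> borel_measurable N"
  using Z by (auto simp: ou_solution_def)

lemma ou_increment_limit:
  assumes st: "0 \<le> s" "s < t"
  defines "u \<equiv> \<lambda>n i. s + (t - s) * real i / real (Suc n)"
  shows "AE w in N. (\<lambda>n. \<Sum>i<Suc n. (\<sigma> * exp (a * (t - u n i))) *\<^sub>R (W (u n (Suc i)) w - W (u n i) w))
      \<longlonglongrightarrow> Z t w - exp (a * (t - s)) *\<^sub>R Z s w"
proof -
  have "AE w in N. continuous_on {0..} (\<lambda>t. Z t w)"
    "AE w in N. \<forall>t\<ge>0. Z t w = Z 0 w + integral {0..t} (\<lambda>u. a *\<^sub>R Z u w) + \<sigma> *\<^sub>R (W t w - W 0 w)"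
    using Z by (auto simp: ou_solution_def)
  then show ?thesis
  proof eventually_elim
    case (elim w)
    show ?case unfolding u_def
      by (rule ou_riemann_sums[where Z="\<lambda>t. Z t w" and W="\<lambda>t. W t w", OF elim(1) _ st]) (use elim(2) in blast)
  qed
qed

text \<open>The approximating sums are Gaussian with variances \<open>v n\<close> that only converge to the desired one. Rescaling
the sums by \<open>k n\<close>, which tends to one, gives all of them the exact variance, so that
\<open>indep_gaussian_limit\<close> applies.\<close>

lemma ou_increment_gaussian:
  assumes st: "0 \<le> s" "s < t"
  shows "indep_gaussian N (past_sigma N borel {0..} W s) (\<lambda>w. Z t w - exp (a * (t - s)) *\<^sub>R Z s w) (\<sigma>\<^sup>2 * kappa a (t - s))"
proof -
  define u where "u = (\<lambda>n i. s + (t - s) * real i / real (Suc n))"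
  \<comment> \<open>These are the sums of \<open>ou_riemann_sums\<close> for the path \<open>w\<close>, and \<open>v n\<close> is the variance of \<open>S n\<close>.\<close>
  define S where "S n w = (\<Sum>i<Suc n. (\<sigma> * exp (a * (t - u n i))) *\<^sub>R (W (u n (Suc i)) w - W (u n i) w))" for n w
  define v where "v n = (\<Sum>i<Suc n. (\<sigma> * exp (a * (t - u n i)))\<^sup>2 * (u n (Suc i) - u n i))" for n
  let ?v = "\<sigma>\<^sup>2 * kappa a (t - s)"
  define k where "k n = sqrt (?v / v n)" for n
  have v0: "0 < ?v" using \<sigma> kappa_pos[of "t - s" a] st by simp
  have um: "u n i < u n (Suc i)" for n i
    unfolding u_def using st by (simp add: divide_strict_right_mono)
  have u0: "u n 0 = s" for n by (simp add: u_def)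
  have vpos: "0 < v n" for n
    unfolding v_def by (rule sum_pos) (use um \<sigma> in \<open>auto intro!: mult_pos_pos\<close>)
  have "(\<sigma> * exp (a * (t - r)))\<^sup>2 = \<sigma>\<^sup>2 * exp (2 * a * (t - r))" for r
    by (simp add: power_mult_distrib exp_double[symmetric] mult.assoc)
  then have veq: "v = (\<lambda>n. \<sigma>\<^sup>2 * (\<Sum>i<Suc n. exp (2 * a * (t - u n i)) * (u n (Suc i) - u n i)))"
    unfolding v_def sum_distrib_left by (intro ext) (simp only: mult.assoc)
  have vlim: "v \<longlonglongrightarrow> ?v"
    unfolding veq u_def by (rule tendsto_mult_left[OF kappa_riemann_sums[OF st]])
  have klim: "k \<longlonglongrightarrow> 1"
  proof -
    have v: "?v \<noteq> 0" using v0 by linarith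
    have "k \<longlonglongrightarrow> sqrt (?v / ?v)"
      unfolding k_def[abs_def] by (intro tendsto_real_sqrt tendsto_divide tendsto_const vlim v)
    then show ?thesis unfolding divide_self[OF v] by simp
  qed
  show ?thesis
  proof (rule indep_gaussian_limit[OF wiener_prob_space[OF W] subalgebra_wiener_past[OF W] v0])
    fix n
    have "indep_gaussian N (past_sigma N borel {0..} W s) (S n) (v n)"
      using wiener_sum_gaussian(1)[OF W, of "u n" "\<lambda>i. \<sigma> * exp (a * (t - u n i))" n] st um \<sigma>
      unfolding S_def v_def u0 by simp
    then have "indep_gaussian N (past_sigma N borel {0..} W s) (\<lambda>w. k n *\<^sub>R S n w) ((k n)\<^sup>2 * v n)"
      by (rule indep_gaussian_scale) (use kappa_pos[of "t - s" a] st \<sigma> vpos[of n] in \<open>simp add: k_def\<close>)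
    moreover have "(k n)\<^sup>2 * v n = ?v" using v0 vpos[of n] by (simp add: k_def)
    ultimately show "indep_gaussian N (past_sigma N borel {0..} W s) (\<lambda>w. k n *\<^sub>R S n w) ?v" by simp
  next
    show "(\<lambda>w. Z t w - exp (a * (t - s)) *\<^sub>R Z s w) \<in> borel_measurable N"
      using st by (intro borel_measurable_diff borel_measurable_scaleR borel_measurable_const ou_measurable) auto
    have "AE w in N. (\<lambda>n. S n w) \<longlonglongrightarrow> Z t w - exp (a * (t - s)) *\<^sub>R Z s w"
      using ou_increment_limit[OF st] unfolding S_def u_def .
    then show "AE w in N. (\<lambda>n. k n *\<^sub>R S n w) \<longlonglongrightarrow> Z t w - exp (a * (t - s)) *\<^sub>R Z s w"
      by eventually_elim (use tendsto_scaleR[OF klim] in fastforce)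
  qed
qed

text \<open>As \<open>Z\<close> starts at zero, the innovation over \<open>[0, u]\<close> is \<open>Z u\<close> itself, an almost sure limit of
functions of the Wiener path up to time \<open>u\<close>.\<close>

lemma ou_adapted:
  assumes Z0: "AE w in N. Z 0 w = 0" and u: "0 \<le> u" "u \<le> s"
  shows "Z u \<in> borel_measurable (ae_completion N (past_sigma N borel {0..} W s))"
proof (cases "u = 0")
  case True
  show ?thesis unfolding True
    by (rule measurable_ae_completion_AE[OF subalgebra_wiener_past[OF W] borel_measurable_const[of 0] ou_measurable Z0]) simp
next
  case False
  then have u0: "0 < u" using u by simp
  show ?thesis
  proof (rule measurable_ae_completion_limit[OF subalgebra_wiener_past[OF W] _ ou_measurable[OF u(1)]])
    fix n
    define r where "r i = 0 + (u - 0) * real i / real (Suc n)" for i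
    have rm: "r i < r (Suc i)" for i
      unfolding r_def using u0 by (simp add: divide_strict_right_mono)
    have "(\<lambda>w. \<Sum>i<Suc n. (\<sigma> * exp (a * (u - r i))) *\<^sub>R (W (r (Suc i)) w - W (r i) w)) \<in> borel_measurable (past_sigma N borel {0..} W (r (Suc n)))"
      by (rule wiener_sum_gaussian(2)[OF W, of r "\<lambda>i. \<sigma> * exp (a * (u - r i))"]) (use rm \<sigma> in \<open>auto simp: r_def\<close>)
    moreover have "r (Suc n) = u" by (simp add: r_def)
    moreover have "subalgebra (ae_completion N (past_sigma N borel {0..} W s)) (past_sigma N borel {0..} W u)"
      using wiener_past_mono[OF W u(2)] sets_ae_completion_superset[OF subalgebra_wiener_past[OF W, of s]]
      by (auto simp: subalgebra_def)
    ultimately show "(\<lambda>w. \<Sum>i<Suc n. (\<sigma> * exp (a * (u - (0 + (u - 0) * real i / real (Suc n))))) *\<^sub>R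
        (W (0 + (u - 0) * real (Suc i) / real (Suc n)) w - W (0 + (u - 0) * real i / real (Suc n)) w))
        \<in> borel_measurable (ae_completion N (past_sigma N borel {0..} W s))"
      unfolding r_def by (metis (no_types, lifting) measurable_from_subalg)
  next
    show "AE w in N. (\<lambda>n. \<Sum>i<Suc n. (\<sigma> * exp (a * (u - (0 + (u - 0) * real i / real (Suc n))))) *\<^sub>R
        (W (0 + (u - 0) * real (Suc i) / real (Suc n)) w - W (0 + (u - 0) * real i / real (Suc n)) w)) \<longlonglongrightarrow> Z u w"
      using ou_increment_limit[OF order_refl u0] Z0 by eventually_elim simp
  qed
qed

lemma ou_kernel_markov:
  assumes Z0: "AE w in N. Z 0 w = 0" and st: "0 \<le> s" "s < t" "t \<le> T"
  shows "kernel_markov N lborel {0..T} Z s t (\<lambda>x y. gauss (\<sigma>\<^sup>2 * kappa a (t - s)) (y - exp (a * (t - s)) *\<^sub>R x))"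
proof -
  let ?C = "ae_completion N (past_sigma N borel {0..} W s)"
  note sub = subalgebra_wiener_past[OF W, of s]
  show ?thesis
  proof (rule kernel_markov_indep_gaussian[OF wiener_prob_space[OF W] subalgebra_ae_completion[OF sub]
        indep_gaussian_ae_completion[OF sub ou_increment_gaussian[OF st(1,2)]]])
    show "sets (past_sigma N lborel {0..T} Z s) \<subseteq> sets ?C"
    proof (rule past_sigma_subset)
      fix u and A :: "(real ^ 'n) set" assume u: "u \<in> {0..T}" "u \<le> s" and A: "A \<in> sets lborel"
      have "Z u \<in> borel_measurable ?C" using u by (intro ou_adapted[OF Z0]) auto
      from measurable_sets[OF this, of A] A show "Z u -` A \<inter> space N \<in> sets ?C" by simp
    qed simp
    show "Z s \<in> borel_measurable ?C" using st by (intro ou_adapted[OF Z0]) auto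
    show "Z t \<in> borel_measurable N" using st by (intro ou_measurable) auto
  qed simp
qed

end

lemma ou_density_gauss: "ou_density a \<sigma> t x y = gauss (\<sigma>\<^sup>2 * kappa a t) (y - exp (a * t) *\<^sub>R x)"
  unfolding ou_density_def gauss_def by (simp only: mult.assoc)

lemma polish_lborel: "polish_state_space (lborel :: (real ^ 'n) measure)"
  unfolding polish_state_space_def
  by (simp add: lborel.sigma_finite_measure_axioms complete_UNIV)

lemma ou_homogeneous_markov:
  fixes Z :: "real \<Rightarrow> 'w \<Rightarrow> real ^ 'n"
  assumes W: "wiener_process N W" and Z: "ou_solution N W a \<sigma> Z" and \<sigma>: "\<sigma> \<noteq> 0"
    and Z0: "AE w in N. Z 0 w = 0"
  shows "homogeneous_markov_process N lborel T Z (ou_density a \<sigma>)"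
proof -
  have dk: "density_kernel lborel (ou_density a \<sigma> (t - s) :: real ^ 'n \<Rightarrow> _)" if "s < t" for s t
    unfolding ou_density_gauss[abs_def]
    using \<sigma> kappa_pos[of "t - s" a] that by (intro density_kernel_gauss) simp
  have km: "kernel_markov N lborel {0..T} Z s t (ou_density a \<sigma> (t - s))" if "s \<in> {0..T}" "t \<in> {0..T}" "s < t" for s t
    using ou_kernel_markov[OF W Z \<sigma> Z0, of s t T] that by (simp add: ou_density_gauss[abs_def])
  have m: "\<And>u. u \<in> {0..T} \<Longrightarrow> Z u \<in> measurable N lborel"
    using ou_measurable[OF W Z \<sigma>] by auto
  show ?thesis
    unfolding homogeneous_markov_process_def
    by (intro conjI polish_lborel
        markov_process_of_kernel[where I="{0..T}" and J="{0..T}" and p="\<lambda>s t. ou_density a \<sigma> (t - s)" and c=0,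
          OF wiener_prob_space[OF W] lborel.sigma_finite_measure_axioms m])
      (auto intro: dk km)
qed

section \<open>The bridge density of the Ornstein-Uhlenbeck process\<close>

lemma ball_average_tendsto:
  fixes f :: "'a::euclidean_space \<Rightarrow> real"
  assumes f: "integrable lborel f" and c: "isCont f b"
  shows "((\<lambda>e. (LINT z:ball b e|lborel. f z) / measure lborel (ball b e)) \<longlongrightarrow> f b) (at_right 0)"
proof (rule tendstoI)
  fix \<epsilon> :: real assume \<epsilon>: "0 < \<epsilon>"
  obtain d where d: "0 < d" and fd: "\<And>z. dist z b < d \<Longrightarrow> dist (f z) (f b) < \<epsilon> / 2"
    using c \<epsilon> unfolding continuous_at by (metis half_gt_zero_iff tendsto_at_iff_tendsto_nhds LIM_def dist_self)
  have "dist ((LINT z:ball b e|lborel. f z) / measure lborel (ball b e)) (f b) < \<epsilon>" if e: "0 < e" "e < d" for e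
  proof -
    let ?V = "measure lborel (ball b e)"
    have V: "0 < ?V" using e by (simp add: content_ball_pos)
    have fin: "emeasure lborel (ball b e) < \<infinity>" using emeasure_lborel_ball_finite[of b e] by simp
    have si: "set_integrable lborel (ball b e) f"
      unfolding set_integrable_def using f by (intro integrable_mult_indicator) auto
    have ci: "set_integrable lborel (ball b e) (\<lambda>_. k)" for k :: real
      unfolding set_integrable_def using fin by simp
    have cv: "(LINT z:ball b e|lborel. k) = ?V * k" for k :: real
      unfolding set_lebesgue_integral_def by simp
    have near: "\<bar>f z - f b\<bar> < \<epsilon> / 2" if "z \<in> ball b e" for z
      using fd[of z] that e by (auto simp: dist_real_def dist_commute[of b z])
    have "(LINT z:ball b e|lborel. f z) \<le> (LINT z:ball b e|lborel. f b + \<epsilon> / 2)"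
    proof (rule set_integral_mono[OF si ci])
      fix z assume "z \<in> ball b e" from near[OF this] show "f z \<le> f b + \<epsilon> / 2" by linarith
    qed
    moreover have "(LINT z:ball b e|lborel. f b - \<epsilon> / 2) \<le> (LINT z:ball b e|lborel. f z)"
    proof (rule set_integral_mono[OF ci si])
      fix z assume "z \<in> ball b e" from near[OF this] show "f b - \<epsilon> / 2 \<le> f z" by linarith
    qed
    ultimately have "(LINT z:ball b e|lborel. f z) / ?V \<le> f b + \<epsilon> / 2" "f b - \<epsilon> / 2 \<le> (LINT z:ball b e|lborel. f z) / ?V"
      unfolding cv using V by (simp_all add: divide_le_eq le_divide_eq mult.commute)
    then have "\<bar>(LINT z:ball b e|lborel. f z) / ?V - f b\<bar> \<le> \<epsilon> / 2" by linarith
    then show ?thesis using \<epsilon> by (simp add: dist_real_def)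
  qed
  then show "\<forall>\<^sub>F e in at_right 0. dist ((LINT z:ball b e|lborel. f z) / measure lborel (ball b e)) (f b) < \<epsilon>"
    using d by (intro eventually_at_rightI[of 0 d]) auto
qed

lemma bridge_densityI:
  assumes "(bridge_ratio lam pU T b s t x y \<longlongrightarrow> l) (at_right 0)"
  shows "bridge_density lam pU T b s t x y = pU (t - s) x y * l"
proof -
  have "Lim (at_right 0) (bridge_ratio lam pU T b s t x y) = l"
    using assms by (intro tendsto_Lim) simp_all
  then show ?thesis unfolding bridge_density_def using assms by auto
qed

lemma isCont_gauss: "isCont (gauss v) (z :: real ^ 'n)"
proof (cases "v = 0")
  case False
  then show ?thesis unfolding gauss_def[abs_def] by (intro continuous_intros) simp
qed (simp add: gauss_def[abs_def])

lemma gauss_pos: "0 < v \<Longrightarrow> 0 < gauss v z"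
  by (simp add: gauss_def)

text \<open>Conditioning a linear Gaussian step of variance \<open>c1\<close> on the value zero after a further step of variance
\<open>c2\<close>: completing the square in \<open>y\<close> gives a Gaussian density again, and the total variance \<open>c3\<close>
makes the constants match.\<close>

lemma gauss_bridge_product:
  fixes x y :: "real ^ 'n"
  assumes c: "0 < c1" "0 < c2" and c3: "c3 = c2 + e2\<^sup>2 * c1"
  shows "gauss c1 (y - e1 *\<^sub>R x) * (gauss c2 (- (e2 *\<^sub>R y)) / gauss c3 (- ((e1 * e2) *\<^sub>R x))) =
    gauss (c1 * c2 / c3) (y - (e1 * c2 / c3) *\<^sub>R x)"
proof -
  let ?p = "real CARD('n) / 2"
  have c3p: "0 < c3" using c by (simp add: c3 add_pos_nonneg)
  have nrm: "(norm (y - k *\<^sub>R x))\<^sup>2 = y \<bullet> y - 2 * k * (x \<bullet> y) + k\<^sup>2 * (x \<bullet> x)" for k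
    unfolding power2_norm_eq_inner
    by (simp add: inner_diff_left inner_diff_right inner_commute power2_eq_square algebra_simps)
  have sq: "(norm (- (k *\<^sub>R z)))\<^sup>2 = k\<^sup>2 * (z \<bullet> z)" for k and z :: "real ^ 'n"
    by (simp add: power_mult_distrib power2_norm_eq_inner)
  have quad: "- (n - 2 * e1 * i + e1\<^sup>2 * m) / (2 * c1) + (- (e2\<^sup>2 * n) / (2 * c2)) - (- ((e1 * e2)\<^sup>2 * m) / (2 * c3)) =
      - (n - 2 * (e1 * c2 / c3) * i + (e1 * c2 / c3)\<^sup>2 * m) / (2 * (c1 * c2 / c3))" for n i m :: real
  proof -
    have 1: "n / (2 * c1) + e2\<^sup>2 * n / (2 * c2) = n / (2 * (c1 * c2 / c3))"
      using c by (simp add: c3 field_simps)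
    have 2: "2 * e1 * i / (2 * c1) = 2 * (e1 * c2 / c3) * i / (2 * (c1 * c2 / c3))"
      using c c3p by (simp add: field_simps)
    have "e1\<^sup>2 * m / (2 * c1) - (e1 * e2)\<^sup>2 * m / (2 * c3) = e1\<^sup>2 * m * (c3 - e2\<^sup>2 * c1) / (2 * c1 * c3)"
      using c c3p by (simp add: field_simps power_mult_distrib)
    also have "c3 - e2\<^sup>2 * c1 = c2" by (simp add: c3)
    also have "e1\<^sup>2 * m * c2 / (2 * c1 * c3) = (e1 * c2 / c3)\<^sup>2 * m / (2 * (c1 * c2 / c3))"
      using c c3p by (simp add: field_simps power2_eq_square)
    finally have 3: "e1\<^sup>2 * m / (2 * c1) - (e1 * e2)\<^sup>2 * m / (2 * c3) = (e1 * c2 / c3)\<^sup>2 * m / (2 * (c1 * c2 / c3))" .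
    have "- (n - 2 * e1 * i + e1\<^sup>2 * m) / (2 * c1) + (- (e2\<^sup>2 * n) / (2 * c2)) - (- ((e1 * e2)\<^sup>2 * m) / (2 * c3)) =
      - (n / (2 * c1) + e2\<^sup>2 * n / (2 * c2)) + 2 * e1 * i / (2 * c1) - (e1\<^sup>2 * m / (2 * c1) - (e1 * e2)\<^sup>2 * m / (2 * c3))"
      unfolding minus_divide_left[symmetric] diff_divide_distrib add_divide_distrib by linarith
    also have "\<dots> = - (n - 2 * (e1 * c2 / c3) * i + (e1 * c2 / c3)\<^sup>2 * m) / (2 * (c1 * c2 / c3))"
      unfolding 1 2 3 minus_divide_left[symmetric] diff_divide_distrib add_divide_distrib by linarith
    finally show ?thesis .
  qed
  have pw: "(2 * pi * (c1 * c2 / c3)) powr ?p = (2 * pi * c1) powr ?p * (2 * pi * c2) powr ?p / (2 * pi * c3) powr ?p"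
  proof -
    have "2 * pi * (c1 * c2 / c3) = (2 * pi * c1) * (2 * pi * c2) / (2 * pi * c3)" by simp
    then show ?thesis using c c3p by (simp only: powr_mult powr_divide)
  qed
  have gen: "1 / p1 * x1 * (1 / p2 * x2 / (1 / p3 * x3)) = 1 / (p1 * p2 / p3) * (x1 * x2 / x3)" for p1 p2 p3 x1 x2 x3 :: real
    by (simp add: ac_simps)
  show ?thesis
    unfolding gauss_def gen pw nrm sq exp_add[symmetric] exp_diff[symmetric] quad ..
qed

text \<open>Numerator and denominator, divided by the volume of the ball, converge to the values of the two continuous
densities at the origin, and the second value is positive.\<close>

lemma ou_bridge_ratio_tendsto:
  fixes x y :: "real ^ 'n"
  assumes st: "0 \<le> s" "s < t" "t < T" and \<sigma>: "\<sigma> \<noteq> 0"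
  shows "(bridge_ratio lborel (ou_density a \<sigma>) T 0 s t x y \<longlongrightarrow>
    gauss (\<sigma>\<^sup>2 * kappa a (T - t)) (- (exp (a * (T - t)) *\<^sub>R y)) / gauss (\<sigma>\<^sup>2 * kappa a (T - s)) (- (exp (a * (T - s)) *\<^sub>R x)))
    (at_right 0)"
proof -
  have av: "((\<lambda>e. (LINT z:ball 0 e|lborel. ou_density a \<sigma> r x z) / measure lborel (ball (0 :: real ^ 'n) e)) \<longlongrightarrow>
      gauss (\<sigma>\<^sup>2 * kappa a r) (- (exp (a * r) *\<^sub>R x))) (at_right 0)" if r: "0 < r" for r and x :: "real ^ 'n"
  proof -
    have v: "0 < \<sigma>\<^sup>2 * kappa a r" using \<sigma> kappa_pos[OF r] by simp
    have "integrable lborel (ou_density a \<sigma> r x)"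
      using has_bochner_integral_gauss[OF v, of "exp (a * r) *\<^sub>R x"]
      by (simp add: ou_density_gauss[abs_def] has_bochner_integral_iff)
    moreover have "isCont (ou_density a \<sigma> r x) 0"
      unfolding ou_density_gauss[abs_def] by (intro isCont_o2[OF _ isCont_gauss] continuous_intros)
    ultimately show ?thesis using ball_average_tendsto[of "ou_density a \<sigma> r x" 0] by (simp add: ou_density_gauss)
  qed
  have "((\<lambda>e. ((LINT z:ball 0 e|lborel. ou_density a \<sigma> (T - t) y z) / measure lborel (ball (0 :: real ^ 'n) e)) /
      ((LINT z:ball 0 e|lborel. ou_density a \<sigma> (T - s) x z) / measure lborel (ball (0 :: real ^ 'n) e))) \<longlongrightarrow>
    gauss (\<sigma>\<^sup>2 * kappa a (T - t)) (- (exp (a * (T - t)) *\<^sub>R y)) / gauss (\<sigma>\<^sup>2 * kappa a (T - s)) (- (exp (a * (T - s)) *\<^sub>R x)))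
    (at_right 0)"
  proof (rule tendsto_divide[OF av av])
    have "0 < \<sigma>\<^sup>2 * kappa a (T - s)" using \<sigma> kappa_pos[of "T - s" a] st by simp
    then show "gauss (\<sigma>\<^sup>2 * kappa a (T - s)) (- (exp (a * (T - s)) *\<^sub>R x)) \<noteq> 0"
      using gauss_pos[of _ "- (exp (a * (T - s)) *\<^sub>R x)"] by (metis less_irrefl)
  qed (use st in auto)
  then show ?thesis
  proof (rule Lim_transform_eventually)
    show "\<forall>\<^sub>F e in at_right 0. ((LINT z:ball 0 e|lborel. ou_density a \<sigma> (T - t) y z) / measure lborel (ball (0 :: real ^ 'n) e)) /
      ((LINT z:ball 0 e|lborel. ou_density a \<sigma> (T - s) x z) / measure lborel (ball (0 :: real ^ 'n) e)) =
      bridge_ratio lborel (ou_density a \<sigma>) T 0 s t x y e"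
    proof (rule eventually_at_rightI[of 0 1])
      fix e :: real assume "e \<in> {0<..<1}"
      then have "0 < measure lborel (ball (0 :: real ^ 'n) e)" by (simp add: content_ball_pos)
      then show "((LINT z:ball 0 e|lborel. ou_density a \<sigma> (T - t) y z) / measure lborel (ball (0 :: real ^ 'n) e)) /
        ((LINT z:ball 0 e|lborel. ou_density a \<sigma> (T - s) x z) / measure lborel (ball (0 :: real ^ 'n) e)) =
        bridge_ratio lborel (ou_density a \<sigma>) T 0 s t x y e"
        by (simp add: bridge_ratio_def)
    qed simp
  qed
qed

definition bridge_var :: "real \<Rightarrow> real \<Rightarrow> real \<Rightarrow> real \<Rightarrow> real" where
  "bridge_var a T s t = kappa a (t - s) * kappa a (T - t) / kappa a (T - s)"

definition bridge_drift :: "real \<Rightarrow> real \<Rightarrow> real \<Rightarrow> real \<Rightarrow> real" where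
  "bridge_drift a T s t = exp (a * (t - s)) * kappa a (T - t) / kappa a (T - s)"

lemma ou_bridge_density:
  fixes x y :: "real ^ 'n"
  assumes st: "0 \<le> s" "s < t" "t < T" and \<sigma>: "\<sigma> \<noteq> 0"
  shows "bridge_density lborel (ou_density a \<sigma>) T 0 s t x y = gauss (\<sigma>\<^sup>2 * bridge_var a T s t) (y - bridge_drift a T s t *\<^sub>R x)"
proof -
  have k: "0 < kappa a (t - s)" "0 < kappa a (T - t)" "0 < kappa a (T - s)" using kappa_pos st by auto
  have "kappa a (T - s) = kappa a (T - t) + exp (2 * a * (T - t)) * kappa a (t - s)"
    using kappa_add[of a "t - s" "T - t"] by simp
  then have c3: "\<sigma>\<^sup>2 * kappa a (T - s) = \<sigma>\<^sup>2 * kappa a (T - t) + (exp (a * (T - t)))\<^sup>2 * (\<sigma>\<^sup>2 * kappa a (t - s))"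
    by (simp add: exp_double[symmetric] algebra_simps)
  have e3: "exp (a * (T - s)) = exp (a * (t - s)) * exp (a * (T - t))"
    by (simp add: exp_add[symmetric] algebra_simps)
  have v: "\<sigma>\<^sup>2 * kappa a (t - s) * (\<sigma>\<^sup>2 * kappa a (T - t)) / (\<sigma>\<^sup>2 * kappa a (T - s)) = \<sigma>\<^sup>2 * bridge_var a T s t"
    using \<sigma> by (simp add: bridge_var_def)
  have m: "exp (a * (t - s)) * (\<sigma>\<^sup>2 * kappa a (T - t)) / (\<sigma>\<^sup>2 * kappa a (T - s)) = bridge_drift a T s t"
    using \<sigma> by (simp add: bridge_drift_def)
  show ?thesis
    unfolding bridge_densityI[OF ou_bridge_ratio_tendsto[OF st \<sigma>]] ou_density_gauss e3
    by (subst gauss_bridge_product[OF _ _ c3]) (use k \<sigma> in \<open>simp_all only: v m, simp_all\<close>)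
qed

lemma bridge_var_pos: "0 \<le> s \<Longrightarrow> s < t \<Longrightarrow> t < T \<Longrightarrow> 0 < bridge_var a T s t"
  by (simp add: bridge_var_def kappa_pos)

lemma density_kernel_ou_bridge:
  assumes st: "0 \<le> s" "s < t" "t < T" and \<sigma>: "\<sigma> \<noteq> 0"
  shows "density_kernel lborel (bridge_density lborel (ou_density a \<sigma>) T 0 s t :: real ^ 'n \<Rightarrow> _)"
  unfolding ou_bridge_density[OF st \<sigma>, abs_def]
  using bridge_var_pos[OF st] \<sigma> by (intro density_kernel_gauss) simp

section \<open>Radial parts of Markov kernels and bridge densities\<close>

lemma space_half_line: "space half_line = {0..}"
  and sets_half_line: "sets half_line = sets (restrict_space borel {0..})"
  by (simp_all add: half_line_def space_restrict_space sets_restrict_space)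

lemma sets_half_line_iff: "A \<in> sets half_line \<longleftrightarrow> A \<subseteq> {0..} \<and> A \<in> sets borel"
  unfolding half_line_def by (subst sets_restrict_space_iff) auto

lemma sigma_finite_half_line: "sigma_finite_measure half_line"
  unfolding half_line_def by (rule sigma_finite_measure_restrict_space) (auto simp: lborel.sigma_finite_measure_axioms)

lemma polish_half_line: "polish_state_space half_line"
  unfolding polish_state_space_def
  using sigma_finite_half_line sets_half_line by (simp add: space_half_line complete_eq_closed)

lemma norm_half_line [measurable]: "norm \<in> measurable (lborel :: (real ^ 'n) measure) half_line"
  unfolding half_line_def by (rule measurable_restrict_space2) auto

lemma nn_integral_half_line: "(\<integral>\<^sup>+r. f r \<partial>half_line) = (\<integral>\<^sup>+r. f r * indicator {0..} r \<partial>lborel)"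
  unfolding half_line_def by (rule nn_integral_restrict_space) simp

lemma radial_density_push:
  fixes x :: "real ^ 'n"
  assumes \<sigma>: "\<sigma> \<noteq> 0" and t: "0 < t" and g: "g \<in> borel_measurable borel"
  shows "(\<integral>\<^sup>+y. ennreal (ou_density a \<sigma> t x y) * g (norm y) \<partial>lborel) =
    (\<integral>\<^sup>+r. ennreal (radial_density CARD('n) a \<sigma> t (norm x) r) * g r \<partial>half_line)"
proof -
  have c: "0 < \<sigma>\<^sup>2 * kappa a t" using \<sigma> kappa_pos[OF t] by simp
  show ?thesis
    unfolding ou_density_gauss norm_gauss_eq_radial[OF c g] nn_integral_half_line
    by (intro nn_integral_cong)
      (auto simp: radial_density_eq[OF _ c] split: split_indicator)
qed

lemma radial_density_measurable:
  assumes "0 < d" "\<sigma> \<noteq> 0" "0 < t"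
  shows "(\<lambda>(x, y). radial_density d a \<sigma> t x y) \<in> borel_measurable (half_line \<Otimes>\<^sub>M half_line)"
proof -
  have c: "0 < \<sigma>\<^sup>2 * kappa a t" using assms kappa_pos by simp
  have id: "(\<lambda>r. r) \<in> measurable half_line borel"
    unfolding half_line_def by (rule measurable_restrict_space1) simp
  have "(\<lambda>z. (fst z, snd z)) \<in> borel_measurable (half_line \<Otimes>\<^sub>M half_line)"
    by (intro borel_measurable_Pair measurable_compose[OF measurable_fst id] measurable_compose[OF measurable_snd id])
  from measurable_compose[OF this borel_measurable_continuous_onI[OF continuous_on_radial_kernel[OF assms(1) c, of "exp (a * t)"]]]
  have "(\<lambda>z. radial_kernel d (\<sigma>\<^sup>2 * kappa a t) (exp (a * t) * fst z) (snd z)) \<in> borel_measurable (half_line \<Otimes>\<^sub>M half_line)"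
    by simp
  then show ?thesis
    by (rule measurable_cong[THEN iffD1, rotated])
      (auto simp: space_pair_measure space_half_line radial_density_eq[OF assms(1) c])
qed

lemma radial_density_nonneg:
  assumes "0 < d" "\<sigma> \<noteq> 0" "0 < t" "0 \<le> x" "0 \<le> y"
  shows "0 \<le> radial_density d a \<sigma> t x y"
  using assms kappa_pos[of t a] by (simp add: radial_density_eq radial_kernel_nonneg)

text \<open>The total mass at radius \<open>r\<close> is computed from any vector of norm \<open>r\<close>.\<close>

lemma density_kernel_push:
  fixes q :: "real ^ 'n \<Rightarrow> real ^ 'n \<Rightarrow> real"
  assumes q: "density_kernel lborel q"
    and m: "(\<lambda>(x, y). q' x y) \<in> borel_measurable (half_line \<Otimes>\<^sub>M half_line)"
    and nn: "\<And>x y. 0 \<le> x \<Longrightarrow> 0 \<le> y \<Longrightarrow> 0 \<le> q' x y"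
    and push: "\<And>x g. g \<in> borel_measurable borel \<Longrightarrow>
      (\<integral>\<^sup>+y. ennreal (q x y) * g (norm y) \<partial>lborel) = (\<integral>\<^sup>+r. ennreal (q' (norm x) r) * g r \<partial>half_line)"
  shows "density_kernel half_line q'"
  unfolding density_kernel_def space_half_line
proof (intro conjI ballI)
  fix r :: real assume "r \<in> {0..}"
  then have r: "0 \<le> r" by simp
  \<comment> \<open>Any unit vector serves as the direction.\<close>
  define x :: "real ^ 'n" where "x = r *\<^sub>R axis undefined 1"
  have x: "norm x = r" using r by (simp add: x_def)
  show "has_bochner_integral half_line (q' r) 1"
  proof (rule has_bochner_integral_nn_integral)
    show "q' r \<in> borel_measurable half_line"
      using measurable_Pair2[OF m, of r] r by (simp add: space_half_line)
    show "AE y in half_line. 0 \<le> q' r y" using nn r by (intro AE_I2) (simp add: space_half_line)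
    have "(\<integral>\<^sup>+y. ennreal (q' r y) \<partial>half_line) = (\<integral>\<^sup>+y. ennreal (q x y) \<partial>lborel)"
      using push[of "\<lambda>_. 1" x] by (simp add: x)
    also have "\<dots> = (\<integral>\<^sup>+y. ennreal (q x y) * indicator UNIV y \<partial>lborel)" by simp
    also have "\<dots> = ennreal (LINT y:UNIV|lborel. q x y)"
      by (rule density_kernel_nn_integral(1)[OF q]) auto
    also have "(LINT y:UNIV|lborel. q x y) = 1"
      using q by (simp add: set_lebesgue_integral_def density_kernel_def has_bochner_integral_iff)
    finally show "(\<integral>\<^sup>+y. ennreal (q' r y) \<partial>half_line) = ennreal 1" .
  qed simp
qed (use m nn in auto)

lemma kernel_markov_norm:
  fixes X :: "real \<Rightarrow> 'w \<Rightarrow> real ^ 'n"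
  assumes km: "kernel_markov M lborel I X s t q"
    and X: "\<And>u. u \<in> I \<Longrightarrow> X u \<in> measurable M lborel" and st: "s \<in> I" "t \<in> I"
    and push: "\<And>x g. g \<in> borel_measurable borel \<Longrightarrow>
      (\<integral>\<^sup>+y. ennreal (q x y) * g (norm y) \<partial>lborel) = (\<integral>\<^sup>+r. ennreal (q' (norm x) r) * g r \<partial>half_line)"
  shows "kernel_markov M half_line I (\<lambda>u w. norm (X u w)) s t q'"
proof (rule kernel_markov_map[OF km norm_half_line X st])
  fix x :: "real ^ 'n" and A assume "A \<in> sets half_line"
  then have "(indicator A :: real \<Rightarrow> ennreal) \<in> borel_measurable borel"
    by (intro borel_measurable_indicator) (simp add: sets_half_line_iff)
  from push[OF this, of x]
  show "(\<integral>\<^sup>+y. ennreal (q x y) * indicator (norm -` A \<inter> space lborel) y \<partial>lborel) =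
      (\<integral>\<^sup>+z. ennreal (q' (norm x) z) * indicator A z \<partial>half_line)"
    by (simp add: indicator_def)
qed

lemma density_kernel_ou:
  assumes "\<sigma> \<noteq> 0" "0 < t"
  shows "density_kernel lborel (ou_density a \<sigma> t :: real ^ 'n \<Rightarrow> _)"
  unfolding ou_density_gauss[abs_def]
  using assms kappa_pos[of t a] by (intro density_kernel_gauss) simp

lemma density_kernel_radial:
  assumes "\<sigma> \<noteq> 0" "0 < t"
  shows "density_kernel half_line (radial_density CARD('n::finite) a \<sigma> t)"
proof (rule density_kernel_push[OF density_kernel_ou[OF assms, of a, where 'n='n]])
  show "(\<lambda>(x, y). radial_density CARD('n) a \<sigma> t x y) \<in> borel_measurable (half_line \<Otimes>\<^sub>M half_line)"
    by (rule radial_density_measurable) (use assms in auto)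
  show "0 \<le> radial_density CARD('n) a \<sigma> t x y" if "0 \<le> x" "0 \<le> y" for x y
    using that assms by (intro radial_density_nonneg) auto
qed (rule radial_density_push[OF assms])

definition gauss_radius :: "nat \<Rightarrow> real \<Rightarrow> real \<Rightarrow> real" where
  "gauss_radius d v r = 1 / (2 * pi * v) powr (real d / 2) * exp (- r\<^sup>2 / (2 * v))"

lemma gauss_eq_radius: "gauss v (x :: real ^ 'n) = gauss_radius CARD('n) v (norm x)"
  by (simp add: gauss_def gauss_radius_def)

text \<open>The limit that defines the bridge densities, written as a function of the norms of the two states.\<close>

definition bridge_tilt :: "nat \<Rightarrow> real \<Rightarrow> real \<Rightarrow> real \<Rightarrow> real \<Rightarrow> real \<Rightarrow> real \<Rightarrow> real \<Rightarrow> real" where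
  "bridge_tilt d a \<sigma> T s t x y =
     gauss_radius d (\<sigma>\<^sup>2 * kappa a (T - t)) (exp (a * (T - t)) * y) /
     gauss_radius d (\<sigma>\<^sup>2 * kappa a (T - s)) (exp (a * (T - s)) * x)"

lemma ou_bridge_ratio_tilt:
  fixes x y :: "real ^ 'n"
  assumes st: "0 \<le> s" "s < t" "t < T" and \<sigma>: "\<sigma> \<noteq> 0"
  shows "(bridge_ratio lborel (ou_density a \<sigma>) T 0 s t x y \<longlongrightarrow> bridge_tilt CARD('n) a \<sigma> T s t (norm x) (norm y)) (at_right 0)"
  using ou_bridge_ratio_tendsto[OF st \<sigma>, of a x y] by (simp add: bridge_tilt_def gauss_eq_radius)

text \<open>The preimage under the norm of a ball around zero in the half line is the ball of the same radius in
\<open>\<real>\<^sup>n\<close>, so numerators and denominators agree separately.\<close>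

lemma bridge_ratio_radial:
  fixes x y :: "real ^ 'n"
  assumes st: "0 \<le> s" "s < t" "t < T" and \<sigma>: "\<sigma> \<noteq> 0"
  shows "bridge_ratio half_line (radial_density CARD('n) a \<sigma>) T 0 s t (norm x) (norm y) =
    bridge_ratio lborel (ou_density a \<sigma>) T 0 s t x y"
proof -
  have "(LINT z:ball 0 e \<inter> space half_line|half_line. radial_density CARD('n) a \<sigma> r (norm x) z) =
      (LINT z:ball 0 e \<inter> space lborel|lborel. ou_density a \<sigma> r x z)" if r: "0 < r" for e r and x :: "real ^ 'n"
  proof -
    let ?A = "ball 0 e \<inter> {0..} :: real set"
    have A: "?A \<in> sets half_line" unfolding sets_half_line_iff by auto
    have g: "(indicator (ball 0 e) :: real \<Rightarrow> ennreal) \<in> borel_measurable borel"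
      by (intro borel_measurable_indicator) simp
    note k1 = density_kernel_nn_integral[OF density_kernel_radial[OF \<sigma> r, where 'n='n, of a] _ A, of "norm x"]
    note k2 = density_kernel_nn_integral[OF density_kernel_ou[OF \<sigma> r, where 'n='n, of a], of x "ball 0 e"]
    have "ennreal (LINT z:?A|half_line. radial_density CARD('n) a \<sigma> r (norm x) z) =
        (\<integral>\<^sup>+z. ennreal (radial_density CARD('n) a \<sigma> r (norm x) z) * indicator ?A z \<partial>half_line)"
      by (rule k1(1)[symmetric]) (simp add: space_half_line)
    also have "\<dots> = (\<integral>\<^sup>+z. ennreal (radial_density CARD('n) a \<sigma> r (norm x) z) * indicator (ball 0 e) z \<partial>half_line)"
      by (rule nn_integral_cong) (simp add: space_half_line indicator_def)
    also have "\<dots> = (\<integral>\<^sup>+y. ennreal (ou_density a \<sigma> r x y) * indicator (ball 0 e) (norm y) \<partial>lborel)"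
      by (rule radial_density_push[OF \<sigma> r g, symmetric])
    also have "\<dots> = (\<integral>\<^sup>+y. ennreal (ou_density a \<sigma> r x y) * indicator (ball 0 e) y \<partial>lborel)"
      by (rule nn_integral_cong) (simp add: indicator_def)
    also have "\<dots> = ennreal (LINT y:ball 0 e|lborel. ou_density a \<sigma> r x y)"
      by (rule k2(1)) auto
    finally show ?thesis
      using k1(2) k2(2) by (simp add: space_half_line)
  qed
  then show ?thesis using st by (intro ext) (simp add: bridge_ratio_def)
qed

lemma radial_bridge_density:
  assumes st: "0 \<le> s" "s < t" "t < T" and \<sigma>: "\<sigma> \<noteq> 0" and xy: "0 \<le> x" "0 \<le> y"
  shows "bridge_density half_line (radial_density CARD('n::finite) a \<sigma>) T 0 s t x y =
    radial_density CARD('n) a \<sigma> (t - s) x y * bridge_tilt CARD('n) a \<sigma> T s t x y"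
proof (rule bridge_densityI)
  let ?v = "\<lambda>r. r *\<^sub>R axis undefined 1 :: real ^ 'n"
  have n: "norm (?v x) = x" "norm (?v y) = y" using xy by simp_all
  show "(bridge_ratio half_line (radial_density CARD('n) a \<sigma>) T 0 s t x y \<longlongrightarrow> bridge_tilt CARD('n) a \<sigma> T s t x y) (at_right 0)"
    using ou_bridge_ratio_tilt[OF st \<sigma>, of a "?v x" "?v y"] bridge_ratio_radial[OF st \<sigma>, of a "?v x" "?v y"]
    unfolding n by simp
qed

text \<open>The factor \<open>bridge_tilt\<close> is a function of \<open>norm y\<close> and can be absorbed into the test function.\<close>

lemma radial_bridge_push:
  fixes x :: "real ^ 'n"
  assumes st: "0 \<le> s" "s < t" "t < T" and \<sigma>: "\<sigma> \<noteq> 0" and g[measurable]: "g \<in> borel_measurable borel"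
  shows "(\<integral>\<^sup>+y. ennreal (bridge_density lborel (ou_density a \<sigma>) T 0 s t x y) * g (norm y) \<partial>lborel) =
    (\<integral>\<^sup>+r. ennreal (bridge_density half_line (radial_density CARD('n) a \<sigma>) T 0 s t (norm x) r) * g r \<partial>half_line)"
proof -
  let ?L = "\<lambda>r. bridge_tilt CARD('n) a \<sigma> T s t (norm x) r"
  have L: "0 \<le> ?L r" for r by (simp add: bridge_tilt_def gauss_radius_def)
  have Lm[measurable]: "?L \<in> borel_measurable borel" unfolding bridge_tilt_def gauss_radius_def by measurable
  have mult: "ennreal (p * ?L r) * h = ennreal p * (ennreal (?L r) * h)" for p r h
    using ennreal_mult''[OF L] by (simp add: mult.assoc)
  have "(\<integral>\<^sup>+y. ennreal (bridge_density lborel (ou_density a \<sigma>) T 0 s t x y) * g (norm y) \<partial>lborel) =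
      (\<integral>\<^sup>+y. ennreal (ou_density a \<sigma> (t - s) x y) * (ennreal (?L (norm y)) * g (norm y)) \<partial>lborel)"
    unfolding bridge_densityI[OF ou_bridge_ratio_tilt[OF st \<sigma>]] mult ..
  also have "\<dots> = (\<integral>\<^sup>+r. ennreal (radial_density CARD('n) a \<sigma> (t - s) (norm x) r) * (ennreal (?L r) * g r) \<partial>half_line)"
    by (rule radial_density_push[OF \<sigma>, where g="\<lambda>r. ennreal (?L r) * g r"]) (use st in \<open>simp, measurable\<close>)
  also have "\<dots> = (\<integral>\<^sup>+r. ennreal (bridge_density half_line (radial_density CARD('n) a \<sigma>) T 0 s t (norm x) r) * g r \<partial>half_line)"
    by (rule nn_integral_cong) (simp add: space_half_line radial_bridge_density[OF st \<sigma>] mult)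
  finally show ?thesis .
qed

lemma density_kernel_radial_bridge:
  assumes st: "0 \<le> s" "s < t" "t < T" and \<sigma>: "\<sigma> \<noteq> 0"
  shows "density_kernel half_line (bridge_density half_line (radial_density CARD('n::finite) a \<sigma>) T 0 s t)"
proof (rule density_kernel_push[OF density_kernel_ou_bridge[OF st \<sigma>, of a, where 'n='n]])
  let ?R = "\<lambda>x y. radial_density CARD('n) a \<sigma> (t - s) x y * bridge_tilt CARD('n) a \<sigma> T s t x y"
  have id: "(\<lambda>r. r) \<in> measurable half_line borel"
    unfolding half_line_def by (rule measurable_restrict_space1) simp
  note [measurable] = measurable_compose[OF measurable_fst id] measurable_compose[OF measurable_snd id]
  have [measurable]: "(\<lambda>(x, y). radial_density CARD('n) a \<sigma> (t - s) x y) \<in> borel_measurable (half_line \<Otimes>\<^sub>M half_line)"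
    by (rule radial_density_measurable) (use st \<sigma> in auto)
  have [measurable]: "(\<lambda>(x, y). bridge_tilt CARD('n) a \<sigma> T s t x y) \<in> borel_measurable (half_line \<Otimes>\<^sub>M half_line)"
    unfolding bridge_tilt_def gauss_radius_def case_prod_beta by measurable
  have "(\<lambda>(x, y). ?R x y) \<in> borel_measurable (half_line \<Otimes>\<^sub>M half_line)"
    by measurable
  then show "(\<lambda>(x, y). bridge_density half_line (radial_density CARD('n) a \<sigma>) T 0 s t x y) \<in> borel_measurable (half_line \<Otimes>\<^sub>M half_line)"
    by (rule measurable_cong[THEN iffD1, rotated])
      (auto simp: space_pair_measure space_half_line radial_bridge_density[OF st \<sigma>])
  show "0 \<le> bridge_density half_line (radial_density CARD('n) a \<sigma>) T 0 s t x y" if "0 \<le> x" "0 \<le> y" for x y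
    using that radial_density_nonneg[of "CARD('n)" \<sigma> "t - s" x y a] st \<sigma>
    by (simp add: radial_bridge_density[OF st \<sigma>] bridge_tilt_def gauss_radius_def)
qed (rule radial_bridge_push[OF st \<sigma>])

section \<open>Construction of the bridges\<close>

definition bridge_scale :: "real \<Rightarrow> real \<Rightarrow> real \<Rightarrow> real" where
  "bridge_scale a T t = exp (a * t) * kappa a (T - t)"

text \<open>Together with \<open>bridge_scale\<close>, this is a solution of the two equations in \<open>bridge_scale_clock\<close>: the ratio
of the scales is the drift coefficient of the bridge, and the scaled increments of the clock are its
variances. The clock runs from zero at time zero to infinity at time \<open>T\<close>.\<close>

definition bridge_clock :: "real \<Rightarrow> real \<Rightarrow> real \<Rightarrow> real" where
  "bridge_clock a T t = exp (- 2 * a * T) * (1 / kappa a (T - t) - 1 / kappa a T)"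

lemma bridge_clock_diff:
  assumes st: "0 \<le> s" "s < t" "t < T"
  shows "bridge_clock a T t - bridge_clock a T s = exp (- 2 * a * t) * kappa a (t - s) / (kappa a (T - t) * kappa a (T - s))"
proof -
  have k: "0 < kappa a (T - t)" "0 < kappa a (T - s)" using kappa_pos st by auto
  have "kappa a (T - s) = kappa a (T - t) + exp (2 * a * (T - t)) * kappa a (t - s)"
    using kappa_add[of a "t - s" "T - t"] by simp
  then have e: "kappa a (T - s) - kappa a (T - t) = exp (2 * a * (T - t)) * kappa a (t - s)" by simp
  have "bridge_clock a T t - bridge_clock a T s = exp (- 2 * a * T) * (1 / kappa a (T - t) - 1 / kappa a (T - s))"
    by (simp add: bridge_clock_def algebra_simps)
  also have "1 / kappa a (T - t) - 1 / kappa a (T - s) = (kappa a (T - s) - kappa a (T - t)) / (kappa a (T - t) * kappa a (T - s))"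
    using k by (simp add: field_simps)
  also have "exp (- 2 * a * T) * \<dots> = (exp (- 2 * a * T) * exp (2 * a * (T - t))) * kappa a (t - s) / (kappa a (T - t) * kappa a (T - s))"
    unfolding e by simp
  also have "exp (- 2 * a * T) * exp (2 * a * (T - t)) = exp (- 2 * a * t)"
    by (simp add: exp_add[symmetric] algebra_simps)
  finally show ?thesis .
qed

lemma bridge_clock_mono:
  assumes "0 \<le> s" "s < t" "t < T" shows "bridge_clock a T s < bridge_clock a T t"
proof -
  have "0 < exp (- 2 * a * t) * kappa a (t - s) / (kappa a (T - t) * kappa a (T - s))"
    using assms by (intro divide_pos_pos mult_pos_pos kappa_pos) auto
  then show ?thesis using bridge_clock_diff[OF assms, of a] by simp
qed

lemma bridge_clock_0: "bridge_clock a T 0 = 0"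
  by (simp add: bridge_clock_def)

lemma bridge_clock_nonneg: "0 \<le> t \<Longrightarrow> t < T \<Longrightarrow> 0 \<le> bridge_clock a T t"
  using bridge_clock_mono[of 0 t T a] bridge_clock_0[of a T] by (cases "t = 0") auto

lemma bridge_scale_clock:
  assumes st: "0 \<le> s" "s < t" "t < T"
  shows "(bridge_scale a T t)\<^sup>2 * (bridge_clock a T t - bridge_clock a T s) = bridge_var a T s t"
    and "bridge_scale a T t = bridge_drift a T s t * bridge_scale a T s"
proof -
  have k: "0 < kappa a (T - t)" "0 < kappa a (T - s)" using kappa_pos st by auto
  have e: "(exp (a * t))\<^sup>2 * exp (- 2 * a * t) = 1"
    by (simp add: exp_double[symmetric] exp_add[symmetric])
  have "(bridge_scale a T t)\<^sup>2 * (bridge_clock a T t - bridge_clock a T s) =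
      ((exp (a * t))\<^sup>2 * exp (- 2 * a * t)) * ((kappa a (T - t))\<^sup>2 * kappa a (t - s) / (kappa a (T - t) * kappa a (T - s)))"
    unfolding bridge_clock_diff[OF st] bridge_scale_def by (simp add: power_mult_distrib)
  also have "\<dots> = bridge_var a T s t"
    unfolding e bridge_var_def using k by (simp add: power2_eq_square)
  finally show "(bridge_scale a T t)\<^sup>2 * (bridge_clock a T t - bridge_clock a T s) = bridge_var a T s t" .
  have "exp (a * t) = exp (a * (t - s)) * exp (a * s)" by (simp add: exp_add[symmetric] algebra_simps)
  then show "bridge_scale a T t = bridge_drift a T s t * bridge_scale a T s"
    using k by (simp add: bridge_scale_def bridge_drift_def)
qed

definition ou_bridge :: "(real \<Rightarrow> 'w \<Rightarrow> real ^ 'n) \<Rightarrow> real \<Rightarrow> real \<Rightarrow> real \<Rightarrow> real \<Rightarrow> 'w \<Rightarrow> real ^ 'n" where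
  "ou_bridge W a \<sigma> T t w =
     (if 0 \<le> t \<and> t < T then (\<sigma> * bridge_scale a T t) *\<^sub>R W (bridge_clock a T t) w else 0)"

lemma ou_bridge_measurable:
  assumes W: "wiener_process N W" shows "ou_bridge W a \<sigma> T t \<in> borel_measurable N"
proof (cases "0 \<le> t \<and> t < T")
  case True
  then have "W (bridge_clock a T t) \<in> borel_measurable N"
    using wiener_measurable[OF W bridge_clock_nonneg] by blast
  then show ?thesis using True unfolding ou_bridge_def[abs_def] by simp
next
  case False
  then have "ou_bridge W a \<sigma> T t = (\<lambda>_. 0)" by (auto simp: ou_bridge_def)
  then show ?thesis by simp
qed

text \<open>The process is a deterministically scaled Wiener process in a new time, so its innovations are
increments of \<open>W\<close> that are independent of the past.\<close>

lemma ou_bridge_kernel_markov: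
  fixes W :: "real \<Rightarrow> 'w \<Rightarrow> real ^ 'n"
  assumes W: "wiener_process N W" and \<sigma>: "\<sigma> \<noteq> 0" and st: "0 \<le> s" "s < t" "t < T"
  shows "kernel_markov N lborel {0..T} (ou_bridge W a \<sigma> T) s t (bridge_density lborel (ou_density a \<sigma>) T 0 s t)"
  unfolding ou_bridge_density[OF st \<sigma>, abs_def]
proof -
  let ?X = "ou_bridge W a \<sigma> T" and ?F = "past_sigma N borel {0..} W (bridge_clock a T s)"
  let ?c = "\<sigma> * bridge_scale a T t"
  have s0: "0 \<le> bridge_clock a T s" using st by (intro bridge_clock_nonneg) auto
  have c: "?c \<noteq> 0" using \<sigma> kappa_pos[of "T - t" a] st by (simp add: bridge_scale_def)
  have G: "indep_gaussian N ?F (\<lambda>w. ?c *\<^sub>R (W (bridge_clock a T t) w - W (bridge_clock a T s) w)) (\<sigma>\<^sup>2 * bridge_var a T s t)"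
    using indep_gaussian_scale[OF wiener_increment_gaussian[OF W s0 bridge_clock_mono[OF st]] c]
    by (simp add: power_mult_distrib mult.assoc bridge_scale_clock(1)[OF st])
  have adapted: "?X u \<in> borel_measurable ?F" if "0 \<le> u" "u \<le> s" for u
  proof -
    have "W (bridge_clock a T u) \<in> borel_measurable ?F"
    proof (rule measurable_wiener_past[OF W])
      show "0 \<le> bridge_clock a T u" using that st by (intro bridge_clock_nonneg) auto
      show "bridge_clock a T u \<le> bridge_clock a T s"
        using bridge_clock_mono[of u s T a] that st by (cases "u = s") auto
    qed
    then show ?thesis using that st unfolding ou_bridge_def[abs_def] by simp
  qed
  show "kernel_markov N lborel {0..T} ?X s t (\<lambda>x y. gauss (\<sigma>\<^sup>2 * bridge_var a T s t) (y - bridge_drift a T s t *\<^sub>R x))"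
  proof (rule kernel_markov_indep_gaussian[OF wiener_prob_space[OF W] subalgebra_wiener_past[OF W] G])
    show "sets (past_sigma N lborel {0..T} ?X s) \<subseteq> sets ?F"
    proof (rule past_sigma_subset)
      fix u and A :: "(real ^ 'n) set" assume u: "u \<in> {0..T}" "u \<le> s" and A: "A \<in> sets lborel"
      have "?X u \<in> borel_measurable ?F" using u by (intro adapted) auto
      from measurable_sets[OF this, of A] A show "?X u -` A \<inter> space N \<in> sets ?F" by simp
    qed simp
    show "?X s \<in> borel_measurable ?F" using st by (intro adapted) auto
    show "?X t \<in> borel_measurable N" by (rule ou_bridge_measurable[OF W])
    show "AE w in N. ?X t w = bridge_drift a T s t *\<^sub>R ?X s w +
        ?c *\<^sub>R (W (bridge_clock a T t) w - W (bridge_clock a T s) w)"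
      using st by (simp add: ou_bridge_def bridge_scale_clock(2)[OF st] scaleR_diff_right mult.commute mult.left_commute)
  qed
qed

text \<open>The bridge is realized as a coordinate process, because its sample space is prescribed to be a space
of paths.\<close>

lemma is_bridge_path_space:
  fixes lam :: "'e::{metric_space, second_countable_topology} measure"
  assumes U: "homogeneous_markov_process N lam T U pU"
    and M: "prob_space M" and V: "\<And>u. V u \<in> measurable M lam"
    and \<alpha>: "\<alpha> \<in> space lam" and b: "b \<in> space lam" and T: "0 < T"
    and q: "\<And>s t. 0 \<le> s \<Longrightarrow> s < t \<Longrightarrow> t < T \<Longrightarrow> density_kernel lam (bridge_density lam pU T b s t)"
    and km: "\<And>s t. 0 \<le> s \<Longrightarrow> s < t \<Longrightarrow> t < T \<Longrightarrow> kernel_markov M lam {0..T} V s t (bridge_density lam pU T b s t)"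
    and start: "AE w in M. V 0 w = \<alpha>" and finish: "AE w in M. V T w = b"
  shows "is_bridge N U lam pU T \<alpha> b (distr M (Pi\<^sub>M UNIV (\<lambda>_. lam)) (\<lambda>w u. V u w)) (\<lambda>u x. x u)"
    (is "is_bridge _ _ _ _ _ _ _ ?P ?X")
proof -
  have lam: "sigma_finite_measure lam" and slam: "sets lam = sets (restrict_space borel (space lam))"
    using U by (auto simp: homogeneous_markov_process_def polish_state_space_def)
  have h: "(\<lambda>w u. V u w) \<in> measurable M (Pi\<^sub>M UNIV (\<lambda>_. lam))"
    using measurable_PiM_single'[of UNIV "\<lambda>u w. V u w" M "\<lambda>_. lam"] V
    by (auto simp: PiE_def dest: measurable_space)
  have P: "prob_space ?P" by (rule prob_space.prob_space_distr[OF M h])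
  have X: "?X u \<in> measurable ?P lam" for u
    unfolding measurable_distr_eq1 by (rule measurable_component_singleton) simp
  have ae: "AE x in ?P. ?X u x = c" if c: "c \<in> space lam" and "AE w in M. V u w = c" for u c
  proof (subst AE_distr_iff[OF h])
    have "{c} \<in> sets lam"
      unfolding slam using c by (auto simp: sets_restrict_space intro!: image_eqI[of _ _ "{c}"])
    then have "?X u -` {c} \<inter> space (Pi\<^sub>M UNIV (\<lambda>_. lam)) \<in> sets (Pi\<^sub>M UNIV (\<lambda>_. lam))"
      by (intro measurable_sets[OF measurable_component_singleton]) auto
    moreover have "?X u -` {c} \<inter> space (Pi\<^sub>M UNIV (\<lambda>_. lam)) = {x \<in> space (Pi\<^sub>M UNIV (\<lambda>_. lam)). x u = c}" by auto
    ultimately show "{x \<in> space (Pi\<^sub>M UNIV (\<lambda>_. lam)). x u = c} \<in> sets (Pi\<^sub>M UNIV (\<lambda>_. lam))" by simp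
  qed (use that in auto)
  have kmP: "kernel_markov ?P lam {0..T} ?X s t (bridge_density lam pU T b s t)" if "0 \<le> s" "s < t" "t < T" for s t
    by (rule kernel_markov_path_space[OF M lam V q[OF that] km[OF that]])
  have end_c: "(AE x in ?P. ?X t x = b) \<and> (\<forall>s\<in>{0..<T}. s < t)" if "t \<in> {0..T} - {0..<T}" for t
  proof -
    have "t = T" using that by auto
    then show ?thesis using ae[OF b finish] by auto
  qed
  have mt: "markov_process ?P lam {0..T} ?X" "transition_densities ?P lam {0..<T} ?X (bridge_density lam pU T b)"
  proof -
    have sub: "{0..<T} \<subseteq> {0..T}" by auto
    have q': "density_kernel lam (bridge_density lam pU T b s t)" if "s \<in> {0..<T}" "t \<in> {0..<T}" "s < t" for s t
      using that by (intro q) auto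
    have k': "kernel_markov ?P lam {0..T} ?X s t (bridge_density lam pU T b s t)"
      if "s \<in> {0..<T}" "t \<in> {0..<T}" "s < t" for s t
      using that by (intro kmP) auto
    note * = markov_process_of_kernel[where V="?X" and p="bridge_density lam pU T b" and c=b, OF P lam X sub q' k' end_c]
    show "markov_process ?P lam {0..T} ?X" "transition_densities ?P lam {0..<T} ?X (bridge_density lam pU T b)"
      by (rule *; assumption)+
  qed
  show ?thesis
    unfolding is_bridge_def using U \<alpha> b mt ae[OF \<alpha> start] ae[OF b finish] by auto
qed

section \<open>Radial parts of bridges and their laws\<close>

lemma path_law_unique:
  fixes V :: "real \<Rightarrow> 'w \<Rightarrow> 'e" and V' :: "real \<Rightarrow> 'v \<Rightarrow> 'e"
  assumes M: "prob_space M" "prob_space M'" and lam: "sigma_finite_measure lam" and T: "0 < T"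
    and V: "\<And>u. u \<in> {0..T} \<Longrightarrow> V u \<in> measurable M lam" "\<And>u. u \<in> {0..T} \<Longrightarrow> V' u \<in> measurable M' lam"
    and q: "\<And>s t. s \<in> {0..<T} \<Longrightarrow> t \<in> {0..<T} \<Longrightarrow> s < t \<Longrightarrow> density_kernel lam (p s t)"
    and km: "\<And>s t. s \<in> {0..<T} \<Longrightarrow> t \<in> {0..<T} \<Longrightarrow> s < t \<Longrightarrow> kernel_markov M lam {0..T} V s t (p s t)"
      "\<And>s t. s \<in> {0..<T} \<Longrightarrow> t \<in> {0..<T} \<Longrightarrow> s < t \<Longrightarrow> kernel_markov M' lam {0..T} V' s t (p s t)"
    and start: "AE w in M. V 0 w = \<alpha>" "AE w in M'. V' 0 w = \<alpha>"
    and finish: "AE w in M. V T w = b" "AE w in M'. V' T w = b"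
    and S: "sets S = sets lam"
  shows "path_law M S {0..T} V = path_law M' S {0..T} V'"
proof (rule path_law_eqI[OF M])
  show "V u \<in> measurable M S" "V' u \<in> measurable M' S" if "u \<in> {0..T}" for u
    using V[OF that] by (simp_all cong: measurable_cong_sets add: S)
  fix K :: "real set" and f :: "real \<Rightarrow> 'e \<Rightarrow> ennreal"
  assume K: "finite K" "K \<subseteq> {0..T}" and f: "\<And>u. f u \<in> borel_measurable S"
  have fl: "f u \<in> borel_measurable lam" for u using f[of u] by (simp cong: measurable_cong_sets add: S)
  have K': "finite (K - {T})" "K - {T} \<subseteq> {0..<T}" using K by force+
  have eq: "(\<integral>\<^sup>+w. (\<Prod>u\<in>K - {T}. f u (V u w)) \<partial>M) = (\<integral>\<^sup>+w. (\<Prod>u\<in>K - {T}. f u (V' u w)) \<partial>M')"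
    by (rule fdd_unique[OF M lam V q km _ _ _ start K' fl]) (use T in auto)
  show "(\<integral>\<^sup>+w. (\<Prod>u\<in>K. f u (V u w)) \<partial>M) = (\<integral>\<^sup>+w. (\<Prod>u\<in>K. f u (V' u w)) \<partial>M')"
  proof (cases "T \<in> K")
    case True
    have split: "(\<Prod>u\<in>K. h u) = h T * (\<Prod>u\<in>K - {T}. h u)" for h :: "real \<Rightarrow> ennreal"
      using K(1) True by (rule prod.remove)
    have m: "(\<lambda>w. \<Prod>u\<in>K - {T}. f u (V u w)) \<in> borel_measurable M" "(\<lambda>w. \<Prod>u\<in>K - {T}. f u (V' u w)) \<in> borel_measurable M'"
      using K by (auto intro!: borel_measurable_prod_ennreal measurable_compose[OF V(1) fl] measurable_compose[OF V(2) fl])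
    have "(\<integral>\<^sup>+w. (\<Prod>u\<in>K. f u (V u w)) \<partial>M) = (\<integral>\<^sup>+w. f T b * (\<Prod>u\<in>K - {T}. f u (V u w)) \<partial>M)"
      unfolding split using finish(1) by (intro nn_integral_cong_AE) auto
    also have "\<dots> = (\<integral>\<^sup>+w. f T b * (\<Prod>u\<in>K - {T}. f u (V' u w)) \<partial>M')"
      unfolding nn_integral_cmult[OF m(1)] nn_integral_cmult[OF m(2)] eq ..
    also have "\<dots> = (\<integral>\<^sup>+w. (\<Prod>u\<in>K. f u (V' u w)) \<partial>M')"
      unfolding split using finish(2) by (intro nn_integral_cong_AE) auto
    finally show ?thesis .
  next
    case False
    then show ?thesis using eq by simp
  qed
qed

lemma is_bridge_kernel_markov:
  assumes B: "is_bridge N U lam pU T \<alpha> b M V" and st: "0 \<le> s" "s < t" "t < T"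
  shows "kernel_markov M lam {0..T} V s t (bridge_density lam pU T b s t)"
proof (rule kernel_markov_of_markov_process(2))
  show "sigma_finite_measure lam" "markov_process M lam {0..T} V"
    "transition_densities M lam {0..<T} V (bridge_density lam pU T b)"
    using B by (auto simp: is_bridge_def homogeneous_markov_process_def polish_state_space_def)
qed (use st in auto)

lemma radial_homogeneous_markov:
  fixes Z :: "real \<Rightarrow> 'w \<Rightarrow> real ^ 'n"
  assumes Z: "homogeneous_markov_process N lborel T Z (ou_density a \<sigma>)" and \<sigma>: "\<sigma> \<noteq> 0"
  shows "homogeneous_markov_process N half_line T (\<lambda>t w. norm (Z t w)) (radial_density CARD('n) a \<sigma>)"
proof -
  have mp: "markov_process N lborel {0..T} Z" and td: "transition_densities N lborel {0..T} Z (\<lambda>s t. ou_density a \<sigma> (t - s))"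
    using Z by (auto simp: homogeneous_markov_process_def)
  have N: "prob_space N" and Zm: "\<And>u. u \<in> {0..T} \<Longrightarrow> Z u \<in> measurable N lborel"
    using mp by (auto simp: markov_process_def)
  have km: "kernel_markov N half_line {0..T} (\<lambda>t w. norm (Z t w)) s t (radial_density CARD('n) a \<sigma> (t - s))"
    if st: "s \<in> {0..T}" "t \<in> {0..T}" "s < t" for s t
    by (rule kernel_markov_norm[OF kernel_markov_of_markov_process(2)[OF lborel.sigma_finite_measure_axioms mp td st order_refl] Zm st(1,2)])
      (use radial_density_push[OF \<sigma>, of "t - s"] st in auto)
  have nm: "(\<lambda>w. norm (Z u w)) \<in> measurable N half_line" if "u \<in> {0..T}" for u
    by (rule measurable_compose[OF Zm[OF that] norm_half_line])
  have dk: "density_kernel half_line (radial_density CARD('n) a \<sigma> (t - s))" if "s < t" for s t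
    by (rule density_kernel_radial[OF \<sigma>]) (use that in simp)
  show ?thesis
    unfolding homogeneous_markov_process_def
    by (intro conjI polish_half_line;
        (rule markov_process_of_kernel[where I="{0..T}" and J="{0..T}" and c=0, OF N sigma_finite_half_line])?;
        use nm km dk in auto)
qed

theorem mainTheorem4:
  fixes a \<sigma> T :: real
    and N :: "'w measure"
    and W Z :: "real \<Rightarrow> 'w \<Rightarrow> real ^ 'n"
    and R :: "real \<Rightarrow> 'w \<Rightarrow> real"
  assumes "\<sigma> \<noteq> 0" and "T > 0"
    and "wiener_process N W"
    and "ou_solution N W a \<sigma> Z" and "AE w in N. Z 0 w = 0"
    and "\<And>t w. R t w = norm (Z t w)"
  shows "(\<exists>(M :: (real \<Rightarrow> real ^ 'n) measure) X.
           is_bridge N Z lborel (ou_density a \<sigma>) T 0 0 M X) \<and>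
         (\<exists>(M' :: (real \<Rightarrow> real) measure) Y.
           is_bridge N R half_line (radial_density CARD('n) a \<sigma>) T 0 0 M' Y) \<and>
         (\<forall>(M :: 'u measure) X (M' :: 'v measure) Y.
           is_bridge N Z lborel (ou_density a \<sigma>) T 0 0 M X \<longrightarrow>
           is_bridge N R half_line (radial_density CARD('n) a \<sigma>) T 0 0 M' Y \<longrightarrow>
           (let q = bridge_density half_line (radial_density CARD('n) a \<sigma>) T 0 in
             markov_process M half_line {0..T} (\<lambda>t w. norm (X t w)) \<and>
             transition_densities M half_line {0..<T} (\<lambda>t w. norm (X t w)) q \<and>
             markov_process M' half_line {0..T} Y \<and>
             transition_densities M' half_line {0..<T} Y q) \<and>
           path_law M (restrict_space borel {0..}) {0..T} (\<lambda>t w. norm (X t w)) =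
           path_law M' (restrict_space borel {0..}) {0..T} Y)"
proof (intro conjI allI impI)
  note \<sigma> = assms(1) and T = assms(2) and W = assms(3)
  let ?p = "ou_density a \<sigma> :: real \<Rightarrow> real ^ 'n \<Rightarrow> real ^ 'n \<Rightarrow> real" and ?r = "radial_density CARD('n) a \<sigma>"
  let ?q = "bridge_density half_line ?r T 0" and ?X = "ou_bridge W a \<sigma> T"
  have R: "R = (\<lambda>t w. norm (Z t w))" using assms(6) by auto
  have Zh: "homogeneous_markov_process N lborel T Z ?p"
    by (rule ou_homogeneous_markov[OF W assms(4) \<sigma> assms(5)])
  have Rh: "homogeneous_markov_process N half_line T R ?r"
    unfolding R by (rule radial_homogeneous_markov[OF Zh \<sigma>])
  have N: "prob_space N" by (rule wiener_prob_space[OF W])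
  have Xm: "?X u \<in> measurable N lborel" for u using ou_bridge_measurable[OF W] by simp
  have X0: "AE w in N. ?X 0 w = 0"
  proof -
    have "AE w in N. W 0 w = 0" using W by (auto simp: wiener_process_def)
    then show ?thesis by eventually_elim (simp add: ou_bridge_def bridge_clock_0)
  qed
  have XT: "AE w in N. ?X T w = 0" by (simp add: ou_bridge_def)
  note kX = ou_bridge_kernel_markov[OF W \<sigma>, where a=a and T=T]
  have "is_bridge N Z lborel ?p T 0 0 (distr N (Pi\<^sub>M UNIV (\<lambda>_. lborel)) (\<lambda>w u. ?X u w)) (\<lambda>u x. x u)"
    by (rule is_bridge_path_space[OF Zh N Xm _ _ T density_kernel_ou_bridge[OF _ _ _ \<sigma>] kX X0 XT]) simp_all
  then show "\<exists>(M :: (real \<Rightarrow> real ^ 'n) measure) X. is_bridge N Z lborel ?p T 0 0 M X" by blast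
  have "is_bridge N R half_line ?r T 0 0 (distr N (Pi\<^sub>M UNIV (\<lambda>_. half_line)) (\<lambda>w u. norm (?X u w))) (\<lambda>u x. x u)"
  proof (rule is_bridge_path_space[OF Rh N _ _ _ T density_kernel_radial_bridge[OF _ _ _ \<sigma>]])
    show "(\<lambda>w. norm (?X u w)) \<in> measurable N half_line" for u
      by (rule measurable_compose[OF Xm norm_half_line])
    show "kernel_markov N half_line {0..T} (\<lambda>u w. norm (?X u w)) s t (?q s t)" if "0 \<le> s" "s < t" "t < T" for s t
      by (rule kernel_markov_norm[OF kX[OF that] Xm _ _ radial_bridge_push[OF that \<sigma>]]) (use that in auto)
    show "AE w in N. norm (?X 0 w) = 0" "AE w in N. norm (?X T w) = 0" using X0 XT by auto
  qed (simp_all add: space_half_line)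
  then show "\<exists>(M' :: (real \<Rightarrow> real) measure) Y. is_bridge N R half_line ?r T 0 0 M' Y" by blast
  fix M :: "'u measure" and X and M' :: "'v measure" and Y
  assume BX: "is_bridge N Z lborel ?p T 0 0 M X" and BY: "is_bridge N R half_line ?r T 0 0 M' Y"
  have MX: "prob_space M" "\<And>u. u \<in> {0..T} \<Longrightarrow> X u \<in> measurable M lborel"
    "AE w in M. X 0 w = 0" "AE w in M. X T w = 0"
    using BX by (auto simp: is_bridge_def markov_process_def)
  have MY: "prob_space M'" "\<And>u. u \<in> {0..T} \<Longrightarrow> Y u \<in> measurable M' half_line"
    "AE w in M'. Y 0 w = 0" "AE w in M'. Y T w = 0"
    using BY by (auto simp: is_bridge_def markov_process_def)
  let ?V = "\<lambda>t w. norm (X t w)"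
  have Vm: "?V u \<in> measurable M half_line" if "u \<in> {0..T}" for u
    by (rule measurable_compose[OF MX(2)[OF that] norm_half_line])
  have V0: "AE w in M. ?V 0 w = 0" and VT: "AE w in M. ?V T w = 0" using MX(3,4) by auto
  have dq: "density_kernel half_line (?q s t)" if "s \<in> {0..<T}" "t \<in> {0..<T}" "s < t" for s t
    by (rule density_kernel_radial_bridge[OF _ _ _ \<sigma>]) (use that in auto)
  have kV: "kernel_markov M half_line {0..T} ?V s t (?q s t)" if st: "s \<in> {0..<T}" "t \<in> {0..<T}" "s < t" for s t
  proof -
    have st': "0 \<le> s" "s < t" "t < T" using st by auto
    show ?thesis
      by (rule kernel_markov_norm[OF is_bridge_kernel_markov[OF BX st'] MX(2) _ _ radial_bridge_push[OF st' \<sigma>]])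
        (use st in auto)
  qed
  have kY: "kernel_markov M' half_line {0..T} Y s t (?q s t)" if "s \<in> {0..<T}" "t \<in> {0..<T}" "s < t" for s t
    by (rule is_bridge_kernel_markov[OF BY]) (use that in auto)
  have end_c: "(AE w in M. ?V t w = 0) \<and> (\<forall>s\<in>{0..<T}. s < t)" if "t \<in> {0..T} - {0..<T}" for t
  proof -
    have "t = T" using that by auto
    then show ?thesis using VT by auto
  qed
  have "markov_process M half_line {0..T} ?V" "transition_densities M half_line {0..<T} ?V ?q"
  proof -
    have sub: "{0..<T} \<subseteq> {0..T}" by auto
    note * = markov_process_of_kernel[where V="?V" and p="?q" and c=0, OF MX(1) sigma_finite_half_line Vm sub dq kV end_c]
    show "markov_process M half_line {0..T} ?V" "transition_densities M half_line {0..<T} ?V ?q"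
      by (rule *; assumption)+
  qed
  moreover have "markov_process M' half_line {0..T} Y" "transition_densities M' half_line {0..<T} Y ?q"
    using BY by (auto simp: is_bridge_def)
  ultimately show "let q = ?q in
      markov_process M half_line {0..T} ?V \<and> transition_densities M half_line {0..<T} ?V q \<and>
      markov_process M' half_line {0..T} Y \<and> transition_densities M' half_line {0..<T} Y q"
    by (simp add: Let_def)
  show "path_law M (restrict_space borel {0..}) {0..T} ?V = path_law M' (restrict_space borel {0..}) {0..T} Y"
    by (rule path_law_unique[OF MX(1) MY(1) sigma_finite_half_line T Vm MY(2) dq kV kY V0 MY(3) VT MY(4)])
      (simp_all add: sets_half_line)
qed

end
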